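(* Let $G$ be a finite group, and assume that (NPQ) holds for every almost simple homomorphic image of $G$. Then (NPQ) holds for $G$.
   Context: For a group $X$ (possibly infinite), $\pi(X)$ denotes the set of primes $p$ such that $X$ has an element of order $p$. The N-prime graph $\Gamma_{\mathrm N}(X)$ of $X$ is the simple directed graph with vertex set $\pi(X)$ in which, for distinct vertices $p$ and $q$, there is an arc $q\rightarrow p$ if and only if there exists an element $x\in X$ of order $p$ such that $\langle x\rangle$ is normalized by some element $y\in X$ of order $q$. For a finite group $G$, $V(\mathbb{Z}G)$ denotes the group of units of augmentation $1$ in the integral group ring $\mathbb{Z}G$. We say that (NPQ) holds for a finite group $G$ if $\Gamma_{\mathrm N}(G)=\Gamma_{\mathrm N}(V(\mathbb{Z}G))$. *)

theory Defs
  imports "HOL-Algebra.Algebra" "Graph_Theory.Pair_Digraph"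
begin

section \<open>The N-prime graph of a group\<close>

text \<open>The function \<open>group.ord\<close> is \<open>0\<close> on elements of infinite order, so the definitions in
  this section are also right for infinite groups.\<close>

definition prime_set :: "('a, 'b) monoid_scheme \<Rightarrow> nat set" where
  "prime_set A = {p. Factorial_Ring.prime p \<and> (\<exists>x \<in> carrier A. group.ord A x = p)}"

text \<open>The pair \<open>(q, p)\<close> stands for the arc from \<open>q\<close> to \<open>p\<close>: the first component is the order
  of the normalizing element \<open>y\<close>.\<close>

definition N_prime_graph :: "('a, 'b) monoid_scheme \<Rightarrow> nat pair_pre_digraph" where
  "N_prime_graph A =
     \<lparr>pverts = prime_set A,
      parcs = {(q, p). q \<in> prime_set A \<and> p \<in> prime_set A \<and> q \<noteq> p \<and>
        (\<exists>x \<in> carrier A. group.ord A x = p \<and>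
          (\<exists>y \<in> carrier A. group.ord A y = q \<and> y \<in> normalizer A (generate A {x})))}\<rparr>"

lemma pair_loopfree_digraph_N_prime_graph: "pair_loopfree_digraph (N_prime_graph A)"
  by unfold_locales (auto simp: N_prime_graph_def)


section \<open>The integral group ring of a finite group and its normalized units\<close>

text \<open>Elements are functions \<open>G \<rightarrow> \<int>\<close>, extended by \<open>0\<close> outside the carrier so that equality of
  ring elements is equality of functions. The definitions are only meant for finite \<open>G\<close>; no
  finite-support condition is imposed.\<close>

definition int_group_ring :: "('a, 'b) monoid_scheme \<Rightarrow> ('a \<Rightarrow> int) ring" where
  "int_group_ring G =
     \<lparr>carrier = {f. \<forall>x. x \<notin> carrier G \<longrightarrow> f x = 0},
      Group.monoid.mult = (\<lambda>f g x. if x \<in> carrier G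
        then \<Sum>y \<in> carrier G. f y * g (inv\<^bsub>G\<^esub> y \<otimes>\<^bsub>G\<^esub> x) else 0),
      one = (\<lambda>x. if x = \<one>\<^bsub>G\<^esub> then 1 else 0),
      ring.zero = (\<lambda>x. 0),
      ring.add = (\<lambda>f g x. f x + g x)\<rparr>"

definition augmentation :: "('a, 'b) monoid_scheme \<Rightarrow> ('a \<Rightarrow> int) \<Rightarrow> int" where
  "augmentation G f = (\<Sum>x \<in> carrier G. f x)"

definition normalized_units :: "('a, 'b) monoid_scheme \<Rightarrow> ('a \<Rightarrow> int) monoid" where
  "normalized_units G =
     (units_of (int_group_ring G))
       \<lparr>carrier := {u \<in> Units (int_group_ring G). augmentation G u = 1}\<rparr>"

lemma ring_int_group_ring:
  assumes "group G" "finite (carrier G)"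
  shows "ring (int_group_ring G)"
proof -
  interpret group G by fact
  let ?c = "carrier G"
  have reindex: "(\<Sum>y\<in>?c. h y) = (\<Sum>y\<in>?c. h (z \<otimes>\<^bsub>G\<^esub> y))"
    if "z \<in> ?c" for h :: "'a \<Rightarrow> int" and z
    by (rule sum.reindex_bij_witness[of _ "\<lambda>y. z \<otimes>\<^bsub>G\<^esub> y" "\<lambda>y. inv\<^bsub>G\<^esub> z \<otimes>\<^bsub>G\<^esub> y"])
       (use that in \<open>auto simp: m_assoc[symmetric]\<close>)
  show ?thesis
  proof (rule ringI)
    show "abelian_group (int_group_ring G)"
    proof (rule abelian_groupI)
      fix f assume "f \<in> carrier (int_group_ring G)"
      then show "\<exists>g\<in>carrier (int_group_ring G).
          g \<oplus>\<^bsub>int_group_ring G\<^esub> f = \<zero>\<^bsub>int_group_ring G\<^esub>"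
        by (intro bexI[of _ "\<lambda>x. - f x"]) (auto simp: int_group_ring_def)
    qed (auto simp: int_group_ring_def fun_eq_iff)
    show "monoid (int_group_ring G)"
    proof (rule monoidI)
      fix f g h
      assume fgh: "f \<in> carrier (int_group_ring G)" "g \<in> carrier (int_group_ring G)"
        "h \<in> carrier (int_group_ring G)"
      have "(\<Sum>y\<in>?c. (\<Sum>z\<in>?c. f z * g (inv\<^bsub>G\<^esub> z \<otimes>\<^bsub>G\<^esub> y)) * h (inv\<^bsub>G\<^esub> y \<otimes>\<^bsub>G\<^esub> x)) =
            (\<Sum>z\<in>?c. f z * (\<Sum>y\<in>?c. g y * h (inv\<^bsub>G\<^esub> y \<otimes>\<^bsub>G\<^esub> (inv\<^bsub>G\<^esub> z \<otimes>\<^bsub>G\<^esub> x))))"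
        if x: "x \<in> ?c" for x
      proof -
        have "(\<Sum>y\<in>?c. (\<Sum>z\<in>?c. f z * g (inv\<^bsub>G\<^esub> z \<otimes>\<^bsub>G\<^esub> y)) * h (inv\<^bsub>G\<^esub> y \<otimes>\<^bsub>G\<^esub> x)) =
              (\<Sum>z\<in>?c. \<Sum>y\<in>?c. f z * g (inv\<^bsub>G\<^esub> z \<otimes>\<^bsub>G\<^esub> y) * h (inv\<^bsub>G\<^esub> y \<otimes>\<^bsub>G\<^esub> x))"
          by (subst sum.swap) (simp add: sum_distrib_right)
        also have "\<dots> = (\<Sum>z\<in>?c. \<Sum>y\<in>?c.
            f z * g y * h (inv\<^bsub>G\<^esub> y \<otimes>\<^bsub>G\<^esub> (inv\<^bsub>G\<^esub> z \<otimes>\<^bsub>G\<^esub> x)))"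
        proof (rule sum.cong[OF refl])
          fix z assume z: "z \<in> ?c"
          show "(\<Sum>y\<in>?c. f z * g (inv\<^bsub>G\<^esub> z \<otimes>\<^bsub>G\<^esub> y) * h (inv\<^bsub>G\<^esub> y \<otimes>\<^bsub>G\<^esub> x)) =
            (\<Sum>y\<in>?c. f z * g y * h (inv\<^bsub>G\<^esub> y \<otimes>\<^bsub>G\<^esub> (inv\<^bsub>G\<^esub> z \<otimes>\<^bsub>G\<^esub> x)))"
            by (subst reindex[OF z])
               (use z x in \<open>auto intro!: sum.cong simp: m_assoc[symmetric] inv_mult_group\<close>)
        qed
        finally show ?thesis by (simp add: sum_distrib_left mult.assoc)
      qed
      with fgh show "f \<otimes>\<^bsub>int_group_ring G\<^esub> g \<otimes>\<^bsub>int_group_ring G\<^esub> h =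
          f \<otimes>\<^bsub>int_group_ring G\<^esub> (g \<otimes>\<^bsub>int_group_ring G\<^esub> h)"
        by (auto simp: int_group_ring_def fun_eq_iff intro!: sum.cong)
    next
      fix f assume f: "f \<in> carrier (int_group_ring G)"
      have "(\<Sum>y\<in>?c. (if y = \<one>\<^bsub>G\<^esub> then 1 else 0) * f (inv\<^bsub>G\<^esub> y \<otimes>\<^bsub>G\<^esub> x)) =
            (\<Sum>y\<in>?c. if y = \<one>\<^bsub>G\<^esub> then f x else 0)" if "x \<in> ?c" for x
        by (rule sum.cong) (use that in auto)
      with f assms(2) show "\<one>\<^bsub>int_group_ring G\<^esub> \<otimes>\<^bsub>int_group_ring G\<^esub> f = f"
        by (auto simp: int_group_ring_def fun_eq_iff)
      have "(\<Sum>y\<in>?c. f y * (if inv\<^bsub>G\<^esub> y \<otimes>\<^bsub>G\<^esub> x = \<one>\<^bsub>G\<^esub> then 1 else 0)) =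
            (\<Sum>y\<in>?c. if y = x then f x else 0)" if "x \<in> ?c" for x
        using that inv_solve_left[of "\<one>\<^bsub>G\<^esub>" _ x]
        by (intro sum.cong) (auto simp: eq_commute[of _ "\<one>\<^bsub>G\<^esub>"])
      with f assms(2) show "f \<otimes>\<^bsub>int_group_ring G\<^esub> \<one>\<^bsub>int_group_ring G\<^esub> = f"
        by (auto simp: int_group_ring_def fun_eq_iff)
    qed (auto simp: int_group_ring_def)
  qed (auto simp: int_group_ring_def fun_eq_iff sum.distrib distrib_left distrib_right)
qed

lemma augmentation_mult:
  assumes "group G" "finite (carrier G)"
  shows "augmentation G (f \<otimes>\<^bsub>int_group_ring G\<^esub> g) = augmentation G f * augmentation G g"
proof -
  interpret group G by fact
  have "(\<Sum>x\<in>carrier G. g (inv\<^bsub>G\<^esub> y \<otimes>\<^bsub>G\<^esub> x)) = (\<Sum>x\<in>carrier G. g x)" if "y \<in> carrier G" for y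
    by (rule sum.reindex_bij_witness[of _ "\<lambda>x. y \<otimes>\<^bsub>G\<^esub> x" "\<lambda>x. inv\<^bsub>G\<^esub> y \<otimes>\<^bsub>G\<^esub> x"])
       (use that in \<open>auto simp: m_assoc[symmetric]\<close>)
  then show ?thesis
    by (simp add: augmentation_def int_group_ring_def sum_distrib_right sum_distrib_left[symmetric]
        sum.swap[of _ "carrier G" "carrier G"])
qed

lemma group_normalized_units:
  assumes G: "group G" "finite (carrier G)"
  shows "group (normalized_units G)"
proof -
  interpret R: ring "int_group_ring G" by (rule ring_int_group_ring[OF G])
  interpret U: group "units_of (int_group_ring G)" by (rule R.units_group)
  have aug_one: "augmentation G \<one>\<^bsub>int_group_ring G\<^esub> = 1"
    using G group.is_monoid[OF G(1)]
    by (simp add: augmentation_def int_group_ring_def monoid.one_closed)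
  have "subgroup {u \<in> Units (int_group_ring G). augmentation G u = 1}
      (units_of (int_group_ring G))"
  proof
    fix u assume "u \<in> {u \<in> Units (int_group_ring G). augmentation G u = 1}"
    then have u: "u \<in> Units (int_group_ring G)" "augmentation G u = 1" by auto
    have "augmentation G (inv\<^bsub>int_group_ring G\<^esub> u) = 1"
      using augmentation_mult[OF G, of u "inv\<^bsub>int_group_ring G\<^esub> u"] u
      by (simp add: R.Units_r_inv aug_one)
    with u show "inv\<^bsub>units_of (int_group_ring G)\<^esub> u
        \<in> {u \<in> Units (int_group_ring G). augmentation G u = 1}"
      by (simp add: R.units_of_inv)
  qed (auto simp: units_of_def aug_one augmentation_mult[OF G])
  then show ?thesis
    unfolding normalized_units_def by (rule U.subgroup_imp_group)
qed

definition NPQ :: "('a, 'b) monoid_scheme \<Rightarrow> bool" where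
  "NPQ G \<longleftrightarrow> N_prime_graph G = N_prime_graph (normalized_units G)"


section \<open>Almost simple groups\<close>

definition Inn :: "('a, 'b) monoid_scheme \<Rightarrow> ('a \<Rightarrow> 'a) set" where
  "Inn S = (\<lambda>g. \<lambda>x \<in> carrier S. g \<otimes>\<^bsub>S\<^esub> x \<otimes>\<^bsub>S\<^esub> inv\<^bsub>S\<^esub> g) ` carrier S"

text \<open>\<open>Inn S \<le> A \<le> Aut S\<close> up to isomorphism, for some non-abelian simple \<open>S\<close>. Taking \<open>S\<close>
  on the type of the elements of \<open>A\<close> loses nothing: \<open>S\<close> is isomorphic to \<open>Inn S\<close>, hence to a
  subgroup of \<open>A\<close>. The locale \<open>simple_group\<close> only admits finite groups.\<close>

definition almost_simple :: "('a, 'b) monoid_scheme \<Rightarrow> bool" where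
  "almost_simple A \<longleftrightarrow> group A \<and>
     (\<exists>S :: 'a monoid. simple_group S \<and> \<not> comm_group S \<and>
       (\<exists>H. subgroup H (AutoGroup S) \<and> Inn S \<subseteq> H \<and> A \<cong> (AutoGroup S)\<lparr>carrier := H\<rparr>))"

end

theory Submission
  imports Defs "HOL-Number_Theory.Number_Theory" "Jordan_Normal_Form.Schur_Decomposition"
begin

text \<open>Let \<open>V = V(\<int>G)\<close>. If \<open>u\<close> in \<open>V\<close> has finite order \<open>m\<close>, its coefficients sum to zero over every
  conjugacy class of elements whose order has a prime factor not dividing \<open>m\<close>, and \<open>u\<close> has
  coefficient \<open>0\<close> at \<open>1\<close> unless \<open>u = 1\<close>. Hence, if a unit of prime order \<open>p\<close> becomes trivial
  in \<open>V(\<int>[G/N])\<close>, then \<open>p\<close> divides \<open>|N|\<close>; and if a unit of order \<open>p * q\<close> drops to order \<open>q\<close> there while \<open>q\<close> does not divide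
  \<open>|N|\<close>, then \<open>G\<close> has an element of order \<open>p * q\<close>.

  Suppose that an element of order \<open>p * q\<close>, or an arc from \<open>q\<close> to \<open>p\<close>, occurs in \<open>V\<close> but not in \<open>G\<close>,
  while no proper quotient of \<open>G\<close> has this defect. If the elements of the arc do not commute, then \<open>q\<close>
  divides \<open>p - 1\<close>; so an element of order \<open>q\<close> that normalizes a non-trivial \<open>p\<close>-subgroup also
  normalizes a subgroup of order \<open>p\<close>, and by a Frattini argument arcs lift from quotients. It follows
  that both \<open>p\<close> and \<open>q\<close> divide the order of every non-trivial normal subgroup of \<open>G\<close>. As \<open>G\<close> has no
  element of order \<open>p * q\<close>, no two non-trivial normal subgroups commute; this makes a minimal normal
  subgroup simple with trivial centralizer, so \<open>G\<close> is almost simple.\<close>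

text \<open>An element of order \<open>q\<close> acting on a \<open>p\<close>-group need not
  normalize any subgroup of order \<open>p\<close>, since the action may be irreducible in dimension
  above 1. If \<open>q\<close> divides \<open>p - 1\<close>, the prime field contains the
  \<open>q\<close>-th roots of unity and eigenvectors exist. The other arcs come from commuting
  elements and amount to elements of order \<open>p * q\<close>; these orders are therefore carried
  through the induction next to the arcs, and settled first.

  The vanishing of coefficient sums rests on congruences for the powers of \<open>u\<close> with
  exponent \<open>r ^ k\<close>. Infinitely many of these powers equal \<open>u\<close>, so
  congruences modulo growing powers of \<open>r\<close> become an equation. The coefficient at 1 is
  beyond this method, as no prime divides the order of 1; there complex eigenvalues take
  over.\<close>

hide_const (open) Polynomial.order

section \<open>Orders, arcs and normalizers\<close>

definition has_ord :: "('a, 'b) monoid_scheme \<Rightarrow> nat \<Rightarrow> bool" where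
  "has_ord A n \<longleftrightarrow> (\<exists>x\<in>carrier A. group.ord A x = n)"

text \<open>The normalizer condition of the N-prime graph, written as an equation between elements
  so that it passes along homomorphisms. For \<open>x\<close> and \<open>y\<close> of finite order
  the two agree by \<open>normalizer_generate_iff\<close>.\<close>

definition has_arc :: "('a, 'b) monoid_scheme \<Rightarrow> nat \<Rightarrow> nat \<Rightarrow> bool" where
  "has_arc A q p \<longleftrightarrow> (\<exists>x\<in>carrier A. \<exists>y\<in>carrier A. group.ord A x = p \<and> group.ord A y = q \<and>
     (\<exists>k::nat. y \<otimes>\<^bsub>A\<^esub> x \<otimes>\<^bsub>A\<^esub> inv\<^bsub>A\<^esub> y = x [^]\<^bsub>A\<^esub> k))"

lemma (in group) conj_mult:
  assumes "y \<in> carrier G" "a \<in> carrier G" "b \<in> carrier G"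
  shows "y \<otimes> (a \<otimes> b) \<otimes> inv y = (y \<otimes> a \<otimes> inv y) \<otimes> (y \<otimes> b \<otimes> inv y)"
proof -
  have "inv y \<otimes> (y \<otimes> (b \<otimes> inv y)) = b \<otimes> inv y"
    using assms by (simp flip: m_assoc)
  then show ?thesis using assms by (simp add: m_assoc)
qed

lemma (in group) conj_comp:
  assumes "y \<in> carrier G" "x \<in> carrier G" "b \<in> carrier G"
  shows "(y \<otimes> x) \<otimes> b \<otimes> inv (y \<otimes> x) = y \<otimes> (x \<otimes> b \<otimes> inv x) \<otimes> inv y"
  using assms by (simp add: m_assoc inv_mult_group)

lemma (in group) conj_pow:
  assumes "y \<in> carrier G" "a \<in> carrier G"
  shows "y \<otimes> (a [^] (n::nat)) \<otimes> inv y = (y \<otimes> a \<otimes> inv y) [^] n"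
  using assms by (induction n) (simp_all add: conj_mult)

lemma (in group) conj_eq_iff:
  assumes "y \<in> carrier G" "a \<in> carrier G" "b \<in> carrier G"
  shows "y \<otimes> a \<otimes> inv y = b \<longleftrightarrow> y \<otimes> a = b \<otimes> y"
  using assms by (metis inv_closed inv_solve_right' m_closed)

lemma (in group) conj_inj:
  assumes "y \<in> carrier G" "a \<in> carrier G" "b \<in> carrier G"
  shows "y \<otimes> a \<otimes> inv y = y \<otimes> b \<otimes> inv y \<longleftrightarrow> a = b"
  using assms by simp

lemma (in group) pow_cong:
  assumes "x \<in> carrier G" "x [^] (p::nat) = \<one>" "[a = b] (mod p)"
  shows "x [^] (a::nat) = x [^] b"
proof -
  have *: "x [^] (c::nat) = x [^] (c mod p)" for c
  proof -
    have "x [^] c = x [^] (p * (c div p) + c mod p)" by simp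
    also have "\<dots> = (x [^] p) [^] (c div p) \<otimes> x [^] (c mod p)"
      using assms(1) by (simp only: nat_pow_mult[symmetric] nat_pow_pow[symmetric] nat_pow_closed)
    finally show ?thesis using assms(1,2) by simp
  qed
  show ?thesis using *[of a] *[of b] assms(3) by (simp add: cong_def)
qed

lemma (in group) ord_prime_iff:
  assumes "x \<in> carrier G" "Factorial_Ring.prime (p::nat)"
  shows "ord x = p \<longleftrightarrow> x \<noteq> \<one> \<and> x [^] p = \<one>"
proof
  assume "ord x = p"
  then show "x \<noteq> \<one> \<and> x [^] p = \<one>" using assms pow_ord_eq_1 ord_eq_1 prime_gt_1_nat by fastforce
next
  assume *: "x \<noteq> \<one> \<and> x [^] p = \<one>"
  then have "ord x dvd p" using assms pow_eq_id by blast
  moreover have "ord x \<noteq> 1" using * assms ord_eq_1 by blast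
  ultimately show "ord x = p" using assms(2) prime_nat_iff by blast
qed

lemma (in group) ord_power_dvd:
  assumes "x \<in> carrier G" "d dvd ord x" "ord x > 0"
  shows "ord (x [^] (ord x div d)) = d"
proof -
  have "ord x div d dvd ord x" "ord x div d \<noteq> 0"
    using assms by (auto simp: dvd_div_eq_0_iff)
  then show ?thesis using ord_pow[OF assms(1)] assms by auto
qed

lemma (in group) ord_pos: "finite (carrier G) \<Longrightarrow> x \<in> carrier G \<Longrightarrow> ord x > 0"
  using ord_ge_1 by fastforce

lemma (in group) has_ord_dvd:
  assumes "finite (carrier G)" "x \<in> carrier G" "d dvd ord x"
  shows "has_ord G d"
  unfolding has_ord_def using ord_power_dvd[OF assms(2,3) ord_pos[OF assms(1,2)]] assms(2) nat_pow_closed by blast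

lemma (in group) ord_mult_coprime:
  assumes xy: "x \<in> carrier G" "y \<in> carrier G" and comm: "x \<otimes> y = y \<otimes> x"
    and cop: "coprime (ord x) (ord y)"
  shows "ord (x \<otimes> y) = ord x * ord y"
proof (rule dvd_antisym)
  show "ord (x \<otimes> y) dvd ord x * ord y" by (rule ord_mul_divides[OF comm xy])
  have one: "x [^] m \<otimes> y [^] m = \<one>" if "ord (x \<otimes> y) dvd m" for m
    using that xy comm by (metis m_closed pow_eq_id pow_mult_distrib)
  have "x [^] (ord (x \<otimes> y) * ord y) = \<one>"
    using one[of "ord (x \<otimes> y) * ord y"] xy pow_eq_id[of y "ord (x \<otimes> y) * ord y"] by simp
  then have "ord x dvd ord (x \<otimes> y) * ord y" using xy pow_eq_id by blast
  moreover have "y [^] (ord (x \<otimes> y) * ord x) = \<one>"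
    using one[of "ord (x \<otimes> y) * ord x"] xy pow_eq_id[of x "ord (x \<otimes> y) * ord x"] by simp
  then have "ord y dvd ord (x \<otimes> y) * ord x" using xy pow_eq_id by blast
  ultimately show "ord x * ord y dvd ord (x \<otimes> y)"
    using cop by (simp add: coprime_dvd_mult_left_iff coprime_commute divides_mult)
qed

text \<open>The powers \<open>x [^] q\<close> and \<open>x [^] p\<close> commute, so the exponent 1
  serves. With the primes exchanged, the same element yields the opposite arc.\<close>

lemma (in group) has_arc_if_has_ord_mult:
  assumes pq: "Factorial_Ring.prime (p::nat)" "Factorial_Ring.prime (q::nat)" and "has_ord G (p * q)"
  shows "has_arc G q p"
proof -
  obtain x where x: "x \<in> carrier G" "ord x = p * q" using assms by (auto simp: has_ord_def)
  have nz: "p \<noteq> 0" "q \<noteq> 0" using pq by auto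
  have "ord (x [^] q) = p" "ord (x [^] p) = q"
    using x ord_pow[of x q] ord_pow[of x p] nz by auto
  moreover have "x [^] p \<otimes> x [^] q \<otimes> inv (x [^] p) = (x [^] q) [^] (1::nat)"
    using x conj_eq_iff[of "x [^] p" "x [^] q" "x [^] q"] by (simp add: nat_pow_mult add.commute)
  ultimately show ?thesis unfolding has_arc_def using x nat_pow_closed by blast
qed

lemma ord_inj_hom:
  assumes "group A" "group B" and h: "h \<in> hom A B" "inj_on h (carrier A)" and z: "z \<in> carrier A"
  shows "group.ord B (h z) = group.ord A z"
proof -
  interpret h: group_hom A B h using assms by (simp add: group_hom_def group_hom_axioms_def)
  have "h z [^]\<^bsub>B\<^esub> (n::nat) = \<one>\<^bsub>B\<^esub> \<longleftrightarrow> z [^]\<^bsub>A\<^esub> n = \<one>\<^bsub>A\<^esub>" for n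
    using z h(2) by (metis h.G.nat_pow_closed h.G.one_closed h.hom_nat_pow h.hom_one inj_onD)
  then show ?thesis using z by (simp add: h.H.ord_unique h.G.pow_eq_id)
qed

lemma has_arc_inj_hom:
  assumes "group A" "group B" and h: "h \<in> hom A B" "inj_on h (carrier A)" and arc: "has_arc A q p"
  shows "has_arc B q p"
proof -
  interpret h: group_hom A B h using assms by (simp add: group_hom_def group_hom_axioms_def)
  obtain x y k where xy: "x \<in> carrier A" "y \<in> carrier A" "h.G.ord x = p" "h.G.ord y = q"
    "y \<otimes>\<^bsub>A\<^esub> x \<otimes>\<^bsub>A\<^esub> inv\<^bsub>A\<^esub> y = x [^]\<^bsub>A\<^esub> (k::nat)"
    using arc unfolding has_arc_def by (elim bexE conjE exE) (rule that)
  have ord: "h.H.ord (h z) = h.G.ord z" if "z \<in> carrier A" for z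
    using ord_inj_hom[OF assms(1-4) that] by simp
  have "h y \<otimes>\<^bsub>B\<^esub> h x \<otimes>\<^bsub>B\<^esub> inv\<^bsub>B\<^esub> (h y) = h x [^]\<^bsub>B\<^esub> k"
    using xy by (metis h.G.inv_closed h.G.m_closed h.hom_inv h.hom_mult h.hom_nat_pow)
  then show ?thesis unfolding has_arc_def using xy ord by (metis h.hom_closed)
qed

lemma has_ord_inj_hom:
  assumes "group A" "group B" "h \<in> hom A B" "inj_on h (carrier A)" "has_ord A n"
  shows "has_ord B n"
  using assms ord_inj_hom[OF assms(1-4)] unfolding has_ord_def by (metis hom_in_carrier)

lemma (in group) generate_pow_finite:
  assumes "x \<in> carrier G" "ord x > 0"
  shows "z \<in> generate G {x} \<longleftrightarrow> (\<exists>k::nat. z = x [^] k)"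
  using generate_pow_nat[of x] assms by (auto simp: gr0_conv_Suc)

lemma (in group) normalizer_generate_iff:
  assumes x: "x \<in> carrier G" "ord x > 0" and y: "y \<in> carrier G" "ord y > 0"
  shows "y \<in> normalizer G (generate G {x}) \<longleftrightarrow> (\<exists>k::nat. y \<otimes> x \<otimes> inv y = x [^] k)"
proof -
  let ?H = "generate G {x}"
  have sub: "?H \<subseteq> carrier G" using x generate_incl[of "{x}"] by simp
  have N: "y \<in> normalizer G ?H \<longleftrightarrow> y <# ?H #> inv y = ?H"
    using sub y by (simp add: normalizer_def stabilizer_def)
  have conjset: "y <# ?H #> inv y = (\<lambda>z. y \<otimes> z \<otimes> inv y) ` ?H"
    by (auto simp: l_coset_def r_coset_def)
  show ?thesis
  proof
    assume "y \<in> normalizer G ?H"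
    then have "y \<otimes> x \<otimes> inv y \<in> ?H" using N conjset generate.incl[of x "{x}" G] by auto
    then show "\<exists>k::nat. y \<otimes> x \<otimes> inv y = x [^] k" using generate_pow_finite[OF x] by blast
  next
    assume "\<exists>k::nat. y \<otimes> x \<otimes> inv y = x [^] k"
    then obtain k :: nat where k: "y \<otimes> x \<otimes> inv y = x [^] k" by blast
    \<comment> \<open>Conjugation by \<open>y\<close> maps the finite group generated by
      \<open>x\<close> injectively into itself, hence onto itself; so one inclusion is enough for
      normalizing.\<close>
    have sub2: "(\<lambda>z. y \<otimes> z \<otimes> inv y) ` ?H \<subseteq> ?H"
    proof clarify
      fix z assume "z \<in> ?H"
      then obtain m :: nat where "z = x [^] m" using generate_pow_finite[OF x] by blast
      then have "y \<otimes> z \<otimes> inv y = x [^] (k * m)" using x y k by (simp add: conj_pow nat_pow_pow)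
      then show "y \<otimes> z \<otimes> inv y \<in> ?H" using generate_pow_finite[OF x] by blast
    qed
    moreover have "inj_on (\<lambda>z. y \<otimes> z \<otimes> inv y) ?H"
      using sub y conj_inj by (meson inj_onI subsetD)
    moreover have "finite ?H"
      using generate_pow_card[OF x(1)] x(2) card_ge_0_finite by metis
    ultimately have "(\<lambda>z. y \<otimes> z \<otimes> inv y) ` ?H = ?H" by (simp add: endo_inj_surj)
    then show "y \<in> normalizer G ?H" using N conjset by simp
  qed
qed

lemma N_prime_graph_arcs:
  assumes "group A"
  shows "parcs (N_prime_graph A) =
    {(q, p). Factorial_Ring.prime q \<and> Factorial_Ring.prime p \<and> q \<noteq> p \<and> has_arc A q p}"
proof -
  interpret group A by fact
  have "(\<exists>x\<in>carrier A. ord x = p \<and> (\<exists>y\<in>carrier A. ord y = q \<and> y \<in> normalizer A (generate A {x})))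
     \<longleftrightarrow> has_arc A q p" if "Factorial_Ring.prime q" "Factorial_Ring.prime p" for p q
  proof -
    have "(ord x = p \<and> (\<exists>y\<in>carrier A. ord y = q \<and> y \<in> normalizer A (generate A {x}))) \<longleftrightarrow>
      (\<exists>y\<in>carrier A. ord x = p \<and> ord y = q \<and> (\<exists>k::nat. y \<otimes>\<^bsub>A\<^esub> x \<otimes>\<^bsub>A\<^esub> inv\<^bsub>A\<^esub> y = x [^]\<^bsub>A\<^esub> k))"
      if "x \<in> carrier A" for x
      using normalizer_generate_iff[OF that] prime_gt_0_nat[OF \<open>Factorial_Ring.prime q\<close>]
        prime_gt_0_nat[OF \<open>Factorial_Ring.prime p\<close>] by auto
    then show ?thesis unfolding has_arc_def by (rule bex_cong[OF refl])
  qed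
  moreover have "p \<in> prime_set A \<and> q \<in> prime_set A"
    if "Factorial_Ring.prime q" "Factorial_Ring.prime p" "has_arc A q p" for p q
    using that unfolding has_arc_def prime_set_def by blast
  ultimately show ?thesis
    unfolding N_prime_graph_def by (auto simp: prime_set_def)
qed

lemma (in group) cauchy:
  assumes "finite (carrier G)" "Factorial_Ring.prime (p::nat)" "p dvd order G"
  shows "has_ord G p"
proof -
  obtain m where m: "order G = p ^ 1 * m" using assms by (auto simp: dvd_def)
  obtain H where H: "subgroup H G" "card H = p ^ 1"
    using sylow_thm[OF assms(2) is_group m assms(1)] by blast
  have "card H > 1" using H assms(2) prime_gt_1_nat by simp
  then obtain x where x: "x \<in> H" "x \<noteq> \<one>"
    using card_mono[of "{\<one>}" H] by fastforce
  interpret H: group "G\<lparr>carrier := H\<rparr>" using H subgroup.subgroup_is_group by blast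
  have "x [^]\<^bsub>G\<lparr>carrier := H\<rparr>\<^esub> order (G\<lparr>carrier := H\<rparr>) = \<one>\<^bsub>G\<lparr>carrier := H\<rparr>\<^esub>"
    using H.pow_order_eq_1[of x] x by simp
  then have "x [^] p = \<one>" using H by (simp add: Coset.order_def nat_pow_consistent[symmetric])
  moreover have "x \<in> carrier G" using x H subgroup.subset by blast
  ultimately show ?thesis unfolding has_ord_def using ord_prime_iff x(2) assms(2) by blast
qed

section \<open>Actions of p-groups\<close>

text \<open>Orbits have \<open>p\<close>-power length, so if all had length above 1, their lengths
  would add up to a multiple of \<open>p\<close>. The action is a bare function with its laws on
  \<open>E\<close>; the proof restricts it to \<open>E\<close> to obtain an extensional
  \<open>group_action\<close>.\<close>

lemma p_group_fixed_point:
  fixes G (structure) and E :: "'c set"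
  assumes "group G" and card: "card (carrier G) = p ^ a" and p: "Factorial_Ring.prime (p::nat)"
    and fin: "finite E" and ndvd: "\<not> p dvd card E"
    and closed: "\<And>g x. g \<in> carrier G \<Longrightarrow> x \<in> E \<Longrightarrow> \<psi> g x \<in> E"
    and mult: "\<And>g h x. g \<in> carrier G \<Longrightarrow> h \<in> carrier G \<Longrightarrow> x \<in> E \<Longrightarrow> \<psi> (g \<otimes> h) x = \<psi> g (\<psi> h x)"
    and one: "\<And>x. x \<in> E \<Longrightarrow> \<psi> \<one> x = x"
  shows "\<exists>x\<in>E. \<forall>g\<in>carrier G. \<psi> g x = x"
proof -
  interpret group G by fact
  let ?\<phi> = "\<lambda>g. \<lambda>x\<in>E. \<psi> g x"
  have inv: "\<psi> (inv g) (\<psi> g x) = x" "\<psi> g (\<psi> (inv g) x) = x" if "g \<in> carrier G" "x \<in> E" for g x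
    using mult[of "inv g" g x] mult[of g "inv g" x] one[of x] that by simp_all
  have bij: "?\<phi> g \<in> Bij E" if "g \<in> carrier G" for g
  proof -
    have "bij_betw (?\<phi> g) E E"
      by (rule bij_betw_byWitness[where f' = "\<psi> (inv g)"]) (use that inv closed in auto)
    then show ?thesis by (simp add: Bij_def)
  qed
  have "?\<phi> \<in> hom G (BijGroup E)"
  proof (rule homI)
    fix g h assume gh: "g \<in> carrier G" "h \<in> carrier G"
    then show "?\<phi> (g \<otimes> h) = ?\<phi> g \<otimes>\<^bsub>BijGroup E\<^esub> ?\<phi> h"
      using bij[OF gh(1)] bij[OF gh(2)] mult[OF gh] closed[OF gh(2)]
      by (auto simp: BijGroup_def compose_def fun_eq_iff)
  qed (use bij in \<open>auto simp: BijGroup_def\<close>)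
  then interpret group_action G E ?\<phi>
    by (simp add: group_action_def group_hom_def group_hom_axioms_def is_group group_BijGroup)
  have "(\<Sum>orb\<in>orbits G E ?\<phi>. card orb) = card E"
    using disjoint_sum[OF fin, of "\<lambda>_. 1::nat"] by simp
  then obtain orb where orb: "orb \<in> orbits G E ?\<phi>" "\<not> p dvd card orb"
    using ndvd dvd_sum by metis
  obtain x where x: "x \<in> E" "orb = orbit G ?\<phi> x" using orb(1) by (auto simp: orbits_def)
  have "card orb dvd p ^ a"
    using orbit_stabilizer_theorem[OF x(1)] card x(2) by (metis dvd_triv_left Coset.order_def)
  then obtain i where "card orb = p ^ i" using p divides_primepow_nat by blast
  then have "card orb = 1" using orb(2) by (cases i) auto
  then obtain y where y: "orb = {y}" using card_1_singletonE by blast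
  have "\<psi> g x = x" if "g \<in> carrier G" for g
  proof -
    have "\<psi> g x \<in> orb" "x \<in> orb" using x orbit_refl that by (auto simp: orbit_def)
    then show ?thesis using y by simp
  qed
  then show ?thesis using x by blast
qed

text \<open>\<open>Q\<close> acts on the right cosets of \<open>P\<close>, whose number is prime to
  \<open>p\<close>. A fixed coset \<open>P #> x\<close> gives
  \<open>P #> (x \<otimes> g) = P #> x\<close>, so \<open>x\<close> conjugates \<open>Q\<close> into
  \<open>P\<close>.\<close>

lemma (in group) p_subgroup_conj_into_sylow:
  assumes fin: "finite (carrier G)" and P: "subgroup P G" and Q: "subgroup Q G"
    and "card Q = p ^ a" and p: "Factorial_Ring.prime (p::nat)" and "\<not> p dvd card (rcosets P)"
  shows "\<exists>x\<in>carrier G. \<forall>g\<in>Q. x \<otimes> g \<otimes> inv x \<in> P"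
proof -
  interpret Q: group "G\<lparr>carrier := Q\<rparr>" using Q subgroup.subgroup_is_group by blast
  have Qc: "g \<in> carrier G" if "g \<in> Q" for g using Q that subgroup.subset by blast
  have Pc: "P \<subseteq> carrier G" using P subgroup.subset by blast
  \<comment> \<open>The inverse turns right multiplication into a left action.\<close>
  have "\<exists>E\<in>rcosets P. \<forall>g\<in>carrier (G\<lparr>carrier := Q\<rparr>). E #> inv g = E"
  proof (rule p_group_fixed_point[where p = p and a = a])
    show "finite (rcosets P)" using fin rcosets_finite[OF _ Pc]
      by (metis Pow_iff finite_Pow_iff finite_subset rcosets_subset_PowG P)
    fix E g assume E: "E \<in> rcosets P" and g: "g \<in> carrier (G\<lparr>carrier := Q\<rparr>)"
    then obtain x where x: "x \<in> carrier G" "E = P #> x" by (auto simp: RCOSETS_def)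
    then show "E #> inv g \<in> rcosets P" using g Qc Pc
      by (auto simp: coset_mult_assoc intro: rcosetsI)
  next
    fix E g h assume E: "E \<in> rcosets P" and g: "g \<in> carrier (G\<lparr>carrier := Q\<rparr>)"
      "h \<in> carrier (G\<lparr>carrier := Q\<rparr>)"
    then have "E \<subseteq> carrier G" using P rcosets_part_G by blast
    then show "E #> inv (g \<otimes>\<^bsub>G\<lparr>carrier := Q\<rparr>\<^esub> h) = E #> inv h #> inv g"
      using g Qc by (simp add: coset_mult_assoc inv_mult_group)
  next
    fix E assume "E \<in> rcosets P"
    then have "E \<subseteq> carrier G" using P rcosets_part_G by blast
    then show "E #> inv \<one>\<^bsub>G\<lparr>carrier := Q\<rparr>\<^esub> = E" by simp
  qed (use assms in \<open>auto simp: Q.is_group\<close>)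
  then obtain x where x: "x \<in> carrier G" "\<And>g. g \<in> Q \<Longrightarrow> P #> x #> inv g = P #> x"
    by (auto simp: RCOSETS_def)
  have "x \<otimes> g \<otimes> inv x \<in> P" if "g \<in> Q" for g
  proof -
    have "P #> (x \<otimes> g) = P #> x"
      using x(2)[of "inv g"] that Qc[of g] subgroup.m_inv_closed[OF Q that] x(1) Pc
      by (simp add: coset_mult_assoc)
    then have "x \<otimes> g \<in> P #> x" using rcos_self[OF _ P, of "x \<otimes> g"] x(1) Qc[OF that] by simp
    then show ?thesis using subgroup.rcos_module_imp[OF P is_group x(1)] by simp
  qed
  then show ?thesis using x by blast
qed


section \<open>Eigenvectors over the prime field, and arcs from normalized
  \<open>p\<close>-subgroups\<close>

lemma root_of_unity_mod_prime:
  assumes p: "Factorial_Ring.prime (p::nat)" and q: "q dvd p - 1"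
  obtains w :: nat where "[w ^ q = 1] (mod p)" "\<And>i. 0 < i \<Longrightarrow> i < q \<Longrightarrow> \<not> [w ^ i = 1] (mod p)"
proof -
  obtain g where g: "residue_primroot p g"
    using prime_primitive_root_exists[of p] p prime_gt_1_nat by auto
  then have o: "Pocklington.ord p g = p - 1" using p by (simp add: residue_primroot_def totient_prime)
  obtain c where c: "p - 1 = q * c" using q by blast
  have "p - 1 > 0" using p prime_gt_1_nat[of p] by simp
  then have c0: "c > 0" using c by (cases c) auto
  have *: "[(g ^ c) ^ i = 1] (mod p) \<longleftrightarrow> q dvd i" for i
  proof -
    have "[(g ^ c) ^ i = 1] (mod p) \<longleftrightarrow> Pocklington.ord p g dvd c * i"
      by (simp only: power_mult[symmetric] ord_divides)
    then show ?thesis using o c c0 by simp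
  qed
  \<comment> \<open>\<open>g\<close> is a primitive root and \<open>c = (p - 1) / q\<close>, so
    \<open>g ^ c\<close> has multiplicative order exactly \<open>q\<close>.\<close>
  show ?thesis
    by (rule that[of "g ^ c"]) (use * in \<open>auto dest: dvd_imp_le\<close>)
qed

text \<open>The sum is geometric with ratio \<open>w ^ i\<close>. Its product with
  \<open>w ^ i - 1\<close> is \<open>(w ^ i) ^ q - 1\<close>, which \<open>p\<close> divides, while
  \<open>p\<close> does not divide \<open>w ^ i - 1\<close>. The integers serve to make subtraction
  available.\<close>

lemma sum_roots_of_unity_mod_prime:
  fixes w p q :: nat
  assumes p: "Factorial_Ring.prime p" and w: "[w ^ q = 1] (mod p)" and i: "\<not> [w ^ i = 1] (mod p)"
  shows "p dvd (\<Sum>e<q. w ^ (e * i))"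
proof -
  have "(int w ^ i) ^ q - 1 = (int w ^ i - 1) * (\<Sum>e<q. (int w ^ i) ^ e)" by (rule power_diff_1_eq)
  moreover have "int p dvd (int w ^ i) ^ q - 1"
  proof -
    have "[(w ^ q) ^ i = 1 ^ i] (mod p)" using w by (rule cong_pow)
    then have "[(int w ^ i) ^ q = 1] (mod int p)"
      by (simp add: power_mult[symmetric] mult.commute flip: cong_int_iff)
    then show ?thesis by (simp add: cong_iff_dvd_diff)
  qed
  moreover have "\<not> int p dvd int w ^ i - 1"
  proof
    assume "int p dvd int w ^ i - 1"
    then have "[int (w ^ i) = int 1] (mod int p)" by (simp add: cong_iff_dvd_diff)
    then show False using i by (simp only: cong_int_iff)
  qed
  ultimately have "int p dvd (\<Sum>e<q. (int w ^ i) ^ e)" using p prime_dvd_mult_iff[of "int p"] by auto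
  also have "\<dots> = int (\<Sum>e<q. w ^ (e * i))" by (simp add: power_mult[symmetric] mult.commute)
  finally show ?thesis by (simp only: int_dvd_int_iff)
qed

context comm_group
begin

lemma finprod_nat_pow:
  assumes "f \<in> {..n} \<rightarrow> carrier G"
  shows "finprod G f {..n} [^] (k::nat) = finprod G (\<lambda>j. f j [^] k) {..n::nat}"
  using assms by (induction n) (auto simp: Pi_iff pow_mult_distrib m_comm)

lemma finprod_hom:
  assumes "h \<in> hom G G" "f \<in> {..n} \<rightarrow> carrier G"
  shows "h (finprod G f {..n}) = finprod G (\<lambda>j. h (f j)) {..n::nat}"
  using assms(2) by (induction n) (use assms(1) in \<open>auto simp: Pi_iff hom_mult[OF assms(1)] hom_in_carrier[OF assms(1)]\<close>)

lemma finprod_pow_swap: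
  assumes "t \<in> {..n} \<rightarrow> carrier G"
  shows "finprod G (\<lambda>e. finprod G (\<lambda>j. t j [^] (c e j :: nat)) {..n::nat}) {..N::nat} =
    finprod G (\<lambda>j. t j [^] (\<Sum>e\<le>N. c e j)) {..n}"
proof (induction N)
  case (Suc N)
  have "finprod G (\<lambda>e. finprod G (\<lambda>j. t j [^] (c e j :: nat)) {..n}) {..Suc N} =
    finprod G (\<lambda>j. t j [^] (c (Suc N) j)) {..n} \<otimes> finprod G (\<lambda>j. t j [^] (\<Sum>e\<le>N. c e j)) {..n}"
    using Suc assms by (subst finprod_Suc) (auto simp: Pi_iff)
  also have "\<dots> = finprod G (\<lambda>j. t j [^] (\<Sum>e\<le>Suc N. c e j)) {..n}"
  proof -
    have "finprod G (\<lambda>j. t j [^] (\<Sum>e\<le>Suc N. c e j)) {..n} =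
      finprod G (\<lambda>j. t j [^] (c (Suc N) j) \<otimes> t j [^] (\<Sum>e\<le>N. c e j)) {..n}"
      using assms by (intro finprod_cong') (auto simp: nat_pow_mult Pi_iff add.commute)
    then show ?thesis using assms by (simp add: Pi_iff)
  qed
  finally show ?case .
qed (use assms in \<open>auto intro!: finprod_cong' simp: Pi_iff\<close>)

text \<open>The eigenspace projections of a fixed \<open>z\<close>, for the eigenvalues \<open>w\<^sup>e\<close> with \<open>w\<close> of order \<open>q\<close>
  modulo \<open>p\<close>, multiply to \<open>z\<^sup>q\<close>; so one of them is non-trivial.\<close>

lemma eigenvector:
  assumes p: "Factorial_Ring.prime (p::nat)" and q: "Factorial_Ring.prime (q::nat)" "q dvd p - 1"
    and exp: "\<And>x. x \<in> carrier G \<Longrightarrow> x [^] p = \<one>" and h: "h \<in> hom G G"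
    and z: "z \<in> carrier G" "z \<noteq> \<one>" "(h ^^ q) z = z"
  shows "\<exists>v\<in>carrier G. v \<noteq> \<one> \<and> (\<exists>k::nat. h v = v [^] k)"
proof -
  obtain w :: nat where w: "[w ^ q = 1] (mod p)" "\<And>i. 0 < i \<Longrightarrow> i < q \<Longrightarrow> \<not> [w ^ i = 1] (mod p)"
    using root_of_unity_mod_prime[OF p q(2)] by blast
  obtain m where m: "q = Suc (Suc m)" 
    using prime_ge_2_nat[OF q(1)] le_Suc_ex[of 2 q] by auto
  \<comment> \<open>The orbit of \<open>z\<close>, listed backwards: since
    \<open>(h ^^ q) z = z\<close>, \<open>t j\<close> plays the part of \<open>h\<close> to the
    power \<open>-j\<close> at \<open>z\<close>, and \<open>h\<close> lowers the index by one
    cyclically.\<close>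
  define t where "t j = (h ^^ (q - j)) z" for j
  have t_closed: "t j \<in> carrier G" for j
  proof -
    have "(h ^^ i) z \<in> carrier G" for i using z(1) hom_in_carrier[OF h] by (induction i) auto
    then show ?thesis by (simp add: t_def)
  qed
  have t0: "t 0 = z" using z(3) by (simp add: t_def)
  have ht: "h (t (Suc j)) = t j" if "j \<le> m" for j
  proof -
    have "q - j = Suc (q - Suc j)" using that m by simp
    then show ?thesis by (simp add: t_def)
  qed
  have ht0: "h (t 0) = t (Suc m)" using t0 m by (simp add: t_def)
  \<comment> \<open>Additively, \<open>v e\<close> is the sum of \<open>w ^ (e * j) * t j\<close>
    over all \<open>j\<close> below \<open>q\<close>: up to the factor \<open>q\<close>, the
    component of \<open>z\<close> in the eigenspace of \<open>w ^ e\<close>.\<close>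
  define v where "v e = finprod G (\<lambda>j. t j [^] (w ^ (e * j))) {..Suc m}" for e
  have v_closed: "v e \<in> carrier G" for e using t_closed by (auto simp: v_def)
  have eig: "h (v e) = v e [^] (w ^ e)" for e
  proof -
    have "h (v e) = finprod G (\<lambda>j. h (t j) [^] (w ^ (e * j))) {..Suc m}"
    proof -
      have "h (x [^] (k::nat)) = h x [^] k" if "x \<in> carrier G" for x k
        using that h by (metis hom_nat_pow is_group)
      then show ?thesis unfolding v_def using t_closed by (subst finprod_hom[OF h]) auto
    qed
    also have "\<dots> = finprod G (\<lambda>j. t j [^] (w ^ (e * Suc j))) {..m} \<otimes> t (Suc m)"
      using t_closed hom_in_carrier[OF h] ht ht0
      by (subst finprod_Suc2) (auto intro!: arg_cong2[where f = "(\<otimes>)"] finprod_cong')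
    also have "t (Suc m) = t (Suc m) [^] (w ^ (e * Suc (Suc m)))"
    proof -
      have "[(w ^ q) ^ e = 1 ^ e] (mod p)" using w(1) by (rule cong_pow)
      then have "[w ^ (e * Suc (Suc m)) = 1] (mod p)"
        unfolding m[symmetric] by (simp only: power_mult[symmetric] mult.commute power_one)
      from pow_cong[OF t_closed exp[OF t_closed] this] show ?thesis using t_closed by simp
    qed
    also have "finprod G (\<lambda>j. t j [^] (w ^ (e * Suc j))) {..m} \<otimes> t (Suc m) [^] (w ^ (e * Suc (Suc m)))
       = finprod G (\<lambda>j. t j [^] (w ^ (e * Suc j))) {..Suc m}"
      using t_closed by (simp add: m_comm)
    also have "\<dots> = v e [^] (w ^ e)"
      unfolding v_def using t_closed
      by (subst finprod_nat_pow) (auto simp: nat_pow_pow power_add mult.commute intro!: finprod_cong')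
    finally show ?thesis .
  qed
  have "finprod G v {..Suc m} = finprod G (\<lambda>j. t j [^] (\<Sum>e\<le>Suc m. w ^ (e * j))) {..Suc m}"
    unfolding v_def using t_closed by (intro finprod_pow_swap) auto
  also have "\<dots> = finprod G (\<lambda>j. if j = 0 then z [^] q else \<one>) {..Suc m}"
  proof (rule finprod_cong')
    fix j assume "j \<in> {..Suc m}"
    show "t j [^] (\<Sum>e\<le>Suc m. w ^ (e * j)) = (if j = 0 then z [^] q else \<one>)"
    proof (cases "j = 0")
      case True
      then show ?thesis using t0 m by simp
    next
      case False
      then have "p dvd (\<Sum>e<q. w ^ (e * j))"
        using sum_roots_of_unity_mod_prime[OF p w(1)] w(2)[of j] \<open>j \<in> _\<close> m by auto
      moreover have "{..<q} = {..Suc m}" using m by auto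
      ultimately obtain c where c: "(\<Sum>e\<le>Suc m. w ^ (e * j)) = p * c" by auto
      show ?thesis unfolding c using False t_closed exp by (simp flip: nat_pow_pow)
    qed
  qed (use z in auto)
  also have "\<dots> = z [^] q"
    using z(1) by (subst finprod_Suc2) (auto simp: Pi_iff intro!: finprod_one_eqI)
  finally have prod: "finprod G v {..Suc m} = z [^] q" .
  \<comment> \<open>\<open>q\<close> divides \<open>p - 1\<close>, so \<open>p\<close> does not
    divide \<open>q\<close> and \<open>z [^] q\<close> is still non-trivial; hence some factor
    \<open>v e\<close> is.\<close>
  have "q < p" using dvd_imp_le[OF q(2)] prime_gt_1_nat[OF p] by simp
  then have "\<not> p dvd q" using prime_gt_0_nat[OF q(1)] by (simp add: nat_dvd_not_less)
  then have "z [^] q \<noteq> \<one>"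
    using z(1,2) exp[OF z(1)] ord_prime_iff[OF z(1) p] by (simp add: pow_eq_id)
  then have "\<exists>e. v e \<noteq> \<one>" using prod by (metis finprod_one_eqI)
  then show ?thesis using v_closed eig by blast
qed

end

text \<open>\<open>P\<close> acts by conjugation on its \<open>p ^ a - 1\<close> non-trivial
  elements, a number prime to \<open>p\<close>; a fixed point is central.\<close>

lemma (in group) p_subgroup_center_nontrivial:
  assumes fin: "finite (carrier G)" and P: "subgroup P G" "card P = p ^ a" "a > 0"
    and p: "Factorial_Ring.prime (p::nat)"
  obtains z where "z \<in> P" "z \<noteq> \<one>" "\<And>w. w \<in> P \<Longrightarrow> w \<otimes> z = z \<otimes> w"
proof -
  interpret P: subgroup P G by fact
  interpret PG: group "G\<lparr>carrier := P\<rparr>" using P(1) subgroup.subgroup_is_group by blast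
  have "\<exists>z\<in>P - {\<one>}. \<forall>w\<in>carrier (G\<lparr>carrier := P\<rparr>). w \<otimes> z \<otimes> inv w = z"
  proof (rule p_group_fixed_point[where p = p and a = a])
    show "finite (P - {\<one>})" using fin P.subset finite_subset by blast
    have "card (P - {\<one>}) = p ^ a - 1" using P by (simp add: P.one_closed)
    moreover have "\<not> p dvd p ^ a - 1"
    proof
      assume "p dvd p ^ a - 1"
      moreover have "p dvd p ^ a" "p ^ a > 0" using P(3) p prime_gt_0_nat by auto
      ultimately have "p dvd 1" using dvd_diffD1[of p "p ^ a" 1] by auto
      then show False using p by auto
    qed
    ultimately show "\<not> p dvd card (P - {\<one>})" by simp
  qed (use P p in \<open>auto simp: PG.is_group conj_comp conj_eq_iff\<close>)
  then obtain z where z: "z \<in> P" "z \<noteq> \<one>" "\<And>w. w \<in> P \<Longrightarrow> w \<otimes> z \<otimes> inv w = z" by auto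
  show ?thesis by (rule that[of z]) (use z conj_eq_iff P.mem_carrier in auto)
qed

lemma (in group) conj_image_subgroup:
  assumes fin: "finite (carrier G)" and "P \<subseteq> carrier G" "n \<in> carrier G"
    and n: "\<And>z. z \<in> P \<Longrightarrow> n \<otimes> z \<otimes> inv n \<in> P"
  shows "(\<lambda>z. n \<otimes> z \<otimes> inv n) ` P = P"
proof (rule endo_inj_surj)
  show "finite P" using assms finite_subset by blast
  show "inj_on (\<lambda>z. n \<otimes> z \<otimes> inv n) P"
    using assms(2,3) conj_inj by (meson inj_onI subsetD)
qed (use n in auto)

text \<open>The central elements of \<open>P\<close> with trivial \<open>p\<close>-th power form a
  characteristic subgroup, non-trivial and elementary abelian: a vector space over the field of
  \<open>p\<close> elements. Conjugation by \<open>n\<close> is linear on it with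
  \<open>q\<close>-th power the identity; as \<open>q\<close> divides \<open>p - 1\<close>, it has
  an eigenvector, which serves as the \<open>x\<close> of the arc.\<close>

lemma (in group) has_arc_if_normalizes_p_subgroup:
  assumes fin: "finite (carrier G)" and P: "subgroup P G" "card P = p ^ a" "a > 0"
    and p: "Factorial_Ring.prime (p::nat)" and q: "Factorial_Ring.prime (q::nat)" "q dvd p - 1"
    and n: "n \<in> carrier G" "ord n = q" "\<And>z. z \<in> P \<Longrightarrow> n \<otimes> z \<otimes> inv n \<in> P"
  shows "has_arc G q p"
proof -
  interpret P: subgroup P G by fact
  define Z where "Z = {z \<in> P. z [^] p = \<one> \<and> (\<forall>w\<in>P. w \<otimes> z = z \<otimes> w)}"
  have ZP: "z \<in> P" and Zp: "z [^] p = \<one>" if "z \<in> Z" for z using that unfolding Z_def by blast+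
  have Zcomm: "w \<otimes> z = z \<otimes> w" if "z \<in> Z" "w \<in> P" for w z using that unfolding Z_def by blast
  have ZI: "z \<in> Z" if "z \<in> P" "z [^] p = \<one>" "\<And>w. w \<in> P \<Longrightarrow> w \<otimes> z = z \<otimes> w" for z
    using that unfolding Z_def by blast
  have Zc: "z \<in> carrier G" if "z \<in> Z" for z using ZP[OF that] P.mem_carrier by blast
  have Z: "subgroup Z G"
  proof
    show "Z \<subseteq> carrier G" using Zc by blast
    show "\<one> \<in> Z" by (rule ZI) (simp_all add: P.one_closed P.mem_carrier)
    fix x y assume xy: "x \<in> Z" "y \<in> Z"
    then have c: "x \<in> carrier G" "y \<in> carrier G" using Zc by auto
    have "x \<otimes> y = y \<otimes> x" by (rule Zcomm[OF xy(2) ZP[OF xy(1)]])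
    from pow_mult_distrib[OF this c, of p] have "(x \<otimes> y) [^] p = \<one>" by (simp add: Zp[OF xy(1)] Zp[OF xy(2)])
    moreover have "w \<otimes> (x \<otimes> y) = x \<otimes> y \<otimes> w" if "w \<in> P" for w
    proof -
      have "w \<otimes> (x \<otimes> y) = x \<otimes> w \<otimes> y"
        using Zcomm[OF xy(1) that] c P.mem_carrier[OF that] by (simp add: m_assoc[symmetric])
      also have "\<dots> = x \<otimes> (y \<otimes> w)"
        using Zcomm[OF xy(2) that] c P.mem_carrier[OF that] by (simp add: m_assoc)
      also have "\<dots> = x \<otimes> y \<otimes> w" using c P.mem_carrier[OF that] by (simp add: m_assoc)
      finally show ?thesis .
    qed
    ultimately show "x \<otimes> y \<in> Z" using ZI[OF P.m_closed[OF ZP[OF xy(1)] ZP[OF xy(2)]]] by blast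
    have "inv x [^] p = \<one>" using Zp[OF xy(1)] c by (simp add: nat_pow_inv)
    moreover have "w \<otimes> inv x = inv x \<otimes> w" if "w \<in> P" for w
    proof -
      have "w \<otimes> x = x \<otimes> w" by (rule Zcomm[OF xy(1) that])
      then have "inv x \<otimes> (w \<otimes> x) \<otimes> inv x = inv x \<otimes> (x \<otimes> w) \<otimes> inv x" by simp
      moreover have "inv x \<otimes> (w \<otimes> x) \<otimes> inv x = inv x \<otimes> w" using c P.mem_carrier[OF that] by (simp add: m_assoc)
      moreover have "inv x \<otimes> (x \<otimes> w) \<otimes> inv x = w \<otimes> inv x" using c P.mem_carrier[OF that] by (simp flip: m_assoc)
      ultimately show ?thesis by simp
    qed
    ultimately show "inv x \<in> Z" using ZI[OF P.m_inv_closed[OF ZP[OF xy(1)]]] by blast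
  qed
  interpret ZG: comm_group "G\<lparr>carrier := Z\<rparr>"
  proof (rule group.group_comm_groupI)
    show "group (G\<lparr>carrier := Z\<rparr>)" using Z subgroup.subgroup_is_group is_group by blast
    fix x y assume "x \<in> carrier (G\<lparr>carrier := Z\<rparr>)" "y \<in> carrier (G\<lparr>carrier := Z\<rparr>)"
    then show "x \<otimes>\<^bsub>G\<lparr>carrier := Z\<rparr>\<^esub> y = y \<otimes>\<^bsub>G\<lparr>carrier := Z\<rparr>\<^esub> x" using Zcomm ZP by auto
  qed
  define h where "h z = n \<otimes> z \<otimes> inv n" for z
  \<comment> \<open>Surjectivity of \<open>h\<close> on \<open>P\<close> is what carries centrality
    over: every \<open>w\<close> in \<open>P\<close> is some \<open>h w'\<close>.\<close>
  have img: "h ` P = P"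
    unfolding h_def by (rule conj_image_subgroup[OF fin P.subset n(1,3)])
  have hZ: "h z \<in> Z" if "z \<in> Z" for z
  proof -
    have "h z [^] p = h (z [^] p)" using that Zc n(1) by (simp add: h_def conj_pow)
    also have "\<dots> = \<one>" using Zp[OF that] n(1) by (simp add: h_def)
    finally have "h z [^] p = \<one>" .
    moreover have "w \<otimes> h z = h z \<otimes> w" if "w \<in> P" for w
    proof -
      have "w \<in> h ` P" using that img by simp
      then obtain w' where w': "w' \<in> P" "w = h w'" by (rule imageE)
      have "w \<otimes> h z = h (w' \<otimes> z)" using w' Zc[OF \<open>z \<in> Z\<close>] n(1) by (simp add: h_def conj_mult P.mem_carrier)
      also have "w' \<otimes> z = z \<otimes> w'" by (rule Zcomm[OF \<open>z \<in> Z\<close> w'(1)])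
      also have "h (z \<otimes> w') = h z \<otimes> w" using w' Zc[OF \<open>z \<in> Z\<close>] n(1) by (simp add: h_def conj_mult P.mem_carrier)
      finally show ?thesis .
    qed
    moreover have "h z \<in> P" using imageI[OF ZP[OF that], of h] img by simp
    ultimately show ?thesis using ZI by blast
  qed
  have hhom: "h \<in> hom (G\<lparr>carrier := Z\<rparr>) (G\<lparr>carrier := Z\<rparr>)"
    by (rule homI) (use hZ Zc n(1) in \<open>auto simp: h_def conj_mult\<close>)
  obtain z0 where z0: "z0 \<in> P" "z0 \<noteq> \<one>" "\<And>w. w \<in> P \<Longrightarrow> w \<otimes> z0 = z0 \<otimes> w"
    using p_subgroup_center_nontrivial[OF fin P p] by blast
  interpret PG: group "G\<lparr>carrier := P\<rparr>" using P(1) subgroup.subgroup_is_group is_group by blast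
  have z0c: "z0 \<in> carrier G" using z0(1) P.mem_carrier by blast
  have "z0 [^] (p ^ a) = \<one>"
    using PG.pow_order_eq_1[of z0] z0(1) P(2) by (simp add: Coset.order_def nat_pow_consistent[symmetric])
  then have "ord z0 dvd p ^ a" using z0c pow_eq_id by blast
  moreover have "ord z0 \<noteq> 1" using z0(2) z0c ord_eq_1 by blast
  moreover obtain i where "ord z0 = p ^ i" using calculation(1) p divides_primepow_nat by blast
  ultimately have "p dvd ord z0" by (cases i) auto
  \<comment> \<open>\<open>z0\<close> is central but may have a larger \<open>p\<close>-power order;
    this power of it has order \<open>p\<close> and so lies in \<open>Z\<close>.\<close>
  define z where "z = z0 [^] (ord z0 div p)"
  have "ord z = p" unfolding z_def using ord_power_dvd[OF z0c \<open>p dvd ord z0\<close>] ord_pos[OF fin z0c] by simp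
  moreover have "z \<in> P"
  proof -
    have "z0 [^] i \<in> P" for i :: nat using z0(1) by (induction i) auto
    then show ?thesis by (simp add: z_def)
  qed
  moreover have "w \<otimes> z = z \<otimes> w" if "w \<in> P" for w
  proof -
    have "w \<otimes> z0 [^] k = z0 [^] k \<otimes> w" for k :: nat
      using group_commutes_pow[OF z0(3)[OF that, symmetric] z0c P.mem_carrier[OF that]] by simp
    then show ?thesis by (simp add: z_def)
  qed
  moreover have "z \<noteq> \<one>" "z [^] p = \<one>"
    using ord_prime_iff[OF _ p, of z] \<open>ord z = p\<close> P.mem_carrier[OF \<open>z \<in> P\<close>] by auto
  ultimately have z: "z \<in> Z" "z \<noteq> \<one>"
    by (auto intro: ZI)
  have pow: "(h ^^ i) z = n [^] i \<otimes> z \<otimes> inv (n [^] i)" for i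
  proof (induction i)
    case (Suc i)
    have "n \<otimes> n [^] i = n [^] Suc i" using n(1) by (metis nat_pow_Suc2)
    then show ?case using Suc n(1) Zc[OF z(1)] conj_comp[of n "n [^] i" z] by (simp add: h_def del: nat_pow_Suc)
  qed (use Zc z in simp)
  have "(h ^^ q) z = z" using pow[of q] n pow_ord_eq_1[OF n(1)] Zc[OF z(1)] by simp
  moreover have "x [^]\<^bsub>G\<lparr>carrier := Z\<rparr>\<^esub> p = \<one>\<^bsub>G\<lparr>carrier := Z\<rparr>\<^esub>" if "x \<in> carrier (G\<lparr>carrier := Z\<rparr>)" for x
    using Zp[of x] that by (simp add: nat_pow_consistent[symmetric])
  ultimately have "\<exists>v\<in>carrier (G\<lparr>carrier := Z\<rparr>). v \<noteq> \<one>\<^bsub>G\<lparr>carrier := Z\<rparr>\<^esub> \<and>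
      (\<exists>k::nat. h v = v [^]\<^bsub>G\<lparr>carrier := Z\<rparr>\<^esub> k)"
    using z by (intro ZG.eigenvector[OF p q _ hhom, of z]) simp_all
  then obtain v k where v: "v \<in> Z" "v \<noteq> \<one>" "h v = v [^] (k::nat)"
    by (auto simp: nat_pow_consistent[symmetric])
  have "ord v = p" using ord_prime_iff[OF Zc p] Zp v by blast
  then show ?thesis
    unfolding has_arc_def using v(3) n Zc[OF v(1)] unfolding h_def by blast
qed

text \<open>The Frattini argument: some \<open>l \<otimes> h\<close> with \<open>l \<in> L\<close> normalizes a Sylow \<open>p\<close>-subgroup of \<open>L\<close>, and
  its order is still divisible by \<open>q\<close>.\<close>

lemma (in group) has_arc_if_normalizes:
  assumes fin: "finite (carrier G)" and L: "subgroup L G" "p dvd card L"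
    and p: "Factorial_Ring.prime (p::nat)" and q: "Factorial_Ring.prime (q::nat)" "q dvd p - 1"
    and h: "h \<in> carrier G" "\<And>l. l \<in> L \<Longrightarrow> h \<otimes> l \<otimes> inv h \<in> L"
      "\<And>m::nat. h [^] m \<in> L \<Longrightarrow> q dvd m"
  shows "has_arc G q p"
proof -
  interpret L: subgroup L G by fact
  interpret LG: group "G\<lparr>carrier := L\<rparr>" using L(1) subgroup.subgroup_is_group is_group by blast
  have finL: "finite L" using fin L.subset finite_subset by blast
  then have "card L \<noteq> 0" using L.one_closed by (metis card_0_eq empty_iff)
  then obtain a m where am: "card L = p ^ a * m" "\<not> p dvd m"
    using p multiplicity_decompose'[of "card L" p] by (metis not_prime_unit)
  have "a > 0" using am L(2) by (cases a) auto
  obtain P where P: "subgroup P (G\<lparr>carrier := L\<rparr>)" "card P = p ^ a"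
    using sylow_thm[OF p LG.is_group, of a m] am finL by (auto simp: Coset.order_def)
  have PL: "P \<subseteq> L" using subgroup.subset[OF P(1)] by simp
  have PG: "subgroup P G" using P(1) L(1) incl_subgroup by blast
  define Q where "Q = (\<lambda>z. h \<otimes> z \<otimes> inv h) ` P"
  have "subgroup Q (G\<lparr>carrier := L\<rparr>)"
  proof (rule subgroup_incl)
    have "h <# P #> inv h = Q" by (auto simp: Q_def l_coset_def r_coset_def)
    then show "subgroup Q G" using subgroup_conjugation_is_surj2[OF h(1) PG] by simp
    show "Q \<subseteq> L" using h(2) PL by (auto simp: Q_def)
  qed (rule L(1))
  moreover have "card Q = p ^ a"
    unfolding Q_def P(2)[symmetric] using conj_inj h(1) PL L.subset
    by (intro card_image inj_onI) (meson subsetD)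
  moreover have "\<not> p dvd card (rcosets\<^bsub>G\<lparr>carrier := L\<rparr>\<^esub> P)"
  proof -
    have "card (rcosets\<^bsub>G\<lparr>carrier := L\<rparr>\<^esub> P) * p ^ a = p ^ a * m"
      using LG.lagrange[OF P(1)] P(2) am(1) by (simp add: Coset.order_def)
    then have "card (rcosets\<^bsub>G\<lparr>carrier := L\<rparr>\<^esub> P) = m" using p by (simp add: prime_gt_0_nat)
    then show ?thesis using am(2) by simp
  qed
  ultimately obtain l where l: "l \<in> L" "\<And>g. g \<in> Q \<Longrightarrow> l \<otimes> g \<otimes> inv l \<in> P"
    using LG.p_subgroup_conj_into_sylow[OF _ P(1) _ _ p, of Q a] finL L(1) by (auto simp: m_inv_consistent)
  have lc: "l \<in> carrier G" using l(1) L.mem_carrier by blast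
  define n where "n = l \<otimes> h"
  have n: "n \<in> carrier G" using lc h by (simp add: n_def)
  have nP: "n \<otimes> z \<otimes> inv n \<in> P" if "z \<in> P" for z
  proof -
    have "z \<in> carrier G" using that PL L.subset by blast
    then have "n \<otimes> z \<otimes> inv n = l \<otimes> (h \<otimes> z \<otimes> inv h) \<otimes> inv l" unfolding n_def by (rule conj_comp[OF lc h(1)])
    then show ?thesis using l(2) that by (simp add: Q_def)
  qed
  \<comment> \<open>The powers of \<open>n\<close> and \<open>h\<close> agree modulo
    \<open>L\<close>. So \<open>n [^] i = \<one>\<close> puts \<open>h [^] i\<close> into
    \<open>L\<close>, and \<open>q\<close> divides \<open>i\<close>.\<close>
  have pow: "\<exists>l'\<in>L. n [^] (i::nat) = l' \<otimes> h [^] i" for i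
  proof (induction i)
    case (Suc i)
    then obtain l' where l': "l' \<in> L" "n [^] i = l' \<otimes> h [^] i" by blast
    have "(h [^] j) \<otimes> l \<otimes> inv (h [^] j) \<in> L" for j :: nat
    proof (induction j)
      case (Suc j)
      have "h \<otimes> h [^] j = h [^] Suc j" using h(1) by (metis nat_pow_Suc2)
      then show ?case using conj_comp[OF h(1) _ lc, of "h [^] j"] h(2)[OF Suc] h(1) by (simp del: nat_pow_Suc)
    qed (use l(1) lc in simp)
    then have *: "l' \<otimes> (h [^] i \<otimes> l \<otimes> inv (h [^] i)) \<in> L" using l'(1) by blast
    have "inv (h [^] i) \<otimes> (h [^] i \<otimes> h) = h" using h(1) by (simp flip: m_assoc)
    then have "n [^] Suc i = l' \<otimes> (h [^] i \<otimes> l \<otimes> inv (h [^] i)) \<otimes> h [^] Suc i"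
      using l' h(1) lc L.mem_carrier[OF l'(1)] by (simp add: n_def m_assoc)
    then show ?case using * by blast
  qed (use L.one_closed in auto)
  have "q dvd i" if "n [^] (i::nat) = \<one>" for i
  proof -
    obtain l' where l': "l' \<in> L" "\<one> = l' \<otimes> h [^] i" using pow[of i] \<open>n [^] i = \<one>\<close> by auto
    then have "inv (h [^] i) = l'" using h(1) L.mem_carrier by (intro inv_equality) auto
    then have "h [^] i = inv l'" using h(1) inv_inv[of "h [^] i"] by simp
    then show ?thesis using h(3) l'(1) by simp
  qed
  then have "q dvd ord n" using n pow_ord_eq_1 by blast
  \<comment> \<open>The order of \<open>n\<close> may be a proper multiple of \<open>q\<close>; a
    power of \<open>n\<close> has order \<open>q\<close> and still normalizes
    \<open>P\<close>.\<close>
  then have "ord (n [^] (ord n div q)) = q" using ord_power_dvd[OF n] ord_pos[OF fin n] by simp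
  moreover have "n [^] i \<otimes> z \<otimes> inv (n [^] i) \<in> P" if "z \<in> P" for z and i :: nat
  proof (induction i)
    case (Suc i)
    have "n \<otimes> n [^] i = n [^] Suc i" using n by (metis nat_pow_Suc2)
    moreover have "z \<in> carrier G" using that PL L.subset by blast
    ultimately show ?case using conj_comp[OF n, of "n [^] i" z] nP[OF Suc] n by (simp del: nat_pow_Suc)
  qed (use that PL L.subset in auto)
  ultimately show ?thesis
    using has_arc_if_normalizes_p_subgroup[OF fin PG P(2) \<open>a > 0\<close> p q, of "n [^] (ord n div q)"] n by simp
qed

section \<open>A criterion for almost simplicity\<close>

lemma (in group) ord_subgroup:
  assumes "subgroup H G" "x \<in> H"
  shows "group.ord (G\<lparr>carrier := H\<rparr>) x = ord x"
proof -
  have "id \<in> hom (G\<lparr>carrier := H\<rparr>) G" using subgroup.subset[OF assms(1)] by (auto simp: hom_def)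
  from ord_inj_hom[OF _ is_group this, of x] show ?thesis
    using assms subgroup.subgroup_is_group[OF assms(1) is_group] by simp
qed

lemma (in group) cauchy_subgroup:
  assumes "finite (carrier G)" "subgroup H G" "Factorial_Ring.prime (p::nat)" "p dvd card H"
  shows "\<exists>x\<in>H. ord x = p"
proof -
  interpret H: group "G\<lparr>carrier := H\<rparr>" using assms subgroup.subgroup_is_group is_group by blast
  have "finite H" using assms(1,2) subgroup.subset finite_subset by blast
  then have "has_ord (G\<lparr>carrier := H\<rparr>) p"
    using assms by (intro H.cauchy) (auto simp: Coset.order_def)
  then show ?thesis using ord_subgroup[OF assms(2)] by (auto simp: has_ord_def)
qed

section \<open>Normal subgroups of order prime to a given prime\<close>

lemma (in group) normal_set_mult:
  assumes "S \<lhd> G" "T \<lhd> G"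
  shows "S <#> T \<lhd> G"
proof (rule normal_invI)
  have sub: "subgroup S G" "subgroup T G" using assms normal_imp_subgroup by auto
  have "S <#> T = T <#> S" using commut_normal[OF sub(2) assms(1)] by simp
  then show "subgroup (S <#> T) G" using sub mult_norm_subgroup[OF assms(1) sub(2)] by simp
  fix g x assume "g \<in> carrier G" "x \<in> S <#> T"
  then obtain s t where st: "s \<in> S" "t \<in> T" "x = s \<otimes> t" by (auto simp: set_mult_def)
  have "g \<otimes> x \<otimes> inv g = (g \<otimes> s \<otimes> inv g) \<otimes> (g \<otimes> t \<otimes> inv g)"
    unfolding st(3) using subgroup.mem_carrier[OF sub(1) st(1)] subgroup.mem_carrier[OF sub(2) st(2)]
    by (rule conj_mult[OF \<open>g \<in> carrier G\<close>])
  moreover have "g \<otimes> s \<otimes> inv g \<in> S" "g \<otimes> t \<otimes> inv g \<in> T"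
    using normal_invE(2)[OF assms(1) \<open>g \<in> carrier G\<close> st(1)]
      normal_invE(2)[OF assms(2) \<open>g \<in> carrier G\<close> st(2)] by auto
  ultimately show "g \<otimes> x \<otimes> inv g \<in> S <#> T" unfolding set_mult_def by blast
qed

text \<open>If \<open>x = s \<otimes> t\<close> has order \<open>p\<close>, its \<open>p\<close>-th
  power agrees with \<open>t [^] p\<close> modulo \<open>S\<close>, so
  \<open>t [^] p \<in> S\<close>. As \<open>p\<close> does not divide the order of \<open>t\<close>,
  \<open>t\<close> is a power of \<open>t [^] p\<close>; so \<open>t\<close>, and with it
  \<open>x\<close>, lies in \<open>S\<close>, and \<open>p\<close> would divide
  \<open>card S\<close>.\<close>

lemma (in group) prime_not_dvd_card_set_mult:
  assumes fin: "finite (carrier G)" and ST: "S \<lhd> G" "T \<lhd> G"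
    and p: "Factorial_Ring.prime (p::nat)" "\<not> p dvd card S" "\<not> p dvd card T"
  shows "\<not> p dvd card (S <#> T)"
proof
  assume "p dvd card (S <#> T)"
  moreover have "subgroup (S <#> T) G" using normal_set_mult[OF ST] normal_imp_subgroup by blast
  ultimately obtain x where x: "x \<in> S <#> T" "ord x = p" using cauchy_subgroup[OF fin _ p(1)] by blast
  interpret S: normal S G by fact
  interpret T: normal T G by fact
  obtain s t where st: "s \<in> S" "t \<in> T" "x = s \<otimes> t" using x(1) by (auto simp: set_mult_def)
  have c: "s \<in> carrier G" "t \<in> carrier G" using st by auto
  have pow: "\<exists>s'\<in>S. x [^] (i::nat) = s' \<otimes> t [^] i" for i
  proof (induction i)
    case (Suc i)
    then obtain s' where s': "s' \<in> S" "x [^] i = s' \<otimes> t [^] i" by blast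
    have "s' \<otimes> (t [^] i \<otimes> s \<otimes> inv (t [^] i)) \<in> S"
      using s'(1) normal_invE(2)[OF ST(1) _ st(1), of "t [^] i"] c by blast
    moreover have "inv (t [^] i) \<otimes> (t [^] i \<otimes> t) = t" using c by (simp flip: m_assoc)
    then have "x [^] Suc i = s' \<otimes> (t [^] i \<otimes> s \<otimes> inv (t [^] i)) \<otimes> t [^] Suc i"
      using s' c S.mem_carrier[OF s'(1)] by (simp add: st(3) m_assoc)
    ultimately show ?case by blast
  qed (use S.one_closed in auto)
  obtain s' where s': "s' \<in> S" "x [^] p = s' \<otimes> t [^] p" using pow by blast
  have "x [^] p = \<one>" using x(2) st c pow_ord_eq_1 by (metis m_closed)
  then have "inv (t [^] p) = s'" using s' c by (intro inv_equality) auto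
  then have tp: "t [^] p \<in> S" using s'(1) c inv_inv[of "t [^] p"] S.m_inv_closed by fastforce
  have "ord t dvd card T"
    using ord_subgroup[OF T.subgroup_axioms st(2)] subgroup.subgroup_is_group[OF T.subgroup_axioms is_group]
      group.ord_dvd_group_order[of "G\<lparr>carrier := T\<rparr>" t] st(2) by (simp add: Coset.order_def)
  then have "coprime p (ord t)" using p by (meson dvd_trans prime_imp_coprime)
  then obtain u where "[p * u = 1] (mod ord t)" using cong_solve_coprime_nat by auto
  from pow_cong[OF c(2) pow_ord_eq_1[OF c(2)] this] have "t = (t [^] p) [^] u"
    using c by (simp add: nat_pow_pow nat_pow_eone)
  moreover have "(t [^] p) [^] i \<in> S" for i :: nat using tp by (induction i) auto
  ultimately have "t \<in> S" by (rule ssubst)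
  then have "x \<in> S" using st by simp
  have "ord x dvd card S"
    using ord_subgroup[OF S.subgroup_axioms \<open>x \<in> S\<close>] subgroup.subgroup_is_group[OF S.subgroup_axioms is_group]
      group.ord_dvd_group_order[of "G\<lparr>carrier := S\<rparr>" x] \<open>x \<in> S\<close> by (simp add: Coset.order_def)
  then show False using x(2) p(2) by simp
qed

text \<open>The subgroup known as O_p'(G). A candidate of maximal cardinality absorbs every other
  one, because the product of two candidates is again a candidate.\<close>

lemma (in group) largest_normal_subgroup_of_order_prime_to:
  assumes fin: "finite (carrier G)" and p: "Factorial_Ring.prime (p::nat)"
  obtains T where "T \<lhd> G" "\<not> p dvd card T" "\<And>S. S \<lhd> G \<Longrightarrow> \<not> p dvd card S \<Longrightarrow> S \<subseteq> T"
proof -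
  define C where "C = {T. T \<lhd> G \<and> \<not> p dvd card T}"
  have "C \<subseteq> Pow (carrier G)" 
    using normal_imp_subgroup[of _ G] subgroup.subset[of _ G] unfolding C_def by blast
  then have finC: "finite C" using fin finite_subset by blast
  have "{\<one>} \<in> C" using one_is_normal p by (auto simp: C_def)
  then have neC: "C \<noteq> {}" by blast
  obtain T where TC: "T \<in> C" and max: "Max (card ` C) = card T"
    by (rule obtains_MAX[OF finC neC])
  have T: "T \<lhd> G" "\<not> p dvd card T" using TC by (auto simp: C_def)
  have "S \<subseteq> T" if S: "S \<lhd> G" "\<not> p dvd card S" for S
  proof -
    have "S <#> T \<in> C"
      using normal_set_mult[OF S(1) T(1)] prime_not_dvd_card_set_mult[OF fin S(1) T(1) p S(2) T(2)]
      by (simp add: C_def)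
    then have le: "card (S <#> T) \<le> card T" unfolding max[symmetric] using finC by simp
    have sub: "subgroup S G" "subgroup T G" using S T(1) normal_imp_subgroup by auto
    have "T \<subseteq> S <#> T" unfolding set_mult_def
      using subgroup.one_closed[OF sub(1)] subgroup.mem_carrier[OF sub(2)] by force
    moreover have "S \<subseteq> S <#> T" unfolding set_mult_def
      using subgroup.one_closed[OF sub(2)] subgroup.mem_carrier[OF sub(1)] by force
    moreover have "finite (S <#> T)" 
      using fin setmult_subset_G[OF subgroup.subset[OF sub(1)] subgroup.subset[OF sub(2)]] finite_subset by blast
    ultimately have "T = S <#> T" using le by (intro card_seteq)
    with \<open>S \<subseteq> S <#> T\<close> show ?thesis by simp
  qed
  then show ?thesis using that T by blast
qed

lemma (in group) conj_iso_normal: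
  assumes "N \<lhd> G" "g \<in> carrier G"
  shows "(\<lambda>x. g \<otimes> x \<otimes> inv g) \<in> iso (G\<lparr>carrier := N\<rparr>) (G\<lparr>carrier := N\<rparr>)"
proof -
  interpret N: normal N G by fact
  have "(\<lambda>x. g \<otimes> x \<otimes> inv g) \<in> hom (G\<lparr>carrier := N\<rparr>) (G\<lparr>carrier := N\<rparr>)"
    by (rule homI) (use assms normal_invE(2) conj_mult in auto)
  moreover have "bij_betw (\<lambda>x. g \<otimes> x \<otimes> inv g) N N"
  proof (rule bij_betw_byWitness[where f' = "\<lambda>x. inv g \<otimes> x \<otimes> inv (inv g)"])
    show "\<forall>a\<in>N. inv g \<otimes> (g \<otimes> a \<otimes> inv g) \<otimes> inv (inv g) = a"
      "\<forall>a\<in>N. g \<otimes> (inv g \<otimes> a \<otimes> inv (inv g)) \<otimes> inv g = a"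
      using assms(2) conj_comp[of "inv g" g] conj_comp[of g "inv g"] by (simp_all flip: conj_comp)
  qed (use assms normal_invE(2) in blast)+
  ultimately show ?thesis by (simp add: iso_def)
qed

lemma (in group) conj_normal_in_normal:
  assumes "N \<lhd> G" "g \<in> carrier G" "S \<lhd> G\<lparr>carrier := N\<rparr>"
  shows "(\<lambda>x. g \<otimes> x \<otimes> inv g) ` S \<lhd> G\<lparr>carrier := N\<rparr>"
proof -
  have "group (G\<lparr>carrier := N\<rparr>)"
    using subgroup.subgroup_is_group[OF normal_imp_subgroup[OF assms(1)] is_group] .
  from iso_normal_subgroup[OF conj_iso_normal[OF assms(1,2)] this this assms(3)] show ?thesis .
qed

lemma (in group) card_conj_image:
  assumes "g \<in> carrier G" "S \<subseteq> carrier G"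
  shows "card ((\<lambda>x. g \<otimes> x \<otimes> inv g) ` S) = card S"
proof (rule card_image, rule inj_onI)
  fix x y assume "x \<in> S" "y \<in> S" "g \<otimes> x \<otimes> inv g = g \<otimes> y \<otimes> inv g"
  moreover from this have "x \<in> carrier G" "y \<in> carrier G" using assms(2) by auto
  ultimately show "x = y" using conj_inj[OF assms(1), of x y] by simp
qed

text \<open>A normal subgroup of \<open>N\<close> need not be normal in \<open>G\<close>, but the
  largest one of order prime to \<open>p\<close> is, since conjugation in \<open>G\<close> preserves
  its defining property. If \<open>p\<close> did not divide \<open>card S\<close>, that subgroup
  would contain \<open>S\<close> and so be a non-trivial normal subgroup of
  \<open>G\<close>.\<close>

lemma (in group) prime_dvd_card_normal_in_normal:
  assumes fin: "finite (carrier G)" and p: "Factorial_Ring.prime (p::nat)"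
    and dvd: "\<And>M. M \<lhd> G \<Longrightarrow> M \<noteq> {\<one>} \<Longrightarrow> p dvd card M"
    and N: "N \<lhd> G" and S: "S \<lhd> G\<lparr>carrier := N\<rparr>" "S \<noteq> {\<one>}"
  shows "p dvd card S"
proof (rule ccontr)
  assume "\<not> p dvd card S"
  interpret N: normal N G by fact
  interpret NG: group "G\<lparr>carrier := N\<rparr>" using N.subgroup_axioms subgroup.subgroup_is_group is_group by blast
  have "finite (carrier (G\<lparr>carrier := N\<rparr>))" using fin N.subset finite_subset by auto
  then obtain T where T: "T \<lhd> G\<lparr>carrier := N\<rparr>" "\<not> p dvd card T"
    "\<And>S. S \<lhd> G\<lparr>carrier := N\<rparr> \<Longrightarrow> \<not> p dvd card S \<Longrightarrow> S \<subseteq> T"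
    using NG.largest_normal_subgroup_of_order_prime_to[OF _ p] by blast
  have TN: "T \<subseteq> N" using normal_imp_subgroup[OF T(1)] subgroup.subset by fastforce
  have "T \<lhd> G"
  proof (rule normal_invI)
    show "subgroup T G" using incl_subgroup[OF N.subgroup_axioms normal_imp_subgroup[OF T(1)]] .
    fix g x assume gx: "g \<in> carrier G" "x \<in> T"
    have "(\<lambda>x. g \<otimes> x \<otimes> inv g) ` T \<subseteq> T"
    proof (rule T(3)[OF conj_normal_in_normal[OF N gx(1) T(1)]])
      show "\<not> p dvd card ((\<lambda>x. g \<otimes> x \<otimes> inv g) ` T)"
        using card_conj_image[OF gx(1), of T] TN N.subset T(2) by auto
    qed
    then show "g \<otimes> x \<otimes> inv g \<in> T" using gx(2) by blast
  qed
  moreover have "T \<noteq> {\<one>}"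
  proof
    assume "T = {\<one>}"
    then have "S \<subseteq> {\<one>}" using T(3) S(1) \<open>\<not> p dvd card S\<close> by blast
    moreover have "\<one> \<in> S" using subgroup.one_closed[OF normal_imp_subgroup[OF S(1)]] by simp
    ultimately show False using S(2) by blast
  qed
  ultimately show False using dvd T(2) by blast
qed


lemma (in group) minimal_nontrivial_normal:
  assumes "finite (carrier G)" "carrier G \<noteq> {\<one>}"
  obtains N where "N \<lhd> G" "N \<noteq> {\<one>}" "\<And>M. M \<lhd> G \<Longrightarrow> M \<noteq> {\<one>} \<Longrightarrow> card N \<le> card M"
proof -
  define P where "P n \<longleftrightarrow> (\<exists>M. M \<lhd> G \<and> M \<noteq> {\<one>} \<and> card M = n)" for n
  have "carrier G \<lhd> G" by (rule normal_invI) (auto simp: subgroup_self)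
  then have "P (card (carrier G))" using assms(2) by (auto simp: P_def)
  then have "P (LEAST n. P n)" by (rule LeastI)
  then obtain N where N: "N \<lhd> G" "N \<noteq> {\<one>}" "card N = (LEAST n. P n)" by (auto simp: P_def)
  show ?thesis
  proof (rule that[OF N(1,2)])
    fix M assume "M \<lhd> G" "M \<noteq> {\<one>}"
    then have "P (card M)" unfolding P_def by blast
    then show "card N \<le> card M" unfolding N(3) by (rule Least_le)
  qed
qed

lemma normal_centralizer:
  assumes "group G" "N \<lhd> G"
  shows "{g \<in> carrier G. \<forall>x\<in>N. g \<otimes>\<^bsub>G\<^esub> x \<otimes>\<^bsub>G\<^esub> inv\<^bsub>G\<^esub> g = x} \<lhd> G" (is "?C \<lhd> G")
proof -
  interpret group G by fact
  have Nc: "x \<in> carrier G" if "x \<in> N" for x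
    using subgroup.mem_carrier[OF normal_imp_subgroup[OF assms(2)] that] .
  have inv_eq: "inv\<^bsub>G\<^esub> a \<otimes>\<^bsub>G\<^esub> x \<otimes>\<^bsub>G\<^esub> inv\<^bsub>G\<^esub> (inv\<^bsub>G\<^esub> a) = x" if "a \<in> ?C" "x \<in> N" for a x
    using that conj_comp[of "inv\<^bsub>G\<^esub> a" a x] Nc[of x] by auto
  have "subgroup ?C G"
  proof
    fix a b assume "a \<in> ?C" "b \<in> ?C"
    then show "a \<otimes>\<^bsub>G\<^esub> b \<in> ?C" using Nc by (auto simp: conj_comp)
  next
    fix a assume "a \<in> ?C"
    then show "inv\<^bsub>G\<^esub> a \<in> ?C" using inv_eq[of a] by auto
  qed (use Nc in auto)
  then show ?thesis
  proof (rule normal_invI)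
    fix g a assume g: "g \<in> carrier G" and a: "a \<in> ?C"
    have *: "(g \<otimes>\<^bsub>G\<^esub> a \<otimes>\<^bsub>G\<^esub> inv\<^bsub>G\<^esub> g) \<otimes>\<^bsub>G\<^esub> x \<otimes>\<^bsub>G\<^esub> inv\<^bsub>G\<^esub> (g \<otimes>\<^bsub>G\<^esub> a \<otimes>\<^bsub>G\<^esub> inv\<^bsub>G\<^esub> g) = x" if x: "x \<in> N" for x
    proof -
      define y where "y = inv\<^bsub>G\<^esub> g \<otimes>\<^bsub>G\<^esub> x \<otimes>\<^bsub>G\<^esub> inv\<^bsub>G\<^esub> (inv\<^bsub>G\<^esub> g)"
      have y: "y \<in> N" unfolding y_def using normal_invE(2)[OF assms(2) inv_closed[OF g] x] .
      have *: "(g \<otimes>\<^bsub>G\<^esub> a \<otimes>\<^bsub>G\<^esub> inv\<^bsub>G\<^esub> g) \<otimes>\<^bsub>G\<^esub> x \<otimes>\<^bsub>G\<^esub> inv\<^bsub>G\<^esub> (g \<otimes>\<^bsub>G\<^esub> a \<otimes>\<^bsub>G\<^esub> inv\<^bsub>G\<^esub> g)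
        = g \<otimes>\<^bsub>G\<^esub> (a \<otimes>\<^bsub>G\<^esub> y \<otimes>\<^bsub>G\<^esub> inv\<^bsub>G\<^esub> a) \<otimes>\<^bsub>G\<^esub> inv\<^bsub>G\<^esub> g"
        unfolding y_def using g a Nc[OF x] by (simp add: conj_comp)
      also have "\<dots> = g \<otimes>\<^bsub>G\<^esub> y \<otimes>\<^bsub>G\<^esub> inv\<^bsub>G\<^esub> g" using a y by simp
      also have "\<dots> = x" 
        unfolding y_def using g Nc[OF x] conj_comp[OF g inv_closed[OF g] Nc[OF x]] by simp
      finally show ?thesis .
    qed
    have "g \<otimes>\<^bsub>G\<^esub> a \<otimes>\<^bsub>G\<^esub> inv\<^bsub>G\<^esub> g \<in> carrier G" using g a by simp
    with * show "g \<otimes>\<^bsub>G\<^esub> a \<otimes>\<^bsub>G\<^esub> inv\<^bsub>G\<^esub> g \<in> ?C" by blast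
  qed
qed

text \<open>Two normal subgroups of a group either meet or commute; since no element of order \<open>p\<close> commutes
  with one of order \<open>q\<close>, they always meet here, which leaves room for a single simple normal
  subgroup with trivial centralizer.\<close>

lemma almost_simple_if_all_normal_subgroups_dvd:
  fixes G :: "'a monoid" (structure)
  assumes "group G" and fin: "finite (carrier G)" and nontriv: "carrier G \<noteq> {\<one>}"
    and pq: "Factorial_Ring.prime (p::nat)" "Factorial_Ring.prime (q::nat)" "p \<noteq> q"
    and no_ord: "\<not> has_ord G (p * q)"
    and dvd: "\<And>M. M \<lhd> G \<Longrightarrow> M \<noteq> {\<one>} \<Longrightarrow> p dvd card M \<and> q dvd card M"
  shows "almost_simple G"
proof -
  interpret group G by fact
  have no_comm: "x \<otimes> y \<noteq> y \<otimes> x" if "x \<in> carrier G" "y \<in> carrier G" "ord x = p" "ord y = q" for x y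
  proof
    assume "x \<otimes> y = y \<otimes> x"
    then have "ord (x \<otimes> y) = p * q"
      using ord_mult_coprime[OF that(1,2)] that pq by (simp add: primes_coprime)
    then show False using no_ord that m_closed unfolding has_ord_def by blast
  qed
  obtain N where N: "N \<lhd> G" "N \<noteq> {\<one>}" "\<And>M. M \<lhd> G \<Longrightarrow> M \<noteq> {\<one>} \<Longrightarrow> card N \<le> card M"
    using minimal_nontrivial_normal[OF fin nontriv] by blast
  interpret N: normal N G by fact
  let ?N = "G\<lparr>carrier := N\<rparr>"
  interpret NG: group ?N using subgroup.subgroup_is_group[OF N.subgroup_axioms is_group] .
  have finN: "finite N" using fin N.subset finite_subset by blast
  have sub: "subgroup S G" "S \<subseteq> N" "finite S" if "S \<lhd> ?N" for S
  proof -
    show "subgroup S G" using incl_subgroup[OF N.subgroup_axioms normal_imp_subgroup[OF that]] .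
    show "S \<subseteq> N" using subgroup.subset[OF normal_imp_subgroup[OF that]] by simp
    then show "finite S" using finN finite_subset by blast
  qed
  have dvdN: "p dvd card S" "q dvd card S" if "S \<lhd> ?N" "S \<noteq> {\<one>}" for S
    using prime_dvd_card_normal_in_normal[OF fin _ _ N(1) that] pq dvd by blast+
  have meet: "S \<inter> T \<noteq> {\<one>}" if S: "S \<lhd> ?N" "S \<noteq> {\<one>}" and T: "T \<lhd> ?N" "T \<noteq> {\<one>}" for S T
  proof
    assume meet: "S \<inter> T = {\<one>}"
    obtain x where x: "x \<in> S" "ord x = p"
      using cauchy_subgroup[OF fin sub(1)[OF S(1)] pq(1) dvdN(1)[OF S]] by blast
    obtain y where y: "y \<in> T" "ord y = q"
      using cauchy_subgroup[OF fin sub(1)[OF T(1)] pq(2) dvdN(2)[OF T]] by blast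
    have "x \<otimes> y = y \<otimes> x"
      using NG.normal_imp_commuting[OF S(1) T(1) _ x(1) y(1)] meet by simp
    then show False
      using no_comm[OF _ _ x(2) y(2)] subgroup.mem_carrier[OF sub(1)[OF S(1)] x(1)]
        subgroup.mem_carrier[OF sub(1)[OF T(1)] y(1)] by blast
  qed
  obtain S where S: "S \<lhd> ?N" "S \<noteq> {\<one>}" "\<And>M. M \<lhd> ?N \<Longrightarrow> M \<noteq> {\<one>} \<Longrightarrow> card S \<le> card M"
    using NG.minimal_nontrivial_normal finN N(2) by auto
  \<comment> \<open>A conjugate of \<open>S\<close> is normal in \<open>N\<close>, so it meets
    \<open>S\<close> in a non-trivial normal subgroup of \<open>N\<close>, which by minimality is
    all of \<open>S\<close>.\<close>
  have "S \<lhd> G"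
  proof (rule normal_invI[OF sub(1)[OF S(1)]])
    fix g x assume g: "g \<in> carrier G" and x: "x \<in> S"
    let ?T = "(\<lambda>x. g \<otimes> x \<otimes> inv g) ` S"
    have T: "?T \<lhd> ?N" by (rule conj_normal_in_normal[OF N(1) g S(1)])
    have cT: "card ?T = card S" using card_conj_image[OF g] subgroup.subset[OF sub(1)[OF S(1)]] by blast
    have "?T \<noteq> {\<one>}"
    proof
      assume "?T = {\<one>}"
      then have "card S = 1" using cT by simp
      then show False using S(2) subgroup.one_closed[OF sub(1)[OF S(1)]] card_1_singletonE by (metis singletonD)
    qed
    then have "S \<inter> ?T \<noteq> {\<one>}" by (rule meet[OF S(1,2) T])
    moreover have "S \<inter> ?T \<lhd> ?N" by (rule NG.normal_subgroup_intersect[OF S(1) T])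
    ultimately have "card S \<le> card (S \<inter> ?T)" using S(3) by blast
    then have "S \<inter> ?T = S" by (rule card_seteq[OF sub(3)[OF S(1)] Int_lower1])
    then have "S \<subseteq> ?T" by (simp only: inf.absorb_iff1)
    then have "S = ?T" by (rule card_subset_eq[OF sub(3)[OF T] _ cT[symmetric]])
    show "g \<otimes> x \<otimes> inv g \<in> S" by (subst \<open>S = ?T\<close>) (rule imageI[OF x])
  qed
  then have "card N \<le> card S" using N(3) S(2) by blast
  have simple: "simple_group ?N"
  proof
    have "card N \<noteq> 1" using N(2) N.one_closed card_1_singletonE by (metis singletonD)
    moreover have "card N \<noteq> 0" using finN N.one_closed by (metis card_0_eq empty_iff)
    ultimately show "1 < order ?N" by (simp add: Coset.order_def)
    fix M assume M: "M \<lhd> ?N"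
    have "M = N" if "M \<noteq> {\<one>}"
      using card_seteq[OF finN sub(2)[OF M]] S(3)[OF M that] \<open>card N \<le> card S\<close> by simp
    then show "M = carrier ?N \<or> M = {\<one>\<^bsub>?N\<^esub>}" by auto
  qed
  have Nsub: "subgroup N G" by (rule N.subgroup_axioms)
  obtain xp where xp: "xp \<in> N" "ord xp = p"
    using cauchy_subgroup[OF fin Nsub pq(1)] dvd[OF N(1,2)] by blast
  obtain xq where xq: "xq \<in> N" "ord xq = q"
    using cauchy_subgroup[OF fin Nsub pq(2)] dvd[OF N(1,2)] by blast
  have noncomm: "\<not> comm_group ?N"
  proof
    assume "comm_group ?N"
    then have "xp \<otimes> xq = xq \<otimes> xp" using comm_groupE(4)[of ?N xp xq] xp(1) xq(1) by simp
    then show False using no_comm[OF _ _ xp(2) xq(2)] xp(1) xq(1) N.mem_carrier by blast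
  qed
  define C where "C = {g \<in> carrier G. \<forall>x\<in>N. g \<otimes> x \<otimes> inv g = x}"
  have CN: "C \<lhd> G" unfolding C_def by (rule normal_centralizer[OF is_group N(1)])
  \<comment> \<open>A non-trivial centralizer would be normal in \<open>G\<close> and contain an
    element of order \<open>q\<close>, commuting with \<open>xp\<close>.\<close>
  have C: "C = {\<one>}"
  proof (rule ccontr)
    assume "C \<noteq> {\<one>}"
    then obtain y where y: "y \<in> C" "ord y = q"
      using cauchy_subgroup[OF fin normal_imp_subgroup[OF CN] pq(2)] dvd[OF CN] by blast
    have yc: "y \<in> carrier G" and "y \<otimes> xp \<otimes> inv y = xp" using y(1) xp(1) by (auto simp: C_def)
    then have "y \<otimes> xp = xp \<otimes> y" using conj_eq_iff[OF yc N.mem_carrier[OF xp(1)] N.mem_carrier[OF xp(1)]] by blast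
    then show False using no_comm[OF N.mem_carrier[OF xp(1)] yc xp(2) y(2)] by simp
  qed
  \<comment> \<open>Restricted to \<open>N\<close>, because the elements of \<open>AutoGroup\<close>
    and of \<open>Inn\<close> are extensional functions.\<close>
  define \<phi> where "\<phi> g = (\<lambda>x\<in>N. g \<otimes> x \<otimes> inv g)" for g
  have \<phi>auto: "\<phi> g \<in> auto ?N" if g: "g \<in> carrier G" for g
  proof -
    have iso: "(\<lambda>x. g \<otimes> x \<otimes> inv g) \<in> iso ?N ?N" by (rule conj_iso_normal[OF N(1) g])
    then have "bij_betw (\<phi> g) N N"
      unfolding \<phi>_def by (subst bij_betw_restrict_eq) (simp add: iso_def)
    moreover have "\<phi> g \<in> hom ?N ?N"
      by (rule homI) (use g normal_invE(2)[OF N(1) g] conj_mult[OF g] N.mem_carrier in \<open>auto simp: \<phi>_def\<close>)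
    ultimately show ?thesis by (simp add: auto_def Bij_def \<phi>_def)
  qed
  have bijN: "f \<in> Bij N" if "f \<in> auto ?N" for f using that by (simp add: auto_def)
  interpret A: group "AutoGroup ?N" by (rule NG.AutoGroup)
  have \<phi>hom: "\<phi> \<in> hom G (AutoGroup ?N)"
  proof (rule homI)
    fix g h assume g: "g \<in> carrier G" and h: "h \<in> carrier G"
    have "\<phi> (g \<otimes> h) = compose N (\<phi> g) (\<phi> h)"
      using conj_comp[OF g h] normal_invE(2)[OF N(1) h] N.mem_carrier
      by (auto simp: compose_def \<phi>_def fun_eq_iff)
    then show "\<phi> (g \<otimes> h) = \<phi> g \<otimes>\<^bsub>AutoGroup ?N\<^esub> \<phi> h"
      using bijN[OF \<phi>auto[OF g]] bijN[OF \<phi>auto[OF h]] by (simp add: AutoGroup_def BijGroup_def)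
  qed (use \<phi>auto in \<open>simp add: AutoGroup_def\<close>)
  interpret \<phi>: group_hom G "AutoGroup ?N" \<phi>
    using \<phi>hom by (simp add: group_hom_def group_hom_axioms_def is_group A.is_group)
  have inj: "inj_on \<phi> (carrier G)"
  proof (rule \<phi>.trivial_ker_imp_inj)
    have "g \<in> C" if g: "g \<in> carrier G" "\<phi> g = \<one>\<^bsub>AutoGroup ?N\<^esub>" for g
    proof -
      have "g \<otimes> x \<otimes> inv g = x" if "x \<in> N" for x
        using fun_cong[OF g(2), of x] that by (simp add: AutoGroup_def BijGroup_def \<phi>_def)
      then show ?thesis using g(1) by (simp add: C_def)
    qed
    then show "kernel G (AutoGroup ?N) \<phi> = {\<one>}" using C \<phi>.hom_one by (auto simp: kernel_def)
  qed
  have "Inn ?N \<subseteq> \<phi> ` carrier G"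
    unfolding Inn_def using N.mem_carrier by (auto simp: \<phi>_def m_inv_consistent[OF Nsub])
  moreover have "subgroup (\<phi> ` carrier G) (AutoGroup ?N)"
    using \<phi>.img_is_subgroup .
  moreover have "G \<cong> AutoGroup ?N\<lparr>carrier := \<phi> ` carrier G\<rparr>"
  proof (rule is_isoI[where h = \<phi>])
    have "\<phi> \<in> hom G (AutoGroup ?N\<lparr>carrier := \<phi> ` carrier G\<rparr>)"
      by (rule homI) (auto simp: \<phi>.hom_mult)
    then show "\<phi> \<in> iso G (AutoGroup ?N\<lparr>carrier := \<phi> ` carrier G\<rparr>)"
      using inj by (simp add: iso_def bij_betw_def)
  qed
  ultimately show ?thesis
    unfolding almost_simple_def using is_group simple noncomm by blast
qed

section \<open>Words and their rotations\<close>

definition word_prod :: "('a, 'b) monoid_scheme \<Rightarrow> 'a list \<Rightarrow> 'a" where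
  "word_prod G w = foldr (\<lambda>x y. x \<otimes>\<^bsub>G\<^esub> y) w \<one>\<^bsub>G\<^esub>"

text \<open>The index set for the expansion of an \<open>n\<close>-th power in the group ring into
  monomials.\<close>

definition words :: "('a, 'b) monoid_scheme \<Rightarrow> nat \<Rightarrow> 'a list set" where
  "words G n = {w. set w \<subseteq> carrier G \<and> length w = n}"

lemma word_prod_simps [simp]:
  "word_prod G [] = \<one>\<^bsub>G\<^esub>" "word_prod G (x # w) = x \<otimes>\<^bsub>G\<^esub> word_prod G w"
  by (simp_all add: word_prod_def)

lemma (in monoid) word_prod_closed [simp]: "set w \<subseteq> carrier G \<Longrightarrow> word_prod G w \<in> carrier G"
  by (induction w) auto

lemma (in monoid) word_prod_append:
  "set v \<subseteq> carrier G \<Longrightarrow> set w \<subseteq> carrier G \<Longrightarrow> word_prod G (v @ w) = word_prod G v \<otimes> word_prod G w"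
  by (induction v) (auto simp: m_assoc)

lemma (in monoid) word_prod_replicate:
  assumes "set a \<subseteq> carrier G"
  shows "word_prod G (concat (replicate m a)) = word_prod G a [^] m"
proof (induction m)
  case (Suc m)
  have "set (concat (replicate m a)) \<subseteq> carrier G" using assms by auto
  then show ?case using Suc assms nat_pow_Suc2[of "word_prod G a" m] by (simp add: word_prod_append)
qed simp

lemma finite_words: "finite (carrier G) \<Longrightarrow> finite (words G n)"
  by (simp add: words_def finite_lists_length_eq)

lemma concat_replicate_if_append_commute:
  assumes "a @ b = b @ a" "length b = m * length a"
  shows "b = concat (replicate m a)"
  using assms
proof (induction m arbitrary: b)
  case (Suc m)
  then obtain b' where b': "b = a @ b'"
    by (metis append_eq_append_conv_if le_add1 mult_Suc append_take_drop_id)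
  then have "b' = concat (replicate m a)" using Suc by auto
  then show ?case using b' by simp
qed simp

lemma rotate_fixed_word:
  assumes "rotate d w = w" "length w = m * d"
  shows "w = concat (replicate m (take d w))"
proof (cases m)
  case (Suc m')
  have "take d w @ drop d w = w" by simp
  moreover have "drop d w @ take d w = w"
  \<comment> \<open>\<open>rotate d\<close> cuts at \<open>d mod length w\<close>, which is
    \<open>d\<close> unless \<open>w\<close> has length \<open>d\<close> or is empty.\<close>
  proof (cases "m' = 0 \<or> d = 0")
    case False
    then have "d mod length w = d" using assms(2) Suc by auto
    then show ?thesis using assms(1) by (simp add: rotate_drop_take)
  next
    case True
    then show ?thesis using assms(2) Suc by auto
  qed
  ultimately have "drop d w = concat (replicate m' (take d w))"
    using assms(2) Suc by (intro concat_replicate_if_append_commute) auto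
  then have "take d w @ drop d w = concat (replicate m (take d w))" using Suc by simp
  then show ?thesis by simp
qed (use assms in auto)

lemma funpow_period:
  assumes "(f ^^ n) x = x" "n > 0"
  obtains d where "d > 0" "\<And>m. (f ^^ m) x = x \<longleftrightarrow> d dvd m"
proof -
  define d where "d = (LEAST d. 0 < d \<and> (f ^^ d) x = x)"
  have d: "0 < d" "(f ^^ d) x = x"
    using LeastI[of "\<lambda>d. 0 < d \<and> (f ^^ d) x = x" n] assms unfolding d_def by auto
  have nl: "\<not> (0 < e \<and> (f ^^ e) x = x)" if "e < d" for e
    using not_less_Least that unfolding d_def by blast
  have "(f ^^ m) x = x \<longleftrightarrow> d dvd m" for m
  proof
    assume "(f ^^ m) x = x"
    then have "(f ^^ (m mod d)) x = x" using funpow_mod_eq[OF d(2), of m] by simp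
    moreover have "m mod d < d" using d(1) by simp
    ultimately have "\<not> 0 < m mod d" using nl[of "m mod d"] by simp
    then have "m mod d = 0" by simp
    then show "d dvd m" by auto
  next
    assume "d dvd m"
    then show "(f ^^ m) x = x" using funpow_mod_eq[OF d(2), of m] by simp
  qed
  then show ?thesis using that d(1) by blast
qed

text \<open>The orbits of \<open>\<rho>\<close> on \<open>E\<close> have \<open>r\<close>-power
  length. A point not fixed by \<open>\<rho> ^^ (r ^ j)\<close> lies in an orbit of length divisible
  by \<open>r ^ Suc j\<close>, on which \<open>f\<close> is constant.\<close>

lemma sum_invariant_cong_fixed_points:
  fixes f :: "'c \<Rightarrow> int"
  assumes r: "Factorial_Ring.prime (r::nat)" and fin: "finite E"
    and \<rho>: "\<And>x. x \<in> E \<Longrightarrow> \<rho> x \<in> E" "\<And>x. x \<in> E \<Longrightarrow> (\<rho> ^^ (r ^ k)) x = x"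
    and f: "\<And>x. x \<in> E \<Longrightarrow> f (\<rho> x) = f x"
  shows "[sum f E = sum f {x \<in> E. (\<rho> ^^ (r ^ j)) x = x}] (mod int (r ^ Suc j))"
proof -
  let ?M = "int (r ^ Suc j)"
  \<comment> \<open>Stated for every invariant set of moved points, to allow induction by removing
    one orbit at a time.\<close>
  have dvd: "?M dvd sum f Y" if "Y \<subseteq> E" "\<And>y. y \<in> Y \<Longrightarrow> \<rho> y \<in> Y" "\<And>y. y \<in> Y \<Longrightarrow> (\<rho> ^^ (r ^ j)) y \<noteq> y" for Y
    using finite_subset[OF that(1) fin] that
  proof (induction Y rule: finite_psubset_induct)
    case (psubset Y)
    show ?case
    proof (cases "Y = {}")
      case False
      then obtain x where x: "x \<in> Y" by blast
      then have xX: "x \<in> E" using psubset.prems(1) by blast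
      obtain d where d: "d > 0" "\<And>m. (\<rho> ^^ m) x = x \<longleftrightarrow> d dvd m"
        using funpow_period[OF \<rho>(2)[OF xX]] r prime_gt_0_nat by (metis zero_less_power)
      have dvd_d: "r ^ Suc j dvd d"
      proof -
        have "d dvd r ^ k" using d(2) \<rho>(2)[OF xX] by blast
        then obtain i where i: "d = r ^ i" using r divides_primepow_nat by blast
        have "\<not> d dvd r ^ j" using d(2) psubset.prems(3)[OF x] by blast
        have "j < i"
        proof (rule ccontr)
          assume "\<not> j < i"
          then have "r ^ i dvd r ^ j" by (intro le_imp_power_dvd) simp
          then show False using \<open>\<not> d dvd r ^ j\<close> i by simp
        qed
        then show ?thesis unfolding i by (intro le_imp_power_dvd) simp
      qed
      define orb where "orb = (\<lambda>i. (\<rho> ^^ i) x) ` {..<d}"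
      have in_orb: "(\<rho> ^^ i) x \<in> orb" for i
      proof -
        have "(\<rho> ^^ (i mod d)) x = (\<rho> ^^ i) x" using funpow_mod_eq[of d \<rho> x i] d(2)[of d] by simp
        then show ?thesis unfolding orb_def using d(1) by (metis imageI lessThan_iff mod_less_divisor)
      qed
      have orbY: "orb \<subseteq> Y"
      proof -
        have "(\<rho> ^^ i) x \<in> Y" for i using x psubset.prems(2) by (induction i) auto
        then show ?thesis by (auto simp: orb_def)
      qed
      have forb: "f y = f x" if "y \<in> orb" for y
      proof -
        have "f ((\<rho> ^^ i) x) = f x \<and> (\<rho> ^^ i) x \<in> E" for i
          using xX \<rho>(1) f by (induction i) auto
        then show ?thesis using that by (auto simp: orb_def)
      qed
      have inj: "inj_on (\<lambda>i. (\<rho> ^^ i) x) {..<d}"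
      proof (rule linorder_inj_onI)
        fix a b assume ab: "a < b" "a \<in> {..<d}" "b \<in> {..<d}"
        show "(\<rho> ^^ a) x \<noteq> (\<rho> ^^ b) x"
        proof
          assume eq: "(\<rho> ^^ a) x = (\<rho> ^^ b) x"
          have "(\<rho> ^^ (d - b + a)) x = (\<rho> ^^ (d - b)) ((\<rho> ^^ b) x)" by (simp add: funpow_add eq)
          also have "\<dots> = (\<rho> ^^ (d - b + b)) x" by (simp add: funpow_add)
          also have "d - b + b = d" using ab by simp
          finally have "d dvd d - b + a" using d(2)[of d] d(2)[of "d - b + a"] by simp
          then show False using ab by (auto dest: dvd_imp_le)
        qed
      qed auto
      have "sum f orb = (\<Sum>y\<in>orb. f x)" by (rule sum.cong) (use forb in auto)
      also have "\<dots> = int d * f x" using card_image[OF inj] by (simp add: orb_def)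
      finally have 1: "?M dvd sum f orb" using dvd_d by (metis dvd_mult2 int_dvd_int_iff)
      have 2: "?M dvd sum f (Y - orb)"
      proof (rule psubset.IH)
        show "Y - orb \<subset> Y" using x in_orb[of 0] by auto
        show "Y - orb \<subseteq> E" using psubset.prems(1) by blast
        show "(\<rho> ^^ (r ^ j)) y \<noteq> y" if "y \<in> Y - orb" for y using that psubset.prems(3) by blast
        show "\<rho> y \<in> Y - orb" if y: "y \<in> Y - orb" for y
        proof
          show "\<rho> y \<in> Y" using y psubset.prems(2) by blast
          \<comment> \<open>Applying \<open>\<rho>\<close> another \<open>r ^ k - 1\<close> times
            recovers \<open>y\<close> from \<open>\<rho> y\<close>, so \<open>\<rho> y\<close> in
            the orbit would put \<open>y\<close> there.\<close>
          show "\<rho> y \<notin> orb"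
          proof
            assume "\<rho> y \<in> orb"
            then obtain i where i: "\<rho> y = (\<rho> ^^ i) x" by (auto simp: orb_def)
            have "r ^ k > 0" using r prime_gt_0_nat by simp
            then have "Suc (r ^ k - 1) = r ^ k" by simp
            moreover have "y \<in> E" using y psubset.prems(1) by blast
            ultimately have "y = (\<rho> ^^ (Suc (r ^ k - 1))) y" using \<rho>(2)[of y] by (simp only:)
            also have "\<dots> = (\<rho> ^^ (r ^ k - 1)) (\<rho> y)" by (simp add: funpow_swap1)
            also have "\<dots> = (\<rho> ^^ (r ^ k - 1 + i)) x" by (simp add: i funpow_add)
            finally show False using in_orb y by (metis DiffD2)
          qed
        qed
      qed
      have "sum f Y = sum f orb + sum f (Y - orb)"
        using sum.subset_diff[OF orbY psubset.hyps(1), of f] by simp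
      then show ?thesis using 1 2 by simp
    qed simp
  qed
  have inv: "\<rho> x \<in> E - {x \<in> E. (\<rho> ^^ (r ^ j)) x = x}" if x: "x \<in> E - {x \<in> E. (\<rho> ^^ (r ^ j)) x = x}" for x
  proof -
    have "(\<rho> ^^ (r ^ j)) (\<rho> x) \<noteq> \<rho> x"
    proof
      assume eq: "(\<rho> ^^ (r ^ j)) (\<rho> x) = \<rho> x"
      have "r ^ k > 0" using r prime_gt_0_nat by simp
      then have "Suc (r ^ k - 1) = r ^ k" by simp
      moreover have "x \<in> E" using x by blast
      ultimately have "(\<rho> ^^ (Suc (r ^ k - 1))) x = x" using \<rho>(2)[of x] by (simp only:)
      then have per: "x = (\<rho> ^^ (r ^ k - 1)) (\<rho> x)" by (simp add: funpow_swap1)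
      have comm: "(\<rho> ^^ a) ((\<rho> ^^ b) z) = (\<rho> ^^ b) ((\<rho> ^^ a) z)" for a b z
        using fun_cong[OF funpow_add[of a b \<rho>], of z] fun_cong[OF funpow_add[of b a \<rho>], of z]
        by (simp add: add.commute)
      have "(\<rho> ^^ (r ^ j)) x = (\<rho> ^^ (r ^ j)) ((\<rho> ^^ (r ^ k - 1)) (\<rho> x))"
        by (rule arg_cong[OF per])
      also have "\<dots> = (\<rho> ^^ (r ^ k - 1)) ((\<rho> ^^ (r ^ j)) (\<rho> x))" by (rule comm)
      also have "\<dots> = x" using eq per by simp
      finally show False using x by blast
    qed
    then show ?thesis using \<rho>(1) x by blast
  qed
  have "?M dvd sum f (E - {x \<in> E. (\<rho> ^^ (r ^ j)) x = x})"
    by (rule dvd[OF Diff_subset inv]) auto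
  moreover have "sum f E = sum f (E - {x \<in> E. (\<rho> ^^ (r ^ j)) x = x}) + sum f {x \<in> E. (\<rho> ^^ (r ^ j)) x = x}"
    by (rule sum.subset_diff) (use fin in auto)
  ultimately show ?thesis by (simp add: cong_iff_dvd_diff)
qed

section \<open>Partial augmentations of torsion units\<close>

context group
begin

lemma int_group_ring_simps:
  "carrier (int_group_ring G) = {f. \<forall>x. x \<notin> carrier G \<longrightarrow> f x = 0}"
  "(f \<otimes>\<^bsub>int_group_ring G\<^esub> g) x = (if x \<in> carrier G then \<Sum>y\<in>carrier G. f y * g (inv y \<otimes> x) else 0)"
  "\<one>\<^bsub>int_group_ring G\<^esub> x = (if x = \<one> then 1 else 0)"
  by (simp_all add: int_group_ring_def)

lemma sum_left_translate:
  assumes "y \<in> carrier G"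
  shows "(\<Sum>x\<in>carrier G. h (y \<otimes> x)) = (\<Sum>x\<in>carrier G. h x)"
  by (rule sum.reindex_bij_witness[of _ "\<lambda>x. inv y \<otimes> x" "\<lambda>x. y \<otimes> x"])
     (use assms in \<open>auto simp: m_assoc[symmetric]\<close>)

text \<open>Summation of a test function \<open>F\<close> against a convolution. With
  \<open>F\<close> an indicator function it yields coefficients and coefficient sums.\<close>

lemma sum_int_group_ring_mult:
  assumes "finite (carrier G)"
  shows "(\<Sum>x\<in>carrier G. F x * (f \<otimes>\<^bsub>int_group_ring G\<^esub> g) x) =
    (\<Sum>y\<in>carrier G. \<Sum>z\<in>carrier G. F (y \<otimes> z) * (f y * g z))"
proof -
  have "(\<Sum>x\<in>carrier G. F x * (f \<otimes>\<^bsub>int_group_ring G\<^esub> g) x) =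
    (\<Sum>x\<in>carrier G. \<Sum>y\<in>carrier G. F x * (f y * g (inv y \<otimes> x)))"
    by (simp add: int_group_ring_simps sum_distrib_left)
  also have "\<dots> = (\<Sum>y\<in>carrier G. \<Sum>x\<in>carrier G. F x * (f y * g (inv y \<otimes> x)))"
    by (rule sum.swap)
  also have "\<dots> = (\<Sum>y\<in>carrier G. \<Sum>z\<in>carrier G. F (y \<otimes> z) * (f y * g z))"
  proof (rule sum.cong[OF refl])
    fix y assume y: "y \<in> carrier G"
    have "(\<Sum>x\<in>carrier G. F x * (f y * g (inv y \<otimes> x))) =
      (\<Sum>z\<in>carrier G. F (y \<otimes> z) * (f y * g (inv y \<otimes> (y \<otimes> z))))"
      by (rule sum_left_translate[OF y, symmetric])
    then show "(\<Sum>x\<in>carrier G. F x * (f y * g (inv y \<otimes> x))) =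
      (\<Sum>z\<in>carrier G. F (y \<otimes> z) * (f y * g z))"
      using y by (simp add: m_assoc[symmetric])
  qed
  finally show ?thesis .
qed

lemma words_Suc: "words G (Suc n) = (\<lambda>(w, x). x # w) ` (words G n \<times> carrier G)"
  unfolding words_def by (rule lists_length_Suc_eq)

text \<open>The induction depends on \<open>F\<close> being arbitrary: splitting off the first
  letter \<open>y\<close> replaces \<open>F\<close> by its translate
  \<open>F (y \<otimes> _)\<close>.\<close>

lemma sum_int_group_ring_pow:
  assumes fin: "finite (carrier G)" and u: "u \<in> carrier (int_group_ring G)"
  shows "(\<Sum>x\<in>carrier G. F x * (u [^]\<^bsub>int_group_ring G\<^esub> n) x) =
    (\<Sum>w\<in>words G n. F (word_prod G w) * prod_list (map u w))"
proof (induction n arbitrary: F)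
  case 0
  have "words G 0 = {[]}" by (auto simp: words_def)
  moreover have "(\<Sum>x\<in>carrier G. F x * (if x = \<one> then 1 else 0)) = (\<Sum>x\<in>carrier G. if x = \<one> then F \<one> else 0)"
    by (rule sum.cong) auto
  ultimately show ?case using fin by (simp add: int_group_ring_simps)
next
  case (Suc n)
  interpret R: ring "int_group_ring G" by (rule ring_int_group_ring[OF is_group fin])
  have "(\<Sum>x\<in>carrier G. F x * (u [^]\<^bsub>int_group_ring G\<^esub> Suc n) x) =
    (\<Sum>y\<in>carrier G. \<Sum>z\<in>carrier G. F (y \<otimes> z) * (u y * (u [^]\<^bsub>int_group_ring G\<^esub> n) z))"
    unfolding R.nat_pow_Suc2[OF u] by (rule sum_int_group_ring_mult[OF fin])
  also have "\<dots> = (\<Sum>y\<in>carrier G. u y * (\<Sum>z\<in>carrier G. F (y \<otimes> z) * (u [^]\<^bsub>int_group_ring G\<^esub> n) z))"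
    by (simp add: sum_distrib_left mult.left_commute)
  also have "\<dots> = (\<Sum>y\<in>carrier G. u y * (\<Sum>w\<in>words G n. F (y \<otimes> word_prod G w) * prod_list (map u w)))"
    by (simp add: Suc.IH[of "\<lambda>z. F (_ \<otimes> z)"])
  also have "\<dots> = (\<Sum>y\<in>carrier G. \<Sum>w\<in>words G n. F (word_prod G (y # w)) * prod_list (map u (y # w)))"
    by (simp add: sum_distrib_left mult.left_commute)
  also have "\<dots> = (\<Sum>w\<in>words G n. \<Sum>y\<in>carrier G. F (word_prod G (y # w)) * prod_list (map u (y # w)))"
    by (rule sum.swap)
  also have "\<dots> = (\<Sum>(w, y)\<in>words G n \<times> carrier G. F (word_prod G (y # w)) * prod_list (map u (y # w)))"
    by (rule sum.cartesian_product)
  also have "\<dots> = (\<Sum>w\<in>words G (Suc n). F (word_prod G w) * prod_list (map u w))"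
    unfolding words_Suc by (subst sum.reindex) (auto simp: inj_on_def case_prod_unfold)
  finally show ?case .
qed

text \<open>Unions of conjugacy classes; the coefficient sum of \<open>u\<close> over a single class
  is a partial augmentation of \<open>u\<close>.\<close>

definition conj_closed :: "'a set \<Rightarrow> bool" where
  "conj_closed D \<longleftrightarrow> D \<subseteq> carrier G \<and> (\<forall>x\<in>D. \<forall>g\<in>carrier G. g \<otimes> x \<otimes> inv g \<in> D)"

lemma conj_closedD:
  "conj_closed D \<Longrightarrow> x \<in> D \<Longrightarrow> x \<in> carrier G"
  "conj_closed D \<Longrightarrow> x \<in> D \<Longrightarrow> g \<in> carrier G \<Longrightarrow> g \<otimes> x \<otimes> inv g \<in> D"
  by (auto simp: conj_closed_def)

lemma conj_closed_commute:
  assumes "conj_closed D" "a \<in> carrier G" "b \<in> carrier G"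
  shows "a \<otimes> b \<in> D \<longleftrightarrow> b \<otimes> a \<in> D"
proof -
  have *: "b \<otimes> a \<in> D" if "a \<in> carrier G" "b \<in> carrier G" "a \<otimes> b \<in> D" for a b
  proof -
    have "b \<otimes> (a \<otimes> b) \<otimes> inv b \<in> D" using conj_closedD(2)[OF assms(1) that(3,2)] .
    moreover have "b \<otimes> (a \<otimes> b) \<otimes> inv b = b \<otimes> a" using that by (simp add: m_assoc)
    ultimately show ?thesis by simp
  qed
  show ?thesis using *[OF assms(2,3)] *[OF assms(3,2)] by blast
qed

text \<open>The sum over words that gives a partial augmentation of a power is invariant under cyclic
  rotation, because the product of a rotated word is conjugate to that of the word.\<close>

lemma sum_conj_closed_pow_cong:
  assumes fin: "finite (carrier G)" and u: "u \<in> carrier (int_group_ring G)" and D: "conj_closed D"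
    and r: "Factorial_Ring.prime (r::nat)"
  shows "[(\<Sum>x\<in>D. (u [^]\<^bsub>int_group_ring G\<^esub> (r ^ k)) x) =
    (\<Sum>w | w \<in> words G (r ^ k) \<and> rotate (r ^ j) w = w.
      if word_prod G w \<in> D then prod_list (map u w) else 0)] (mod int (r ^ Suc j))"
proof -
  let ?f = "\<lambda>w. if word_prod G w \<in> D then prod_list (map u w) else 0"
  have "(\<Sum>x\<in>D. (u [^]\<^bsub>int_group_ring G\<^esub> (r ^ k)) x) =
    (\<Sum>x\<in>carrier G. (if x \<in> D then 1 else 0) * (u [^]\<^bsub>int_group_ring G\<^esub> (r ^ k)) x)"
    using D fin by (intro sum.mono_neutral_cong_left) (auto simp: conj_closed_def)
  also have "\<dots> = (\<Sum>w\<in>words G (r ^ k). ?f w)"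
    unfolding sum_int_group_ring_pow[OF fin u] by (rule sum.cong) auto
  also have "[(\<Sum>w\<in>words G (r ^ k). ?f w) = (\<Sum>w | w \<in> words G (r ^ k) \<and> (rotate1 ^^ (r ^ j)) w = w. ?f w)]
    (mod int (r ^ Suc j))"
  proof (rule sum_invariant_cong_fixed_points[OF r finite_words[OF fin]])
    fix w assume w: "w \<in> words G (r ^ k)"
    show "rotate1 w \<in> words G (r ^ k)" using w by (auto simp: words_def)
    have "r ^ k = length w" using w by (simp add: words_def)
    then have "rotate (r ^ k) w = w" by simp
    then show "(rotate1 ^^ (r ^ k)) w = w" unfolding rotate_def .
    show "?f (rotate1 w) = ?f w"
    proof (cases w)
      case (Cons a v)
      then have "a \<in> carrier G" "set v \<subseteq> carrier G" using w by (auto simp: words_def)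
      then show ?thesis
        using Cons conj_closed_commute[OF D, of a "word_prod G v"] by (simp add: word_prod_append mult.commute)
    qed simp
  qed
  finally show ?thesis by (simp add: rotate_def)
qed

lemma word_prod_rotate_fixed:
  assumes "w \<in> words G (m * d)" "rotate d w = w"
  shows "word_prod G w = word_prod G (take d w) [^] m" "word_prod G (take d w) \<in> carrier G"
proof -
  have sub: "set (take d w) \<subseteq> carrier G" using assms(1) set_take_subset[of d w] by (auto simp: words_def)
  then show "word_prod G (take d w) \<in> carrier G" by simp
  have "w = concat (replicate m (take d w))"
    using rotate_fixed_word[OF assms(2)] assms(1) by (simp add: words_def)
  then show "word_prod G w = word_prod G (take d w) [^] m" using word_prod_replicate[OF sub] by metis
qed

lemma ord_conj:
  assumes "g \<in> carrier G" "x \<in> carrier G"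
  shows "ord (g \<otimes> x \<otimes> inv g) = ord x"
proof -
  have "(g \<otimes> x \<otimes> inv g) [^] (n::nat) = \<one> \<longleftrightarrow> x [^] n = \<one>" for n
    using conj_pow[OF assms, of n] conj_eq_iff[OF assms(1) nat_pow_closed[OF assms(2)] one_closed, of n] assms
    by simp
  then show ?thesis using assms by (simp add: ord_unique pow_eq_id)
qed

text \<open>\<open>r ^ a\<close> is the full power of \<open>r\<close> in the order of
  \<open>G\<close>, so raising to it removes the \<open>r\<close>-part of every element.\<close>

lemma pow_prime_power_ord:
  assumes fin: "finite (carrier G)" and r: "Factorial_Ring.prime (r::nat)"
  obtains a c where "order G = r ^ a * c" "\<not> r dvd c" "\<And>g. g \<in> carrier G \<Longrightarrow> \<not> r dvd ord (g [^] (r ^ a))"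
proof -
  have "order G \<noteq> 0" using fin order_gt_0_iff_finite by simp
  then obtain a c where ac: "order G = r ^ a * c" "\<not> r dvd c"
    using multiplicity_decompose'[of "order G" r] r not_prime_unit by metis
  have "\<not> r dvd ord (g [^] (r ^ a))" if g: "g \<in> carrier G" for g
  proof
    assume "r dvd ord (g [^] (r ^ a))"
    moreover have "(g [^] (r ^ a)) [^] c = \<one>" using pow_order_eq_1[OF g] ac(1) g by (simp add: nat_pow_pow)
    then have "ord (g [^] (r ^ a)) dvd c" using pow_eq_id[OF nat_pow_closed[OF g]] by blast
    ultimately show False using ac(2) dvd_trans by blast
  qed
  then show ?thesis using that ac by blast
qed

lemma monoid_pow_mod:
  assumes "monoid M" "u \<in> carrier M" "u [^]\<^bsub>M\<^esub> (m::nat) = \<one>\<^bsub>M\<^esub>" "[n = 1] (mod m)" "n > 0"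
  shows "u [^]\<^bsub>M\<^esub> (n::nat) = u"
proof -
  interpret M: monoid M by fact
  have "m dvd n - 1" using assms(4,5) cong_altdef_nat[of 1 n m] by (simp add: cong_sym_eq)
  then obtain s where "n - 1 = m * s" by (rule dvdE)
  then have s: "n = m * s + 1" using assms(5) by simp
  have "u [^]\<^bsub>M\<^esub> n = (u [^]\<^bsub>M\<^esub> m) [^]\<^bsub>M\<^esub> s \<otimes>\<^bsub>M\<^esub> u"
    unfolding s using assms(2) by (simp add: M.nat_pow_mult[symmetric] M.nat_pow_pow)
  then show ?thesis using assms(2,3) by simp
qed

text \<open>Take \<open>k\<close> with \<open>u ^ (r ^ k) = u\<close>. Words fixed by rotation through \<open>r ^ (k - a)\<close> are \<open>r ^ a\<close>-th
  powers, whose product has order prime to \<open>r\<close>; so the partial augmentation is divisible by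
  \<open>r ^ (k - a + 1)\<close> for arbitrarily large \<open>k\<close>.\<close>

lemma sum_ord_dvd_eq_0:
  assumes fin: "finite (carrier G)" and u: "u \<in> carrier (int_group_ring G)"
    and um: "u [^]\<^bsub>int_group_ring G\<^esub> (m::nat) = \<one>\<^bsub>int_group_ring G\<^esub>" and m: "m > 0"
    and r: "Factorial_Ring.prime (r::nat)" "\<not> r dvd m"
    and D: "conj_closed D" "\<And>x. x \<in> D \<Longrightarrow> r dvd ord x"
  shows "sum u D = 0"
proof (rule ccontr)
  assume nz: "sum u D \<noteq> 0"
  interpret R: ring "int_group_ring G" by (rule ring_int_group_ring[OF is_group fin])
  obtain a where a: "\<And>g. g \<in> carrier G \<Longrightarrow> \<not> r dvd ord (g [^] (r ^ a))"
    using pow_prime_power_ord[OF fin r(1)] by blast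
  \<comment> \<open>Large enough for \<open>r ^ Suc j\<close>, with \<open>j = k - a\<close>, to
    exceed the absolute value of \<open>sum u D\<close>. The factor \<open>totient m\<close> in
    \<open>k\<close> makes \<open>r ^ k\<close> congruent to 1 modulo \<open>m\<close>, so that
    \<open>u\<close> equals its power with exponent \<open>r ^ k\<close>.\<close>
  define t where "t = a + nat \<bar>sum u D\<bar>"
  define k where "k = totient m * t"
  have "totient m > 0" using m by simp
  then have "k \<ge> t" by (simp add: k_def Suc_le_eq)
  have "coprime r m" using r by (simp add: prime_imp_coprime)
  then have "[(r ^ totient m) ^ t = 1 ^ t] (mod m)" by (intro cong_pow euler_theorem)
  then have "[r ^ k = 1] (mod m)" by (simp add: k_def power_mult)
  then have uk: "u [^]\<^bsub>int_group_ring G\<^esub> (r ^ k) = u"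
    using monoid_pow_mod[OF R.monoid_axioms u um] r(1) prime_gt_0_nat by simp
  define j where "j = k - a"
  have "a \<le> k" using \<open>k \<ge> t\<close> by (simp add: t_def)
  then have kj: "r ^ k = r ^ a * r ^ j" by (simp add: j_def flip: power_add)
  have "[sum u D = (\<Sum>w | w \<in> words G (r ^ k) \<and> rotate (r ^ j) w = w.
      if word_prod G w \<in> D then prod_list (map u w) else 0)] (mod int (r ^ Suc j))"
    using sum_conj_closed_pow_cong[OF fin u D(1) r(1), of k j] by (simp add: uk)
  also have "(\<Sum>w | w \<in> words G (r ^ k) \<and> rotate (r ^ j) w = w.
      if word_prod G w \<in> D then prod_list (map u w) else 0) = 0"
  proof (rule sum.neutral, clarify)
    fix w assume w: "w \<in> words G (r ^ k)" "rotate (r ^ j) w = w"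
    have "\<not> r dvd ord (word_prod G w)"
      using word_prod_rotate_fixed[of w "r ^ a" "r ^ j"] w a unfolding kj by metis
    then show "(if word_prod G w \<in> D then prod_list (map u w) else 0) = 0" using D(2) by auto
  qed
  finally have "int (r ^ Suc j) dvd sum u D" by (simp add: cong_iff_dvd_diff)
  then have "\<bar>int (r ^ Suc j)\<bar> \<le> \<bar>sum u D\<bar>" using nz by (intro dvd_imp_le_int)
  moreover have "Suc j < r ^ Suc j" using r(1) prime_gt_1_nat by (intro power_gt_expt) auto
  moreover have "nat \<bar>sum u D\<bar> \<le> j" using \<open>k \<ge> t\<close> by (simp add: j_def t_def)
  ultimately show False by linarith
qed

text \<open>The prime may vary with the element, whereas \<open>sum_ord_dvd_eq_0\<close> handles one
  prime at a time. So the part of \<open>D\<close> with order divisible by \<open>r\<close> is split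
  off for one \<open>r\<close> after another; only the finitely many prime divisors of the order of
  \<open>G\<close> occur.\<close>

lemma sum_ord_not_dvd_eq_0:
  assumes fin: "finite (carrier G)" and u: "u \<in> carrier (int_group_ring G)"
    and um: "u [^]\<^bsub>int_group_ring G\<^esub> (m::nat) = \<one>\<^bsub>int_group_ring G\<^esub>" and m: "m > 0"
    and D: "conj_closed D"
      "\<And>x. x \<in> D \<Longrightarrow> \<exists>r. Factorial_Ring.prime r \<and> r dvd ord x \<and> \<not> r dvd m"
  shows "sum u D = 0"
proof -
  have *: "sum u D = 0" if "finite R" "\<And>r. r \<in> R \<Longrightarrow> Factorial_Ring.prime r \<and> \<not> r dvd m"
    "conj_closed D" "\<And>x. x \<in> D \<Longrightarrow> \<exists>r\<in>R. r dvd ord x" for R :: "nat set" and D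
    using that
  proof (induction R arbitrary: D rule: finite_induct)
    case empty
    then have "D = {}" by blast
    then show ?case by simp
  next
    case (insert r R)
    let ?A = "{x \<in> D. r dvd ord x}" and ?B = "{x \<in> D. \<not> r dvd ord x}"
    have cc: "conj_closed ?A" "conj_closed ?B"
      using insert.prems(2) ord_conj by (auto simp: conj_closed_def subset_eq)
    have "finite D" using insert.prems(2) fin finite_subset by (auto simp: conj_closed_def)
    then have "sum u D = sum u ?A + sum u ?B"
      by (subst sum.union_disjoint[symmetric]) (auto intro: arg_cong[where f = "sum u"])
    moreover have "sum u ?A = 0"
      using sum_ord_dvd_eq_0[OF fin u um m _ _ cc(1), of r] insert.prems(1) by blast
    moreover have "sum u ?B = 0"
      by (rule insert.IH[OF _ cc(2)]) (use insert.prems in auto)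
    ultimately show ?case by simp
  qed
  have "D \<subseteq> carrier G" using D(1) by (simp add: conj_closed_def)
  show ?thesis
  proof (rule *[where R = "{r. Factorial_Ring.prime r \<and> r dvd order G \<and> \<not> r dvd m}"])
    have "order G > 0" using fin order_gt_0_iff_finite by simp
    then have "{r. Factorial_Ring.prime r \<and> r dvd order G \<and> \<not> r dvd m} \<subseteq> {..order G}"
      by (auto dest: dvd_imp_le)
    then show "finite {r. Factorial_Ring.prime r \<and> r dvd order G \<and> \<not> r dvd m}"
      using finite_subset by blast
    fix x assume x: "x \<in> D"
    then obtain r where "Factorial_Ring.prime r" "r dvd ord x" "\<not> r dvd m" using D(2) by blast
    moreover have "ord x dvd order G" using ord_dvd_group_order x \<open>D \<subseteq> carrier G\<close> by blast
    ultimately show "\<exists>r\<in>{r. Factorial_Ring.prime r \<and> r dvd order G \<and> \<not> r dvd m}. r dvd ord x"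
      using dvd_trans by blast
  qed (use D(1) in auto)
qed

end

lemma int_power_prime_cong:
  assumes r: "Factorial_Ring.prime (r::nat)"
  shows "[(a::int) ^ (r ^ k) = a] (mod int r)"
proof -
  have 1: "[(b::int) ^ r = b] (mod int r)" for b
  proof -
    define n where "n = nat (b mod int r)"
    have "int r > 0" using r prime_gt_0_nat by simp
    then have b: "[b = int n] (mod int r)" by (simp add: n_def cong_def)
    have "[n ^ r = n] (mod r)"
    proof (cases "r dvd n")
      case True
      then show ?thesis using r prime_gt_0_nat by (metis cong_0_iff cong_sym cong_trans dvd_power_same dvd_power dvd_trans)
    next
      case False
      then have "[n ^ (r - 1) * n = 1 * n] (mod r)" using fermat_theorem[OF r] by (intro cong_mult) auto
      then show ?thesis using prime_gt_0_nat[OF r] by (simp flip: power_Suc2)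
    qed
    then have "[int n ^ r = int n] (mod int r)" by (simp flip: of_nat_power add: cong_int_iff)
    then show ?thesis using b cong_pow[OF b, of r] by (meson cong_sym cong_trans)
  qed
  show ?thesis
  proof (induction k)
    case (Suc k)
    have "[(a ^ (r ^ k)) ^ r = a ^ (r ^ k)] (mod int r)" by (rule 1)
    then show ?case using Suc by (simp add: power_mult[symmetric] mult.commute cong_trans)
  qed simp
qed

text \<open>The words fixed by a single rotation are constant. The word repeating \<open>x\<close>
  counts exactly if \<open>x [^] (r ^ k) = \<one>\<close>, and it contributes
  \<open>u x ^ (r ^ k)\<close>, congruent to \<open>u x\<close> by Fermat.\<close>

lemma (in group) sum_pow_one_cong:
  assumes fin: "finite (carrier G)" and u: "u \<in> carrier (int_group_ring G)"
    and r: "Factorial_Ring.prime (r::nat)"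
  shows "[(u [^]\<^bsub>int_group_ring G\<^esub> (r ^ k)) \<one> = (\<Sum>x | x \<in> carrier G \<and> x [^] (r ^ k) = \<one>. u x)] (mod int r)"
proof -
  have D: "conj_closed {\<one>}" by (auto simp: conj_closed_def)
  let ?f = "\<lambda>w. if word_prod G w \<in> {\<one>} then prod_list (map u w) else 0"
  let ?W = "{w \<in> words G (r ^ k). rotate (r ^ 0) w = w}"
  have "[(u [^]\<^bsub>int_group_ring G\<^esub> (r ^ k)) \<one> = (\<Sum>w\<in>?W. ?f w)] (mod int r)"
    using sum_conj_closed_pow_cong[OF fin u D r, of k 0] by simp
  also have "?W = replicate (r ^ k) ` carrier G"
  proof (intro equalityI subsetI)
    fix w assume w: "w \<in> ?W"
    have pos: "r ^ k > 0" using r prime_gt_0_nat by simp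
    then obtain x where x: "take 1 w = [x]" "x \<in> carrier G"
      using w by (cases w) (auto simp: words_def)
    have "concat (replicate n [x]) = replicate n x" for n by (induction n) auto
    then have "w = replicate (r ^ k) x"
      using rotate_fixed_word[of 1 w "r ^ k"] w x by (simp add: words_def)
    then show "w \<in> replicate (r ^ k) ` carrier G" using x(2) by blast
  next
    fix w assume "w \<in> replicate (r ^ k) ` carrier G"
    then show "w \<in> ?W" by (auto simp: words_def)
  qed
  also have "(\<Sum>w\<in>replicate (r ^ k) ` carrier G. ?f w) =
      (\<Sum>x\<in>carrier G. ?f (replicate (r ^ k) x))"
    using r prime_gt_0_nat by (subst sum.reindex) (auto simp: inj_on_def)
  also have "\<dots> = (\<Sum>x\<in>carrier G. if x [^] (r ^ k) = \<one> then u x ^ (r ^ k) else 0)"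
  proof (rule sum.cong[OF refl])
    fix x assume x: "x \<in> carrier G"
    have "word_prod G (replicate n x) = x [^] n" for n
    proof (induction n)
      case (Suc n)
      then show ?case using nat_pow_Suc2[OF x, of n] by simp
    qed simp
    then show "?f (replicate (r ^ k) x) = (if x [^] (r ^ k) = \<one> then u x ^ (r ^ k) else 0)"
      by (simp add: map_replicate prod_list_replicate)
  qed
  also have "[\<dots> = (\<Sum>x\<in>carrier G. if x [^] (r ^ k) = \<one> then u x else 0)] (mod int r)"
    by (rule cong_sum) (use int_power_prime_cong[OF r] in auto)
  also have "(\<Sum>x\<in>carrier G. if x [^] (r ^ k) = \<one> then u x else 0) =
      (\<Sum>x | x \<in> carrier G \<and> x [^] (r ^ k) = \<one>. u x)"
    using fin by (simp add: sum.inter_filter)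
  finally show ?thesis .
qed

section \<open>The Berman-Higman theorem\<close>

lemma index_mult_mat_sum:
  assumes "A \<in> carrier_mat n n" "B \<in> carrier_mat n n" "i < n" "j < n"
  shows "(A * B) $$ (i, j) = (\<Sum>l<n. A $$ (i, l) * B $$ (l, j))"
proof -
  have "(A * B) $$ (i, j) = (\<Sum>l\<in>{0..<n}. A $$ (i, l) * B $$ (l, j))"
    using assms by (auto simp: scalar_prod_def intro!: sum.cong)
  then show ?thesis by (simp add: atLeast0LessThan)
qed

lemma sum_diag_mult_commute:
  fixes A B :: "'a :: comm_semiring_0 mat"
  assumes "A \<in> carrier_mat n n" "B \<in> carrier_mat n n"
  shows "(\<Sum>i<n. (A * B) $$ (i, i)) = (\<Sum>i<n. (B * A) $$ (i, i))"
proof -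
  have "(\<Sum>i<n. (A * B) $$ (i, i)) = (\<Sum>i<n. \<Sum>l<n. A $$ (i, l) * B $$ (l, i))"
    using assms by (intro sum.cong) (auto simp: index_mult_mat_sum[OF assms] index_mult_mat_sum[OF assms(2,1)] simp del: index_mult_mat(1))
  also have "\<dots> = (\<Sum>l<n. \<Sum>i<n. A $$ (i, l) * B $$ (l, i))" by (rule sum.swap)
  also have "\<dots> = (\<Sum>l<n. \<Sum>i<n. B $$ (l, i) * A $$ (i, l))" by (simp add: mult.commute)
  also have "\<dots> = (\<Sum>i<n. (B * A) $$ (i, i))"
    using assms by (intro sum.cong) (auto simp: index_mult_mat_sum[OF assms] index_mult_mat_sum[OF assms(2,1)] simp del: index_mult_mat(1))
  finally show ?thesis .
qed

lemma pow_mat_similar: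
  fixes B :: "'a :: semiring_1 mat"
  assumes "B \<in> carrier_mat n n" "P \<in> carrier_mat n n" "Q \<in> carrier_mat n n"
    "P * Q = 1\<^sub>m n" "Q * P = 1\<^sub>m n"
  shows "(P * B * Q) ^\<^sub>m k = P * (B ^\<^sub>m k) * Q"
proof (induction k)
  case 0
  then show ?case using assms by simp
next
  case (Suc k)
  have C: "B ^\<^sub>m k \<in> carrier_mat n n" using assms by simp
  have mc: "M * N \<in> carrier_mat n n" if "M \<in> carrier_mat n n" "N \<in> carrier_mat n n" for M N :: "'a mat"
    using that by simp
  have "(P * B * Q) ^\<^sub>m Suc k = P * (B ^\<^sub>m k) * Q * (P * B * Q)" by (simp add: Suc)
  also have "\<dots> = P * (B ^\<^sub>m k) * (Q * (P * (B * Q)))"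
    using assms C by (simp add: assoc_mult_mat[of _ n n _ n _ n] mc)
  also have "Q * (P * (B * Q)) = (Q * P) * (B * Q)"
    by (rule assoc_mult_mat[symmetric, of _ n n _ n _ n]) (use assms in auto)
  also have "\<dots> = B * Q" unfolding assms(5) using assms(1,3) by simp
  also have "P * (B ^\<^sub>m k) * (B * Q) = P * (B ^\<^sub>m k * B) * Q"
    using assms(1-3) C by (simp add: assoc_mult_mat[of _ n n _ n _ n] mc)
  finally show ?case by simp
qed

lemma upper_triangular_pow_mat:
  fixes B :: "'a :: comm_semiring_1 mat"
  assumes B: "B \<in> carrier_mat n n" and ut: "\<And>i j. j < i \<Longrightarrow> i < n \<Longrightarrow> B $$ (i, j) = 0"
  shows "\<And>i j. j < i \<Longrightarrow> i < n \<Longrightarrow> (B ^\<^sub>m k) $$ (i, j) = 0"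
    and "\<And>i. i < n \<Longrightarrow> (B ^\<^sub>m k) $$ (i, i) = (B $$ (i, i)) ^ k"
proof (induction k)
  case (Suc k)
  have C: "B ^\<^sub>m k \<in> carrier_mat n n" using B by simp
  {
    case 1
    have "(B ^\<^sub>m k * B) $$ (i, j) = (\<Sum>l<n. (B ^\<^sub>m k) $$ (i, l) * B $$ (l, j))"
      using index_mult_mat_sum[OF C B] 1 by simp
    also have "\<dots> = 0"
    proof (rule sum.neutral, clarify)
      fix l assume "l < n"
      then show "(B ^\<^sub>m k) $$ (i, l) * B $$ (l, j) = 0"
        using Suc(1)[of l i] ut[of j l] 1 by (cases "l < i") auto
    qed
    finally show ?case by simp
  next
    case 2
    have "(B ^\<^sub>m k * B) $$ (i, i) = (\<Sum>l<n. (B ^\<^sub>m k) $$ (i, l) * B $$ (l, i))"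
      using index_mult_mat_sum[OF C B] 2 by simp
    also have "\<dots> = (\<Sum>l<n. if l = i then B $$ (i, i) ^ k * B $$ (i, i) else 0)"
    proof (rule sum.cong[OF refl])
      fix l assume "l \<in> {..<n}"
      then show "(B ^\<^sub>m k) $$ (i, l) * B $$ (l, i) = (if l = i then B $$ (i, i) ^ k * B $$ (i, i) else 0)"
        using Suc(1)[of l i] Suc(2)[of i] ut[of i l] 2 by (cases "l < i") auto
    qed
    finally show ?case using 2 by (simp add: mult.commute)
  }
qed (use B in auto)

text \<open>By induction on the distance from the diagonal. When the entries above the diagonal and
  closer to it vanish, the \<open>(i, j)\<close> entry of the \<open>k\<close>-th power is
  \<open>k * s ^ (k - 1)\<close> times that of \<open>B\<close>; at \<open>k = m\<close> it is 0,
  which in characteristic 0 forces the entry of \<open>B\<close> to be 0. The proof multiplies by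
  \<open>s\<close> to avoid the exponent \<open>k - 1\<close>.\<close>

lemma upper_triangular_finite_order_scalar:
  fixes B :: "'a :: field_char_0 mat"
  assumes B: "B \<in> carrier_mat n n" and ut: "\<And>i j. j < i \<Longrightarrow> i < n \<Longrightarrow> B $$ (i, j) = 0"
    and diag: "\<And>i. i < n \<Longrightarrow> B $$ (i, i) = s" and s: "s \<noteq> 0"
    and m: "B ^\<^sub>m m = 1\<^sub>m n" "m > 0"
  shows "B = s \<cdot>\<^sub>m 1\<^sub>m n"
proof -
  have off: "B $$ (i, j) = 0" if "i < j" "j < n" for i j
    using that
  proof (induction "j - i" arbitrary: i j rule: less_induct)
    case less
    have pow: "(B ^\<^sub>m k) $$ (i, j) * s = of_nat k * s ^ k * B $$ (i, j)" for k
    proof (induction k)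
      case 0
      then show ?case using less B by simp
    next
      case (Suc k)
      have C: "B ^\<^sub>m k \<in> carrier_mat n n" using B by simp
      have "(B ^\<^sub>m k * B) $$ (i, j) = (\<Sum>l<n. (B ^\<^sub>m k) $$ (i, l) * B $$ (l, j))"
        using index_mult_mat_sum[OF C B] less by simp
      also have "\<dots> = (\<Sum>l\<in>{i, j}. (B ^\<^sub>m k) $$ (i, l) * B $$ (l, j))"
      proof (rule sum.mono_neutral_right)
        show "\<forall>l\<in>{..<n} - {i, j}. (B ^\<^sub>m k) $$ (i, l) * B $$ (l, j) = 0"
        proof
          fix l assume l: "l \<in> {..<n} - {i, j}"
          consider "l < i" | "i < l" "l < j" | "j < l" using l by fastforce
          then show "(B ^\<^sub>m k) $$ (i, l) * B $$ (l, j) = 0"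
          proof cases
            case 1
            then show ?thesis using upper_triangular_pow_mat(1)[OF B ut, of l i k] less.prems by simp
          next
            case 2
            then show ?thesis using less.hyps[of j l] less.prems by simp
          next
            case 3
            then show ?thesis using ut[of j l] l by simp
          qed
        qed
      qed (use less.prems in auto)
      also have "\<dots> = s ^ k * B $$ (i, j) + (B ^\<^sub>m k) $$ (i, j) * s"
        using upper_triangular_pow_mat(2)[OF B ut, of i k] diag less.prems by simp
      finally have "(B ^\<^sub>m Suc k) $$ (i, j) * s = s ^ k * B $$ (i, j) * s + (B ^\<^sub>m k) $$ (i, j) * s * s"
        by (simp add: distrib_right)
      then show ?case unfolding Suc by (simp add: algebra_simps)
    qed
    have "of_nat m * s ^ m * B $$ (i, j) = 0"
      using pow[of m] m(1) less.prems by simp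
    then show ?case using s m(2) by simp
  qed
  show ?thesis
  proof (rule eq_matI)
    fix i j assume "i < dim_row (s \<cdot>\<^sub>m 1\<^sub>m n)" "j < dim_col (s \<cdot>\<^sub>m 1\<^sub>m n)"
    then show "B $$ (i, j) = (s \<cdot>\<^sub>m 1\<^sub>m n) $$ (i, j)"
      using off[of i j] ut[of j i] diag[of i] by (cases i j rule: linorder_cases) auto
  qed (use B in auto)
qed

text \<open>The Berman-Higman theorem for a matrix of finite order: the trace is a sum of \<open>n\<close> roots of
  unity, so a non-zero integer multiple of \<open>n\<close> only arises from a scalar matrix.\<close>

lemma finite_order_mat_scalar_if_trace:
  fixes A :: "complex mat"
  assumes A: "A \<in> carrier_mat n n" and m: "A ^\<^sub>m m = 1\<^sub>m n" "m > 0"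
    and tr: "(\<Sum>i<n. A $$ (i, i)) = of_nat n * of_int c" and c: "c \<noteq> 0"
  shows "A = of_int (sgn c) \<cdot>\<^sub>m 1\<^sub>m n"
proof -
  obtain es where "char_poly A = (\<Prod>a\<leftarrow>es. [:- a, 1:])" using char_poly_factorized[OF A] by blast
  then obtain B where B: "B \<in> carrier_mat n n" "upper_triangular B" "similar_mat A B"
    using schur_decomposition_exists[OF A] by blast
  have ut: "B $$ (i, j) = 0" if "j < i" "i < n" for i j using upper_triangularD[OF B(2)] that B(1) by auto
  obtain n' P Q where "{A, B, P, Q} \<subseteq> carrier_mat n' n'" and PQ': "P * Q = 1\<^sub>m n'" "Q * P = 1\<^sub>m n'"
    and AB: "A = P * B * Q" using similar_matD[OF B(3)] by blast
  moreover have "n' = n" using calculation(1) A by auto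
  ultimately have P: "P \<in> carrier_mat n n" and Q: "Q \<in> carrier_mat n n"
    and PQ: "P * Q = 1\<^sub>m n" "Q * P = 1\<^sub>m n" by auto
  have QAP: "Q * (P * M * Q) * P = M" if "M \<in> carrier_mat n n" for M
  proof -
    have "Q * (P * M * Q) * P = (Q * P) * M * (Q * P)"
      using P Q that by (simp add: assoc_mult_mat[of _ n n _ n _ n])
    then show ?thesis using PQ that by simp
  qed
  have Bm: "B ^\<^sub>m m = 1\<^sub>m n"
  proof -
    have "B ^\<^sub>m m = Q * (P * (B ^\<^sub>m m) * Q) * P" using QAP B(1) by simp
    also have "\<dots> = Q * (A ^\<^sub>m m) * P" using pow_mat_similar[OF B(1) P Q PQ] AB by simp
    finally show ?thesis using m(1) Q PQ by simp
  qed
  have norm1: "norm (B $$ (i, i)) = 1" if "i < n" for i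
  proof -
    have "B $$ (i, i) ^ m = 1" using upper_triangular_pow_mat(2)[OF B(1) ut that, of m] Bm that by simp
    then have "norm (B $$ (i, i)) ^ m = 1" by (metis norm_one norm_power)
    then show ?thesis using power_eq_imp_eq_base[of "norm (B $$ (i, i))" m 1] m(2) by simp
  qed
  have trB: "(\<Sum>i<n. B $$ (i, i)) = of_nat n * of_int c"
  proof -
    have "(\<Sum>i<n. A $$ (i, i)) = (\<Sum>i<n. (Q * (P * B)) $$ (i, i))"
      unfolding AB using P Q B(1) by (intro sum_diag_mult_commute) auto
    also have "Q * (P * B) = B"
      using P Q B(1) PQ assoc_mult_mat[OF Q P B(1)] by simp
    finally show ?thesis using tr by simp
  qed
  define s where "s = (of_int (sgn c) :: complex)"
  have s: "s = 1 \<or> s = -1" using c by (auto simp: s_def sgn_if)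
  have le: "Re (s * B $$ (i, i)) \<le> 1" if "i < n" for i
    using complex_Re_le_cmod[of "s * B $$ (i, i)"] norm1[OF that] s by (auto simp: norm_mult)
  \<comment> \<open>The summands are non-negative and add up to
    \<open>n - n * \<bar>c\<bar>\<close>, which is at most 0. So each \<open>s * B $$ (i, i)\<close>
    has real part 1, and being on the unit circle it is 1.\<close>
  have "(\<Sum>i<n. 1 - Re (s * B $$ (i, i))) = real n - Re (s * (\<Sum>i<n. B $$ (i, i)))"
    by (simp add: sum_subtractf sum_distrib_left)
  also have "s * (\<Sum>i<n. B $$ (i, i)) = of_nat n * of_int \<bar>c\<bar>"
    unfolding trB s_def by (simp add: abs_sgn mult.left_commute flip: of_int_mult)
  also have "Re (of_nat n * of_int \<bar>c\<bar>) = real n * real_of_int \<bar>c\<bar>" by simp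
  also have "real n - real n * real_of_int \<bar>c\<bar> \<le> 0"
  proof -
    have "1 \<le> real_of_int \<bar>c\<bar>" using c by linarith
    then show ?thesis using mult_left_mono[of 1 "real_of_int \<bar>c\<bar>" "real n"] by simp
  qed
  finally have le0: "(\<Sum>i<n. 1 - Re (s * B $$ (i, i))) \<le> 0" .
  have "B $$ (i, i) = s" if i: "i < n" for i
  proof -
    have "(\<Sum>i<n. 1 - Re (s * B $$ (i, i))) = 0"
      using le0 le by (intro antisym sum_nonneg) auto
    then have re: "Re (s * B $$ (i, i)) = 1"
      using sum_nonneg_eq_0_iff[of "{..<n}" "\<lambda>i. 1 - Re (s * B $$ (i, i))"] le i by force
    have "norm (s * B $$ (i, i)) = 1" using norm1[OF i] s by (auto simp: norm_mult)
    then have "(Re (s * B $$ (i, i)))\<^sup>2 + (Im (s * B $$ (i, i)))\<^sup>2 = 1"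
      using cmod_power2[of "s * B $$ (i, i)"] by simp
    then have "s * B $$ (i, i) = 1" using re by (simp add: complex_eq_iff)
    then have "s * (s * B $$ (i, i)) = s" by simp
    moreover have "s * s = 1" using s by auto
    ultimately show ?thesis by (simp flip: mult.assoc)
  qed
  then have "B = s \<cdot>\<^sub>m 1\<^sub>m n"
    using upper_triangular_finite_order_scalar[OF B(1) ut _ _ Bm m(2), of s] s by auto
  then have "A = P * (s \<cdot>\<^sub>m 1\<^sub>m n) * Q" using AB by simp
  also have "P * (s \<cdot>\<^sub>m 1\<^sub>m n) = s \<cdot>\<^sub>m P" using mult_smult_distrib[OF P one_carrier_mat, of s] P by simp
  also have "s \<cdot>\<^sub>m P * Q = s \<cdot>\<^sub>m (P * Q)" by (rule mult_smult_assoc_mat[OF P Q])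
  finally show ?thesis using PQ by (simp add: s_def)
qed

text \<open>Passage to the regular representation: \<open>A f\<close> is the matrix of left
  multiplication by \<open>f\<close>, and all diagonal entries of \<open>A u\<close> are
  \<open>u \<one>\<close>. If this is non-zero, \<open>A u\<close> is plus or minus the identity,
  and augmentation 1 leaves only the identity.\<close>

lemma (in group) torsion_unit_coeff_one_eq_0:
  assumes fin: "finite (carrier G)" and u: "u \<in> carrier (int_group_ring G)"
    and m: "u [^]\<^bsub>int_group_ring G\<^esub> (m::nat) = \<one>\<^bsub>int_group_ring G\<^esub>" "m > 0"
    and aug: "augmentation G u = 1" and "u \<noteq> \<one>\<^bsub>int_group_ring G\<^esub>"
  shows "u \<one> = 0"
proof (rule ccontr)
  assume nz: "u \<one> \<noteq> 0"
  interpret R: ring "int_group_ring G" by (rule ring_int_group_ring[OF is_group fin])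
  define n where "n = card (carrier G)"
  obtain e where "bij_betw e {0..<n} (carrier G)" using ex_bij_betw_nat_finite[OF fin] unfolding n_def by blast
  then have e: "bij_betw e {..<n} (carrier G)" by (simp add: atLeast0LessThan)
  have ec: "e i \<in> carrier G" if "i < n" for i using bij_betwE[OF e] that by blast
  define A where "A f = mat n n (\<lambda>(i, j). complex_of_int (f (e i \<otimes> inv (e j))))" for f
  have Ac: "A f \<in> carrier_mat n n" for f by (simp add: A_def)
  have A_mult: "A (f \<otimes>\<^bsub>int_group_ring G\<^esub> g) = A f * A g" for f g
  proof (rule eq_matI)
    fix i j assume "i < dim_row (A f * A g)" "j < dim_col (A f * A g)"
    then have ij: "i < n" "j < n" by (simp_all add: A_def)
    let ?x = "e i" and ?y = "e j"
    have xy: "?x \<in> carrier G" "?y \<in> carrier G" using ec ij by auto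
    have "(A f * A g) $$ (i, j) = (\<Sum>l<n. complex_of_int (f (?x \<otimes> inv (e l)) * g (e l \<otimes> inv ?y)))"
      using index_mult_mat_sum[OF Ac Ac ij] ij by (simp add: A_def)
    also have "\<dots> = complex_of_int (\<Sum>l<n. f (?x \<otimes> inv (e l)) * g (e l \<otimes> inv ?y))" by simp
    also have "(\<Sum>l<n. f (?x \<otimes> inv (e l)) * g (e l \<otimes> inv ?y)) =
      (\<Sum>z\<in>carrier G. f (?x \<otimes> inv z) * g (z \<otimes> inv ?y))"
      by (rule sum.reindex_bij_betw[OF e])
    also have "\<dots> = (\<Sum>t\<in>carrier G. f t * g (inv t \<otimes> (?x \<otimes> inv ?y)))"
    proof (rule sum.reindex_bij_witness[of _ "\<lambda>t. inv t \<otimes> ?x" "\<lambda>z. ?x \<otimes> inv z"])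
      fix z assume z: "z \<in> carrier G"
      show "inv (?x \<otimes> inv z) \<otimes> ?x = z" using z xy by (simp add: inv_mult_group m_assoc)
      have "inv (?x \<otimes> inv z) \<otimes> (?x \<otimes> inv ?y) = z \<otimes> inv ?y"
        using z xy \<open>inv (?x \<otimes> inv z) \<otimes> ?x = z\<close> by (simp flip: m_assoc)
      then show "f (?x \<otimes> inv z) * g (inv (?x \<otimes> inv z) \<otimes> (?x \<otimes> inv ?y)) =
        f (?x \<otimes> inv z) * g (z \<otimes> inv ?y)" by simp
      show "?x \<otimes> inv (inv z \<otimes> ?x) = z" using z xy by (simp add: inv_mult_group flip: m_assoc)
    qed (use xy in auto)
    also have "\<dots> = (f \<otimes>\<^bsub>int_group_ring G\<^esub> g) (?x \<otimes> inv ?y)"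
      using xy by (simp add: int_group_ring_simps)
    finally show "A (f \<otimes>\<^bsub>int_group_ring G\<^esub> g) $$ (i, j) = (A f * A g) $$ (i, j)"
      using ij by (simp add: A_def)
  qed (simp_all add: A_def)
  have e_eq: "e i = e j \<longleftrightarrow> i = j" if "i < n" "j < n" for i j
    using bij_betw_imp_inj_on[OF e] that by (auto dest: inj_onD)
  have e_div: "e i \<otimes> inv (e j) = \<one> \<longleftrightarrow> i = j" if "i < n" "j < n" for i j
    using e_eq[OF that] ec[OF that(1)] ec[OF that(2)] by (metis inv_closed inv_inv inv_equality r_inv)
  have A_one: "A \<one>\<^bsub>int_group_ring G\<^esub> = 1\<^sub>m n"
    by (rule eq_matI) (use e_div in \<open>auto simp: A_def int_group_ring_simps\<close>)
  have A_pow: "A (u [^]\<^bsub>int_group_ring G\<^esub> k) = A u ^\<^sub>m k" for k :: nat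
    using Ac[of u] by (induction k) (simp_all add: A_one A_mult)
  have Au: "A u = of_int (sgn (u \<one>)) \<cdot>\<^sub>m 1\<^sub>m n"
  proof (rule finite_order_mat_scalar_if_trace[OF Ac _ m(2) _ nz])
    show "A u ^\<^sub>m m = 1\<^sub>m n" using A_pow[of m] m(1) A_one by simp
    show "(\<Sum>i<n. A u $$ (i, i)) = of_nat n * of_int (u \<one>)" using ec by (simp add: A_def)
  qed
  have val: "u x = (if x = \<one> then sgn (u \<one>) else 0)" if x: "x \<in> carrier G" for x
  proof -
    obtain i where i: "i < n" "e i = x" using e x by (metis bij_betw_iff_bijections lessThan_iff)
    obtain j where j: "j < n" "e j = \<one>" using e one_closed by (metis bij_betw_iff_bijections lessThan_iff)
    have "complex_of_int (u x) = A u $$ (i, j)" using i j x by (simp add: A_def)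
    also have "\<dots> = of_int (if x = \<one> then sgn (u \<one>) else 0)"
      unfolding Au using i j e_eq[OF i(1) j(1)] by auto
    finally show ?thesis by (simp only: of_int_eq_iff)
  qed
  have "augmentation G u = (\<Sum>x\<in>carrier G. if x = \<one> then sgn (u \<one>) else 0)"
    unfolding augmentation_def by (rule sum.cong[OF refl]) (rule val)
  also have "\<dots> = sgn (u \<one>)" using fin by simp
  finally have sgn: "augmentation G u = sgn (u \<one>)" .
  have eq: "u x = \<one>\<^bsub>int_group_ring G\<^esub> x" for x
  proof (cases "x \<in> carrier G")
    case True
    then show ?thesis
      using val[OF True] sgn aug by (simp only: int_group_ring_simps(3))
  next
    case False
    then have "u x = 0" "x \<noteq> \<one>" using u by (auto simp: int_group_ring_simps(1))
    then show ?thesis by (simp only: int_group_ring_simps(3)) simp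
  qed
  have "u = \<one>\<^bsub>int_group_ring G\<^esub>"
  proof
    fix x show "u x = \<one>\<^bsub>int_group_ring G\<^esub> x" by (rule eq)
  qed
  with assms(6) show False by (rule notE)
qed

section \<open>The maps of normalized units induced by homomorphisms\<close>

lemma normalized_units_simps:
  "carrier (normalized_units G) = {u \<in> Units (int_group_ring G). augmentation G u = 1}"
  "u \<otimes>\<^bsub>normalized_units G\<^esub> v = u \<otimes>\<^bsub>int_group_ring G\<^esub> v"
  "\<one>\<^bsub>normalized_units G\<^esub> = \<one>\<^bsub>int_group_ring G\<^esub>"
  by (simp_all add: normalized_units_def units_of_def)

lemma normalized_units_pow:
  "u [^]\<^bsub>normalized_units G\<^esub> (n::nat) = u [^]\<^bsub>int_group_ring G\<^esub> n"
  by (induction n) (simp_all add: normalized_units_simps)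

lemma normalized_units_carrier:
  assumes "u \<in> carrier (normalized_units G)"
  shows "u \<in> carrier (int_group_ring G)" "augmentation G u = 1"
  using assms by (auto simp: normalized_units_simps Units_def)

text \<open>For a homomorphism \<open>h\<close> of finite groups, the induced map of group
  rings.\<close>

definition pushforward :: "('a, 'b) monoid_scheme \<Rightarrow> ('a \<Rightarrow> 'c) \<Rightarrow> ('a \<Rightarrow> int) \<Rightarrow> 'c \<Rightarrow> int" where
  "pushforward G h f = (\<lambda>k. \<Sum>g | g \<in> carrier G \<and> h g = k. f g)"

context group_hom
begin

lemma ord_hom_dvd: "x \<in> carrier G \<Longrightarrow> H.ord (h x) dvd G.ord x"
  using H.pow_eq_id[of "h x" "G.ord x"] hom_nat_pow[of x "G.ord x"] G.pow_ord_eq_1[of x] by simp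

text \<open>Pushing forward is adjoint to composing with \<open>h\<close>. Augmentations,
  coefficient sums and multiplicativity are read off from this by the choice of
  \<open>F\<close>.\<close>

lemma sum_pushforward:
  assumes fin: "finite (carrier G)" "finite (carrier H)"
  shows "(\<Sum>k\<in>carrier H. F k * pushforward G h f k) = (\<Sum>g\<in>carrier G. F (h g) * f g)"
proof -
  have "(\<Sum>k\<in>carrier H. F k * pushforward G h f k) =
    (\<Sum>k\<in>carrier H. \<Sum>g\<in>{g \<in> carrier G. h g = k}. F (h g) * f g)"
    by (auto simp: pushforward_def sum_distrib_left intro!: sum.cong)
  also have "\<dots> = (\<Sum>g\<in>carrier G. F (h g) * f g)"
    by (rule sum.group) (use fin in auto)
  finally show ?thesis .
qed

lemma sum_pushforward_set:
  assumes fin: "finite (carrier G)" "finite (carrier H)" and "D \<subseteq> carrier H"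
  shows "sum (pushforward G h f) D = sum f {g \<in> carrier G. h g \<in> D}"
proof -
  have "sum (pushforward G h f) D = (\<Sum>k\<in>carrier H. (if k \<in> D then 1 else 0) * pushforward G h f k)"
    using assms by (intro sum.mono_neutral_cong_left) auto
  also have "\<dots> = (\<Sum>g\<in>carrier G. (if h g \<in> D then 1 else 0) * f g)"
    by (rule sum_pushforward[OF fin])
  also have "\<dots> = sum f {g \<in> carrier G. h g \<in> D}"
    using fin by (intro sum.mono_neutral_cong_right) auto
  finally show ?thesis .
qed

lemma pushforward_carrier: "pushforward G h f \<in> carrier (int_group_ring H)"
proof -
  have "pushforward G h f k = 0" if "k \<notin> carrier H" for k
    using that by (auto simp: pushforward_def intro!: sum.neutral)
  then show ?thesis by (simp add: H.int_group_ring_simps)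
qed

lemma augmentation_pushforward:
  assumes fin: "finite (carrier G)" "finite (carrier H)"
  shows "augmentation H (pushforward G h f) = augmentation G f"
  using sum_pushforward[OF fin, of "\<lambda>_. 1"] by (simp add: augmentation_def)

lemma pushforward_mult:
  assumes fin: "finite (carrier G)" "finite (carrier H)"
  shows "pushforward G h (u \<otimes>\<^bsub>int_group_ring G\<^esub> v) =
    pushforward G h u \<otimes>\<^bsub>int_group_ring H\<^esub> pushforward G h v"
proof
  fix k :: 'c
  let ?d = "\<lambda>x. if x = k then 1 else 0 :: int"
  show "pushforward G h (u \<otimes>\<^bsub>int_group_ring G\<^esub> v) k =
    (pushforward G h u \<otimes>\<^bsub>int_group_ring H\<^esub> pushforward G h v) k"
  proof (cases "k \<in> carrier H")
    case True
    \<comment> \<open>A coefficient is the pairing with an indicator function, which brings both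
      sides into the form of \<open>sum_pushforward\<close> and
      \<open>sum_int_group_ring_mult\<close>.\<close>
    have ev: "f k = (\<Sum>x\<in>carrier H. ?d x * f x)" for f :: "'c \<Rightarrow> int"
    proof -
      have "(\<Sum>x\<in>carrier H. ?d x * f x) = (\<Sum>x\<in>carrier H. if x = k then f k else 0)"
        by (rule sum.cong) auto
      then show ?thesis using True fin(2) by simp
    qed
    have "pushforward G h (u \<otimes>\<^bsub>int_group_ring G\<^esub> v) k =
      (\<Sum>g\<in>carrier G. ?d (h g) * (u \<otimes>\<^bsub>int_group_ring G\<^esub> v) g)"
      by (subst ev) (rule sum_pushforward[OF fin])
    also have "\<dots> = (\<Sum>y\<in>carrier G. \<Sum>z\<in>carrier G. ?d (h (y \<otimes> z)) * (u y * v z))"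
      by (rule G.sum_int_group_ring_mult[OF fin(1)])
    also have "\<dots> = (\<Sum>y\<in>carrier G. (\<Sum>z\<in>carrier G. ?d (h y \<otimes>\<^bsub>H\<^esub> h z) * v z) * u y)"
      by (intro sum.cong refl) (auto simp: sum_distrib_left sum_distrib_right mult_ac intro!: sum.cong)
    also have "\<dots> = (\<Sum>y\<in>carrier G. (\<Sum>b\<in>carrier H. ?d (h y \<otimes>\<^bsub>H\<^esub> b) * pushforward G h v b) * u y)"
      by (intro sum.cong refl arg_cong2[where f = "(*)"]) (rule sum_pushforward[OF fin, symmetric])
    also have "\<dots> = (\<Sum>a\<in>carrier H. (\<Sum>b\<in>carrier H. ?d (a \<otimes>\<^bsub>H\<^esub> b) * pushforward G h v b) * pushforward G h u a)"
      by (rule sum_pushforward[OF fin, symmetric])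
    also have "\<dots> = (\<Sum>a\<in>carrier H. \<Sum>b\<in>carrier H. ?d (a \<otimes>\<^bsub>H\<^esub> b) * (pushforward G h u a * pushforward G h v b))"
      by (intro sum.cong refl) (auto simp: sum_distrib_left sum_distrib_right mult_ac intro!: sum.cong)
    also have "\<dots> = (\<Sum>x\<in>carrier H. ?d x * (pushforward G h u \<otimes>\<^bsub>int_group_ring H\<^esub> pushforward G h v) x)"
      by (rule H.sum_int_group_ring_mult[OF fin(2), symmetric])
    also have "\<dots> = (pushforward G h u \<otimes>\<^bsub>int_group_ring H\<^esub> pushforward G h v) k"
      by (rule ev[symmetric])
    finally show ?thesis .
  next
    case False
    then show ?thesis
      using pushforward_carrier[of "u \<otimes>\<^bsub>int_group_ring G\<^esub> v"] by (simp add: H.int_group_ring_simps)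
  qed
qed

lemma pushforward_one:
  assumes fin: "finite (carrier G)"
  shows "pushforward G h \<one>\<^bsub>int_group_ring G\<^esub> = \<one>\<^bsub>int_group_ring H\<^esub>"
proof
  fix k
  have "(\<Sum>g | g \<in> carrier G \<and> h g = k. if g = \<one> then 1 else 0 :: int) = (if \<one>\<^bsub>H\<^esub> = k then 1 else 0)"
    using fin by (simp add: sum.delta)
  then show "pushforward G h \<one>\<^bsub>int_group_ring G\<^esub> k = \<one>\<^bsub>int_group_ring H\<^esub> k"
    by (auto simp: pushforward_def G.int_group_ring_simps H.int_group_ring_simps)
qed

lemma pushforward_hom:
  assumes fin: "finite (carrier G)" "finite (carrier H)"
  shows "pushforward G h \<in> hom (normalized_units G) (normalized_units H)"
proof (rule homI)
  fix u assume u: "u \<in> carrier (normalized_units G)"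
  then obtain v where v: "v \<in> carrier (int_group_ring G)"
    "v \<otimes>\<^bsub>int_group_ring G\<^esub> u = \<one>\<^bsub>int_group_ring G\<^esub>" "u \<otimes>\<^bsub>int_group_ring G\<^esub> v = \<one>\<^bsub>int_group_ring G\<^esub>"
    by (auto simp: normalized_units_simps Units_def)
  have "pushforward G h v \<otimes>\<^bsub>int_group_ring H\<^esub> pushforward G h u = \<one>\<^bsub>int_group_ring H\<^esub>"
    "pushforward G h u \<otimes>\<^bsub>int_group_ring H\<^esub> pushforward G h v = \<one>\<^bsub>int_group_ring H\<^esub>"
    unfolding pushforward_mult[OF fin, symmetric] v(2,3) by (rule pushforward_one[OF fin(1)])+
  then have "pushforward G h u \<in> Units (int_group_ring H)"
    using pushforward_carrier unfolding Units_def by blast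
  then show "pushforward G h u \<in> carrier (normalized_units H)"
    using augmentation_pushforward[OF fin] normalized_units_carrier(2)[OF u]
    by (simp add: normalized_units_simps)
qed (simp add: normalized_units_simps pushforward_mult[OF fin])

end

section \<open>Group elements as units, and units of prime order\<close>

context group
begin

definition of_elem :: "'a \<Rightarrow> 'a \<Rightarrow> int" where
  "of_elem a = (\<lambda>x. if x = a then 1 else 0)"

lemma of_elem_hom:
  assumes fin: "finite (carrier G)"
  shows "of_elem \<in> hom G (normalized_units G)" "inj_on of_elem (carrier G)"
proof -
  have mult: "of_elem (a \<otimes> b) = of_elem a \<otimes>\<^bsub>int_group_ring G\<^esub> of_elem b"
    if "a \<in> carrier G" "b \<in> carrier G" for a b
  proof
    fix x
    show "of_elem (a \<otimes> b) x = (of_elem a \<otimes>\<^bsub>int_group_ring G\<^esub> of_elem b) x"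
    proof (cases "x \<in> carrier G")
      case True
      have "(\<Sum>y\<in>carrier G. of_elem a y * of_elem b (inv y \<otimes> x)) =
        (\<Sum>y\<in>carrier G. if y = a then of_elem b (inv a \<otimes> x) else 0)"
        by (rule sum.cong) (auto simp: of_elem_def)
      also have "\<dots> = of_elem b (inv a \<otimes> x)" using that fin by simp
      also have "\<dots> = of_elem (a \<otimes> b) x"
        using that True inv_solve_left'[of b a x] by (auto simp: of_elem_def)
      finally show ?thesis using True by (simp add: int_group_ring_simps)
    next
      case False
      then show ?thesis using that by (auto simp: int_group_ring_simps of_elem_def)
    qed
  qed
  have one: "of_elem \<one> = \<one>\<^bsub>int_group_ring G\<^esub>"
    by (rule ext) (simp add: of_elem_def int_group_ring_simps)
  have car: "of_elem a \<in> carrier (int_group_ring G)" if "a \<in> carrier G" for a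
    using that by (auto simp: int_group_ring_simps of_elem_def)
  show "of_elem \<in> hom G (normalized_units G)"
  proof (rule homI)
    fix a assume a: "a \<in> carrier G"
    have "of_elem (inv a) \<otimes>\<^bsub>int_group_ring G\<^esub> of_elem a = \<one>\<^bsub>int_group_ring G\<^esub>"
      "of_elem a \<otimes>\<^bsub>int_group_ring G\<^esub> of_elem (inv a) = \<one>\<^bsub>int_group_ring G\<^esub>"
      using a mult[of "inv a" a] mult[of a "inv a"] one by simp_all
    then have "of_elem a \<in> Units (int_group_ring G)"
      using car[OF a] car[OF inv_closed[OF a]] unfolding Units_def by blast
    moreover have "augmentation G (of_elem a) = 1"
      using a fin by (simp add: augmentation_def of_elem_def)
    ultimately show "of_elem a \<in> carrier (normalized_units G)" by (simp add: normalized_units_simps)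
  qed (simp add: normalized_units_simps mult)
  show "inj_on of_elem (carrier G)"
    by (rule inj_onI) (metis of_elem_def zero_neq_one)
qed

lemma normal_conj_closed:
  assumes N: "N \<lhd> G"
  shows "conj_closed N"
  using normal_invE(2)[OF N] subgroup.subset[OF normal_imp_subgroup[OF N]]
  unfolding conj_closed_def by blast

lemma ord_normalized_unit:
  assumes fin: "finite (carrier G)" and u: "u \<in> carrier (normalized_units G)"
  shows "u [^]\<^bsub>int_group_ring G\<^esub> group.ord (normalized_units G) u = \<one>\<^bsub>int_group_ring G\<^esub>"
proof -
  interpret V: group "normalized_units G" by (rule group_normalized_units[OF is_group fin])
  show ?thesis using V.pow_ord_eq_1[OF u] by (simp add: normalized_units_simps normalized_units_pow)
qed

lemma coeff_one_eq_0:
  assumes fin: "finite (carrier G)" and u: "u \<in> carrier (normalized_units G)"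
    and "group.ord (normalized_units G) u > 1"
  shows "u \<one> = 0"
proof -
  interpret V: group "normalized_units G" by (rule group_normalized_units[OF is_group fin])
  have "u \<noteq> \<one>\<^bsub>int_group_ring G\<^esub>" using assms(3) V.ord_id by (auto simp: normalized_units_simps)
  then show ?thesis
    using torsion_unit_coeff_one_eq_0[OF fin _ ord_normalized_unit[OF fin u]]
      normalized_units_carrier[OF u] assms(3) by simp
qed

lemma exists_prime_dvd_ord:
  assumes "x \<in> carrier G" "x \<noteq> \<one>"
  shows "\<exists>r. Factorial_Ring.prime r \<and> r dvd ord x"
proof -
  have "ord x \<noteq> 1" using ord_eq_1[OF assms(1)] assms(2) by simp
  then show ?thesis by (rule prime_factor_nat)
qed

lemma ord_dvd_card_subgroup:
  assumes "subgroup H G" "x \<in> H"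
  shows "ord x dvd card H"
proof -
  interpret H: group "G\<lparr>carrier := H\<rparr>" using subgroup.subgroup_is_group[OF assms(1) is_group] .
  show ?thesis using H.ord_dvd_group_order[of x] ord_subgroup[OF assms] assms(2) by (simp add: Coset.order_def)
qed

text \<open>If \<open>p\<close> does not divide \<open>card N\<close>, every non-trivial element of
  \<open>N\<close> has a prime other than \<open>p\<close> in its order. So \<open>u\<close> sums to
  0 over these elements, and \<open>u \<one> = 0\<close>, against the sum 1. This is applied to
  kernels and to all of \<open>G\<close>, where the sum is the augmentation.\<close>

lemma prime_ord_unit_dvd_card:
  assumes fin: "finite (carrier G)" and p: "Factorial_Ring.prime (p::nat)"
    and u: "u \<in> carrier (normalized_units G)" "group.ord (normalized_units G) u = p"
    and N: "N \<lhd> G" and sum: "sum u N = 1"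
  shows "p dvd card N"
proof (rule ccontr)
  assume np: "\<not> p dvd card N"
  have sub: "subgroup N G" by (rule normal_imp_subgroup[OF N])
  have Nc: "N \<subseteq> carrier G" by (rule subgroup.subset[OF sub])
  have "conj_closed (N - {\<one>})"
    using normal_conj_closed[OF N] conj_eq_iff by (auto simp: conj_closed_def subset_eq)
  moreover have "\<exists>r. Factorial_Ring.prime r \<and> r dvd ord x \<and> \<not> r dvd p" if x: "x \<in> N - {\<one>}" for x
  proof -
    obtain r where r: "Factorial_Ring.prime r" "r dvd ord x"
      using exists_prime_dvd_ord x Nc by blast
    have "ord x dvd card N" using ord_dvd_card_subgroup[OF sub] x by blast
    then have "r dvd card N" using r(2) dvd_trans by blast
    then have "r \<noteq> p" using np by blast
    then have "\<not> r dvd p" using primes_dvd_imp_eq[OF r(1) p] by blast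
    then show ?thesis using r by blast
  qed
  ultimately have "sum u (N - {\<one>}) = 0"
    using sum_ord_not_dvd_eq_0[OF fin normalized_units_carrier(1)[OF u(1)]
        ord_normalized_unit[OF fin u(1), unfolded u(2)] prime_gt_0_nat[OF p]] by blast
  moreover have "u \<one> = 0" using coeff_one_eq_0[OF fin u(1)] u(2) p prime_gt_1_nat by simp
  moreover have "sum u N = u \<one> + sum u (N - {\<one>})"
    using sum.remove[OF finite_subset[OF Nc fin], of \<one> u] subgroup.one_closed[OF sub] by simp
  ultimately show False using sum by simp
qed

lemma prime_ord_unit_dvd_order:
  assumes fin: "finite (carrier G)" and p: "Factorial_Ring.prime (p::nat)"
    and "has_ord (normalized_units G) p"
  shows "p dvd order G"
proof -
  obtain u where u: "u \<in> carrier (normalized_units G)" "group.ord (normalized_units G) u = p"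
    using assms(3) by (auto simp: has_ord_def)
  have "carrier G \<lhd> G" by (rule normal_invI) (auto simp: subgroup_self)
  then show ?thesis
    using prime_ord_unit_dvd_card[OF fin p u] normalized_units_carrier(2)[OF u(1)]
    by (simp add: augmentation_def Coset.order_def)
qed

end

text \<open>The coefficient of the image at 1 is the sum of \<open>u\<close> over the
  kernel.\<close>

lemma (in group_hom) prime_ord_unit_in_kernel_dvd:
  assumes fin: "finite (carrier G)" "finite (carrier H)" and p: "Factorial_Ring.prime (p::nat)"
    and u: "u \<in> carrier (normalized_units G)" "group.ord (normalized_units G) u = p"
    and push: "pushforward G h u = \<one>\<^bsub>int_group_ring H\<^esub>"
  shows "p dvd card (kernel G H h)"
proof (rule G.prime_ord_unit_dvd_card[OF fin(1) p u normal_kernel])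
  have "kernel G H h = {g \<in> carrier G. h g \<in> {\<one>\<^bsub>H\<^esub>}}" by (auto simp: kernel_def)
  then have "sum u (kernel G H h) = sum (pushforward G h u) {\<one>\<^bsub>H\<^esub>}"
    using sum_pushforward_set[OF fin, of "{\<one>\<^bsub>H\<^esub>}" u] by simp
  then show "sum u (kernel G H h) = 1" by (simp add: push H.int_group_ring_simps)
qed

text \<open>Let \<open>Q\<close> be the set of \<open>q\<close>-elements and \<open>D\<close> the set of elements whose image has order prime
  to \<open>q\<close>. Coefficient sums vanish on classes of elements whose order has a prime factor not
  dividing that of the unit, so the coefficients of \<open>u\<close> sum to \<open>0\<close> on \<open>D\<close>, and hence on the complement of \<open>Q\<close>; but they
  sum to a multiple of \<open>q\<close> on \<open>Q\<close>, whereas the total is \<open>1\<close>.\<close>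

lemma (in group_hom) has_ord_mult_if_order_drops:
  assumes fin: "finite (carrier G)" "finite (carrier H)"
    and pq: "Factorial_Ring.prime (p::nat)" "Factorial_Ring.prime (q::nat)" "p \<noteq> q"
    and u: "u \<in> carrier (normalized_units G)" "group.ord (normalized_units G) u = p * q"
    and push: "group.ord (normalized_units H) (pushforward G h u) = q"
    and ndvd: "\<not> q dvd card (kernel G H h)"
  shows "has_ord G (p * q)"
proof (rule ccontr)
  assume no_ord: "\<not> has_ord G (p * q)"
  interpret V: group "normalized_units G" by (rule group_normalized_units[OF G.is_group fin(1)])
  have pos: "p * q > 0" "p * q > 1" and q1: "q > 1"
    using pq prime_gt_0_nat prime_gt_1_nat by (auto intro: one_less_mult)
  have uR: "u \<in> carrier (int_group_ring G)" and aug: "augmentation G u = 1"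
    using normalized_units_carrier[OF u(1)] by auto
  have upq: "u [^]\<^bsub>int_group_ring G\<^esub> (p * q) = \<one>\<^bsub>int_group_ring G\<^esub>"
    using G.ord_normalized_unit[OF fin(1) u(1)] u(2) by simp
  have u1: "u \<one> = 0" using G.coeff_one_eq_0[OF fin(1) u(1)] u(2) pos by simp
  let ?w = "pushforward G h u"
  have w: "?w \<in> carrier (normalized_units H)" using hom_in_carrier[OF pushforward_hom[OF fin] u(1)] .
  have wR: "?w \<in> carrier (int_group_ring H)" by (rule pushforward_carrier)
  have wq: "?w [^]\<^bsub>int_group_ring H\<^esub> q = \<one>\<^bsub>int_group_ring H\<^esub>"
    using H.ord_normalized_unit[OF fin(2) w] push by simp
  have w1: "?w \<one>\<^bsub>H\<^esub> = 0" using H.coeff_one_eq_0[OF fin(2) w] push q1 by simp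
  obtain k c where kc: "order G = q ^ k * c" "\<not> q dvd c"
    using G.pow_prime_power_ord[OF fin(1) pq(2)] by blast
  define Q where "Q = {x \<in> carrier G. x [^] (q ^ k) = \<one>}"
  define D where "D = {x \<in> carrier G. \<not> q dvd H.ord (h x)}"
  have Qc: "Q \<subseteq> carrier G" and Dc: "D \<subseteq> carrier G" by (auto simp: Q_def D_def)
  \<comment> \<open>The power of \<open>u\<close> with exponent \<open>q ^ k\<close> is not 1,
    because \<open>p\<close> divides the order of \<open>u\<close>. So its coefficient at 1 is 0,
    and this is congruent to the sum of \<open>u\<close> over \<open>Q\<close>.\<close>
  have sumQ: "int q dvd sum u Q"
  proof -
    let ?v = "u [^]\<^bsub>int_group_ring G\<^esub> (q ^ k)"
    have vV: "?v \<in> carrier (normalized_units G)"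
      using V.nat_pow_closed[OF u(1), of "q ^ k"] by (simp add: normalized_units_pow)
    have "?v \<noteq> \<one>\<^bsub>int_group_ring G\<^esub>"
    proof
      assume "?v = \<one>\<^bsub>int_group_ring G\<^esub>"
      then have "p * q dvd q ^ k"
        using V.pow_eq_id[OF u(1), of "q ^ k"] u(2) by (simp add: normalized_units_simps normalized_units_pow)
      then have "p dvd q ^ k" using dvd_mult_left by blast
      then show False using pq primes_dvd_imp_eq prime_dvd_power by blast
    qed
    moreover have "?v [^]\<^bsub>int_group_ring G\<^esub> (p * q) = \<one>\<^bsub>int_group_ring G\<^esub>"
    proof -
      have "(u [^]\<^bsub>normalized_units G\<^esub> (q ^ k)) [^]\<^bsub>normalized_units G\<^esub> (p * q) = \<one>\<^bsub>normalized_units G\<^esub>"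
        using V.pow_ord_eq_1[OF u(1)] u(1) u(2) V.nat_pow_pow[OF u(1), of "q ^ k" "p * q"]
          V.nat_pow_pow[OF u(1), of "p * q" "q ^ k"] by (simp add: mult.commute)
      then show ?thesis by (simp add: normalized_units_simps normalized_units_pow)
    qed
    ultimately have "?v \<one> = 0"
      using G.torsion_unit_coeff_one_eq_0[OF fin(1) normalized_units_carrier(1)[OF vV] _ pos(1)
          normalized_units_carrier(2)[OF vV]] by blast
    then have "[0 = sum u Q] (mod int q)"
      using G.sum_pow_one_cong[OF fin(1) uR pq(2), of k] by (simp add: Q_def)
    then have "[sum u Q = 0] (mod int q)" by (rule cong_sym)
    then show ?thesis by (simp add: cong_0_iff)
  qed
  \<comment> \<open>\<open>D\<close> is the preimage of the elements of order prime to
    \<open>q\<close>. The image of \<open>u\<close>, of order \<open>q\<close>, sums to 0 over the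
    non-trivial ones among these and has coefficient 0 at 1.\<close>
  have sumD: "sum u D = 0"
  proof -
    let ?E = "{y \<in> carrier H. \<not> q dvd H.ord y}"
    have "D = {g \<in> carrier G. h g \<in> ?E}" by (auto simp: D_def)
    then have "sum u D = sum ?w ?E" using sum_pushforward_set[OF fin, of ?E u] by auto
    also have "\<dots> = ?w \<one>\<^bsub>H\<^esub> + sum ?w (?E - {\<one>\<^bsub>H\<^esub>})"
      using fin(2) q1 by (intro sum.remove) auto
    also have "sum ?w (?E - {\<one>\<^bsub>H\<^esub>}) = 0"
    proof (rule H.sum_ord_not_dvd_eq_0[OF fin(2) wR wq])
      show "H.conj_closed (?E - {\<one>\<^bsub>H\<^esub>})"
        using H.ord_conj H.conj_eq_iff by (auto simp: H.conj_closed_def)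
      fix y assume y: "y \<in> ?E - {\<one>\<^bsub>H\<^esub>}"
      then obtain r where "Factorial_Ring.prime r" "r dvd H.ord y"
        using H.exists_prime_dvd_ord by blast
      moreover from this have "r \<noteq> q" using y by blast
      ultimately show "\<exists>r. Factorial_Ring.prime r \<and> r dvd H.ord y \<and> \<not> r dvd q"
        using pq(2) primes_dvd_imp_eq by blast
    qed (use q1 in simp)
    finally show ?thesis using w1 by simp
  qed
  have Qord: "x \<in> Q \<longleftrightarrow> x \<in> carrier G \<and> G.ord x dvd q ^ k" for x
    using G.pow_eq_id[of x "q ^ k"] by (auto simp: Q_def)
  \<comment> \<open>The image of a common element has both \<open>q\<close>-power order and order
    prime to \<open>q\<close>, so the element lies in the kernel, which has no non-trivial
    \<open>q\<close>-elements.\<close>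
  have DQ: "D \<inter> Q = {\<one>}"
  proof (intro equalityI subsetI)
    fix x assume x: "x \<in> D \<inter> Q"
    then have xc: "x \<in> carrier G" using Qc by blast
    have "G.ord x dvd q ^ k" using x Qord by blast
    then have "H.ord (h x) dvd q ^ k" by (rule dvd_trans[OF ord_hom_dvd[OF xc]])
    then obtain i where i: "H.ord (h x) = q ^ i" using pq(2) divides_primepow_nat by blast
    moreover have "\<not> q dvd H.ord (h x)" using x by (auto simp: D_def)
    ultimately have "H.ord (h x) = 1" by (cases i) auto
    then have xN: "x \<in> kernel G H h" using xc H.ord_eq_1[of "h x"] by (simp add: kernel_def)
    have "G.ord x dvd card (kernel G H h)" by (rule G.ord_dvd_card_subgroup[OF subgroup_kernel xN])
    then have "\<not> q dvd G.ord x" using ndvd dvd_trans by blast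
    moreover obtain j where "G.ord x = q ^ j" using x Qord pq(2) divides_primepow_nat by blast
    ultimately have "G.ord x = 1" by (cases j) auto
    then show "x \<in> {\<one>}" using G.ord_eq_1[OF xc] by simp
  next
    fix x assume "x \<in> {\<one>}"
    then show "x \<in> D \<inter> Q" using q1 by (simp add: D_def Q_def)
  qed
  let ?A = "carrier G - (Q \<union> D)"
  \<comment> \<open>Outside \<open>Q\<close> and \<open>D\<close> the order is divisible by
    \<open>q\<close>, not by \<open>p\<close> for lack of an element of order \<open>p * q\<close>,
    and not a power of \<open>q\<close>; so a third prime divides it.\<close>
  have sumA: "sum u ?A = 0"
  proof (rule G.sum_ord_not_dvd_eq_0[OF fin(1) uR upq pos(1)])
    have "G.conj_closed Q" unfolding G.conj_closed_def using Qc Qord G.ord_conj by auto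
    moreover have "G.conj_closed D" unfolding G.conj_closed_def
      using Dc H.ord_conj by (auto simp: D_def)
    moreover have "G.conj_closed (carrier G - E)" if "G.conj_closed E" for E
      unfolding G.conj_closed_def
    proof (intro conjI ballI)
      fix x g assume x: "x \<in> carrier G - E" and g: "g \<in> carrier G"
      have "inv g \<otimes> (g \<otimes> x \<otimes> inv g) \<otimes> inv (inv g) = x"
        using x g G.conj_comp[of "inv g" g x] by simp
      then have "g \<otimes> x \<otimes> inv g \<notin> E"
        using G.conj_closedD(2)[OF that, of "g \<otimes> x \<otimes> inv g" "inv g"] x g by fastforce
      then show "g \<otimes> x \<otimes> inv g \<in> carrier G - E" using x g by simp
    qed auto
    moreover have "G.conj_closed (Q \<union> D)" using calculation(1,2) by (auto simp: G.conj_closed_def)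
    ultimately show "G.conj_closed ?A" by blast
    fix x assume x: "x \<in> ?A"
    then have xc: "x \<in> carrier G" and xQ: "\<not> G.ord x dvd q ^ k" and "q dvd H.ord (h x)"
      using Qord by (auto simp: D_def)
    have qx: "q dvd G.ord x" by (rule dvd_trans[OF \<open>q dvd H.ord (h x)\<close> ord_hom_dvd[OF xc]])
    show "\<exists>r. Factorial_Ring.prime r \<and> r dvd G.ord x \<and> \<not> r dvd p * q"
    proof (rule ccontr)
      assume none: "\<not> ?thesis"
      have "\<not> p dvd G.ord x"
      proof
        assume "p dvd G.ord x"
        then have "p * q dvd G.ord x" using qx pq by (simp add: divides_mult primes_coprime)
        then show False using no_ord G.has_ord_dvd[OF fin(1) xc] by blast
      qed
      then have only_q: "r = q" if "Factorial_Ring.prime r" "r dvd G.ord x" for r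
      proof -
        have "r dvd p * q" using that none by blast
        then have "r dvd p \<or> r dvd q" using prime_dvd_mult_iff[OF that(1)] by blast
        then have "r = p \<or> r = q" using primes_dvd_imp_eq[OF that(1)] pq by blast
        then show ?thesis using \<open>\<not> p dvd G.ord x\<close> that(2) by blast
      qed
      have "G.ord x dvd q ^ k * c" using G.ord_dvd_group_order[OF xc] kc(1) by simp
      moreover have "coprime (G.ord x) c"
      proof (rule ccontr)
        assume "\<not> coprime (G.ord x) c"
        then have "gcd (G.ord x) c \<noteq> 1" using coprime_iff_gcd_eq_1 by blast
        then obtain r where "Factorial_Ring.prime r" "r dvd gcd (G.ord x) c"
          using prime_factor_nat by blast
        then have "Factorial_Ring.prime r" "r dvd G.ord x" "r dvd c" by auto
        then show False using only_q kc(2) by blast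
      qed
      ultimately have "G.ord x dvd q ^ k" by (simp add: coprime_dvd_mult_left_iff)
      then show False using xQ by blast
    qed
  qed
  have finQD: "finite Q" "finite D" using Qc Dc fin(1) finite_subset by blast+
  have "sum u (carrier G) = sum u ?A + sum u (Q \<union> D)"
    using sum.subset_diff[of "Q \<union> D" "carrier G" u] Qc Dc fin(1) by simp
  also have "sum u (Q \<union> D) = sum u Q + sum u D - sum u (Q \<inter> D)"
    using sum_Un[OF finQD, of u] .
  also have "sum u (Q \<inter> D) = 0" using DQ u1 by (simp add: Int_commute)
  finally have "sum u Q = 1" using sumA sumD aug by (simp add: augmentation_def)
  then show False using sumQ q1 by simp
qed

section \<open>Reduction to almost simple quotients\<close>

lemma dvd_mult_primes_cases:
  assumes "Factorial_Ring.prime (p::nat)" "Factorial_Ring.prime (q::nat)" "d dvd p * q"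
  shows "d = 1 \<or> d = p \<or> d = q \<or> d = p * q"
proof -
  obtain a b where "d = a * b" "a dvd p" "b dvd q" using division_decomp[OF assms(3)] by blast
  moreover have "a = 1 \<or> a = p" "b = 1 \<or> b = q" using calculation assms(1,2) prime_nat_iff by blast+
  ultimately show ?thesis by auto
qed

lemma (in group) nat_pow_eq_imp_cong:
  assumes "x \<in> carrier G" "x [^] (a::nat) = x [^] (b::nat)"
  shows "[a = b] (mod ord x)"
proof -
  have "x [^] int a = x [^] int b" unfolding int_pow_int by (rule assms(2))
  then have "int (ord x) dvd int b - int a" using int_pow_eq[OF assms(1)] by blast
  then have "[int b = int a] (mod int (ord x))" by (simp only: cong_iff_dvd_diff)
  then show ?thesis unfolding cong_int_iff by (rule cong_sym)
qed

text \<open>From \<open>y [^] q = \<one>\<close> it follows that \<open>k ^ q\<close> is 1 modulo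
  \<open>p\<close>, while \<open>k\<close> is not, as \<open>x\<close> and \<open>y\<close> do not
  commute. So \<open>k\<close> has multiplicative order \<open>q\<close> modulo \<open>p\<close>,
  and \<open>q\<close> divides \<open>p - 1\<close>.\<close>

lemma (in group) prime_dvd_if_conj_power:
  assumes pq: "Factorial_Ring.prime (p::nat)" "Factorial_Ring.prime (q::nat)"
    and x: "x \<in> carrier G" "ord x = p" and y: "y \<in> carrier G" "ord y = q"
    and k: "y \<otimes> x \<otimes> inv y = x [^] (k::nat)" and nc: "y \<otimes> x \<noteq> x \<otimes> y"
  shows "q dvd p - 1" "\<not> [k = 1] (mod p)"
proof -
  have kn: "\<not> [k = 1] (mod p)"
  proof
    assume "[k = 1] (mod p)"
    then have "y \<otimes> x \<otimes> inv y = x"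
      using pow_cong[OF x(1), of p k 1] pow_ord_eq_1[OF x(1)] x k by simp
    then show False using nc conj_eq_iff[OF y(1) x(1) x(1)] by blast
  qed
  have pow: "y [^] i \<otimes> x \<otimes> inv (y [^] i) = x [^] (k ^ i)" for i :: nat
  proof (induction i)
    case (Suc i)
    have "y [^] Suc i \<otimes> x \<otimes> inv (y [^] Suc i) = y \<otimes> (y [^] i \<otimes> x \<otimes> inv (y [^] i)) \<otimes> inv y"
      unfolding nat_pow_Suc2[OF y(1)] by (rule conj_comp) (use x y in auto)
    also have "\<dots> = (x [^] k) [^] (k ^ i)"
      unfolding Suc using conj_pow[OF y(1) x(1)] k by simp
    also have "\<dots> = x [^] (k ^ Suc i)" using x(1) by (simp add: nat_pow_pow)
    finally show ?case .
  qed (use x in simp)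
  have "x [^] (k ^ q) = x" using pow[of q] pow_ord_eq_1[OF y(1)] x y by simp
  then have "[k ^ q = 1] (mod p)"
    using nat_pow_eq_imp_cong[OF x(1), of "k ^ q" 1] x by simp
  then have "Pocklington.ord p k dvd q" using ord_divides by blast
  moreover have "Pocklington.ord p k \<noteq> 1"
    using kn ord_divides[of k 1 p] by auto
  ultimately have q: "Pocklington.ord p k = q" using pq(2) prime_nat_iff by blast
  then have "coprime p k" using pq(2) Pocklington.ord_eq_0[of p k] prime_gt_0_nat by fastforce
  then have "[k ^ totient p = 1] (mod p)" by (intro euler_theorem) (simp add: coprime_commute)
  then show "q dvd p - 1" using q ord_divides pq(1) by (metis totient_prime)
  show "\<not> [k = 1] (mod p)" by (rule kn)
qed

lemma (in group) has_ord_mult_if_commute: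
  assumes "Factorial_Ring.prime (p::nat)" "Factorial_Ring.prime (q::nat)" "p \<noteq> q"
    and "x \<in> carrier G" "ord x = p" "y \<in> carrier G" "ord y = q" "x \<otimes> y = y \<otimes> x"
  shows "has_ord G (p * q)"
proof -
  have "ord (x \<otimes> y) = p * q"
    using ord_mult_coprime[of x y] assms by (simp add: primes_coprime)
  then show ?thesis unfolding has_ord_def using assms(4,6) by blast
qed

lemma (in group) has_ord_mult_if_has_arc:
  assumes "Factorial_Ring.prime (p::nat)" "Factorial_Ring.prime (q::nat)" "p \<noteq> q"
    and "has_arc G q p" "\<not> q dvd p - 1"
  shows "has_ord G (p * q)"
proof -
  obtain x y k where xy: "x \<in> carrier G" "y \<in> carrier G" "ord x = p" "ord y = q"
    "y \<otimes> x \<otimes> inv y = x [^] (k::nat)"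
    using assms(4) unfolding has_arc_def by (elim bexE conjE exE) (rule that)
  then have "y \<otimes> x = x \<otimes> y" using prime_dvd_if_conj_power(1)[of p q x y k] assms by blast
  then show ?thesis using has_ord_mult_if_commute[OF assms(1-3) xy(1,3,2,4)] by simp
qed

section \<open>Lifting orders and arcs along epimorphisms\<close>

lemma (in group_hom) has_ord_lift:
  assumes fin: "finite (carrier G)" and surj: "h ` carrier G = carrier H" and "has_ord H n"
  shows "has_ord G n"
proof -
  obtain y where y: "y \<in> carrier H" "H.ord y = n" using assms(3) by (auto simp: has_ord_def)
  then have "y \<in> h ` carrier G" using surj by simp
  then obtain x where x: "x \<in> carrier G" "y = h x" by blast
  have "H.ord (h x) dvd G.ord x" by (rule ord_hom_dvd[OF x(1)])
  then have "n dvd G.ord x" using x(2) y(2) by simp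
  then show ?thesis by (rule G.has_ord_dvd[OF fin x(1)])
qed

text \<open>Let \<open>L\<close> be the preimage of the subgroup generated by \<open>a\<close>. A
  preimage \<open>y\<close> of \<open>b\<close> normalizes \<open>L\<close>, and
  \<open>y [^] m\<close> lies in \<open>L\<close> only if \<open>q\<close> divides \<open>m\<close>,
  because that subgroup has order \<open>p\<close>, prime to \<open>q\<close>. Then
  \<open>has_arc_if_normalizes\<close> applies.\<close>

lemma (in group_hom) has_arc_lift:
  assumes fin: "finite (carrier G)" and surj: "h ` carrier G = carrier H"
    and pq: "Factorial_Ring.prime (p::nat)" "Factorial_Ring.prime (q::nat)" "p \<noteq> q" "q dvd p - 1"
    and "has_arc H q p"
  shows "has_arc G q p"
proof -
  obtain a b k where ab: "a \<in> carrier H" "b \<in> carrier H" "H.ord a = p" "H.ord b = q"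
    "b \<otimes>\<^bsub>H\<^esub> a \<otimes>\<^bsub>H\<^esub> inv\<^bsub>H\<^esub> b = a [^]\<^bsub>H\<^esub> (k::nat)"
    using assms(7) unfolding has_arc_def by (elim bexE conjE exE) (rule that)
  define A where "A = generate H {a}"
  have A: "subgroup A H" unfolding A_def by (rule H.generate_is_subgroup) (use ab in simp)
  have pos: "H.ord a > 0" using ab(3) pq(1) prime_gt_0_nat by simp
  have Ai: "z \<in> A \<longleftrightarrow> (\<exists>i::nat. z = a [^]\<^bsub>H\<^esub> i)" for z
    unfolding A_def by (rule H.generate_pow_finite[OF ab(1) pos])
  define L where "L = {g \<in> carrier G. h g \<in> A}"
  have L: "subgroup L G"
    by unfold_locales (use subgroup.one_closed[OF A] subgroup.m_closed[OF A] subgroup.m_inv_closed[OF A]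
      in \<open>auto simp: L_def\<close>)
  have "a \<in> h ` carrier G" "b \<in> h ` carrier G" using surj ab by auto
  then obtain x y where x: "x \<in> carrier G" "a = h x" and y: "y \<in> carrier G" "b = h y" by blast
  have "a \<in> A" using Ai[of a] ab(1) by (metis H.nat_pow_eone)
  then have xL: "x \<in> L" using x by (simp add: L_def)
  have "H.ord (h x) dvd G.ord x" by (rule ord_hom_dvd[OF x(1)])
  then have "p dvd G.ord x" using x(2) ab(3) by simp
  moreover have "G.ord x dvd card L" by (rule G.ord_dvd_card_subgroup[OF L xL])
  ultimately have pL: "p dvd card L" by (rule dvd_trans)
  show ?thesis
  proof (rule G.has_arc_if_normalizes[OF fin L pL pq(1,2,4) y(1)])
    fix l assume l: "l \<in> L"
    then have lc: "l \<in> carrier G" and "h l \<in> A" by (auto simp: L_def)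
    then obtain i :: nat where i: "h l = a [^]\<^bsub>H\<^esub> i" using Ai by blast
    have "h (y \<otimes> l \<otimes> inv y) = b \<otimes>\<^bsub>H\<^esub> (a [^]\<^bsub>H\<^esub> i) \<otimes>\<^bsub>H\<^esub> inv\<^bsub>H\<^esub> b"
      using lc y i by simp
    also have "\<dots> = a [^]\<^bsub>H\<^esub> (k * i)"
      using H.conj_pow[OF ab(2,1), of i] ab(1,5) by (simp add: H.nat_pow_pow)
    finally show "y \<otimes> l \<otimes> inv y \<in> L" using lc y Ai by (auto simp: L_def)
  next
    fix m :: nat assume "y [^] m \<in> L"
    then have "h (y [^] m) \<in> A" by (simp add: L_def)
    then obtain i :: nat where i: "b [^]\<^bsub>H\<^esub> m = a [^]\<^bsub>H\<^esub> i" using Ai y hom_nat_pow[OF y(1)] by auto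
    have "b [^]\<^bsub>H\<^esub> (m * p) = (a [^]\<^bsub>H\<^esub> i) [^]\<^bsub>H\<^esub> p" using ab(2) i by (simp add: H.nat_pow_pow[symmetric])
    also have "\<dots> = (a [^]\<^bsub>H\<^esub> p) [^]\<^bsub>H\<^esub> i" using ab(1) by (simp add: H.nat_pow_pow mult.commute)
    also have "\<dots> = \<one>\<^bsub>H\<^esub>" using H.pow_ord_eq_1[OF ab(1)] ab(3) by simp
    finally have "q dvd m * p" using H.pow_eq_id[OF ab(2)] ab(4) by blast
    then show "q dvd m" using pq prime_dvd_mult_iff[OF pq(2)] primes_dvd_imp_eq[OF pq(2,1)] by auto
  qed
qed

text \<open>Only the implications that may fail: for finite groups the converses follow from the
  embedding into the units. The orders \<open>p * q\<close> are recorded as well, because an arc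
  alone does not show whether the two elements commute.\<close>

definition unit_orders_realized :: "('a, 'b) monoid_scheme \<Rightarrow> bool" where
  "unit_orders_realized A \<longleftrightarrow> (\<forall>p q. Factorial_Ring.prime p \<longrightarrow> Factorial_Ring.prime q \<longrightarrow> p \<noteq> q \<longrightarrow>
     (has_ord (normalized_units A) (p * q) \<longrightarrow> has_ord A (p * q)) \<and>
     (has_arc (normalized_units A) q p \<longrightarrow> has_arc A q p))"

lemma unit_orders_realizedD:
  assumes "unit_orders_realized A" "Factorial_Ring.prime p" "Factorial_Ring.prime q" "p \<noteq> q"
  shows "has_ord (normalized_units A) (p * q) \<Longrightarrow> has_ord A (p * q)"
    and "has_arc (normalized_units A) q p \<Longrightarrow> has_arc A q p"
  using assms(1)[unfolded unit_orders_realized_def, rule_format, OF assms(2-4)] by blast+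

text \<open>If \<open>V(\<int>A)\<close> has an element of order \<open>p * q\<close>, then \<open>A\<close> has both arcs between \<open>p\<close> and \<open>q\<close>, and
  one of them comes from a trivial action because \<open>q dvd p - 1\<close> and \<open>p dvd q - 1\<close> exclude each
  other.\<close>

lemma unit_orders_realized_if_NPQ:
  assumes "group A" "finite (carrier A)" "NPQ A"
  shows "unit_orders_realized A"
  unfolding unit_orders_realized_def
proof (intro allI impI)
  fix p q :: nat assume pq: "Factorial_Ring.prime p" "Factorial_Ring.prime q" "p \<noteq> q"
  interpret group A by fact
  interpret V: group "normalized_units A" by (rule group_normalized_units[OF assms(1,2)])
  have "parcs (N_prime_graph A) = parcs (N_prime_graph (normalized_units A))"
    using assms(3) by (simp add: NPQ_def)
  then have arc: "has_arc A s r \<longleftrightarrow> has_arc (normalized_units A) s r"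
    if "Factorial_Ring.prime r" "Factorial_Ring.prime s" "r \<noteq> s" for r s
    unfolding N_prime_graph_arcs[OF assms(1)] N_prime_graph_arcs[OF V.is_group] using that by blast
  have "has_ord A (p * q)" if o: "has_ord (normalized_units A) (p * q)"
  proof -
    have 1: "has_arc A q p" using arc[OF pq] V.has_arc_if_has_ord_mult[OF pq(1,2) o] by blast
    have 2: "has_arc A p q"
      using arc[OF pq(2,1)] pq(3) V.has_arc_if_has_ord_mult[OF pq(2,1)] o by (simp add: mult.commute)
    have "p - 1 > 0" "q - 1 > 0" using pq prime_gt_1_nat by auto
    then have "\<not> (q dvd p - 1 \<and> p dvd q - 1)"
      using dvd_imp_le[of q "p - 1"] dvd_imp_le[of p "q - 1"] by linarith
    then consider "\<not> q dvd p - 1" | "\<not> p dvd q - 1" by blast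
    then show ?thesis
    proof cases
      case 1
      then show ?thesis by (rule has_ord_mult_if_has_arc[OF pq \<open>has_arc A q p\<close>])
    next
      case 2
      then show ?thesis
        using has_ord_mult_if_has_arc[OF pq(2,1) pq(3)[symmetric] \<open>has_arc A p q\<close>] by (simp add: mult.commute)
    qed
  qed
  then show "(has_ord (normalized_units A) (p * q) \<longrightarrow> has_ord A (p * q)) \<and>
     (has_arc (normalized_units A) q p \<longrightarrow> has_arc A q p)" using arc[OF pq] by blast
qed

text \<open>The image of \<open>u\<close> has order 1, \<open>p\<close> or \<open>q\<close>, since
  otherwise the quotient and then \<open>G\<close> would have an element of order
  \<open>p * q\<close>. A prime lost from the order of \<open>u\<close> divides that of the kernel,
  since a power of \<open>u\<close> with this order becomes trivial; a prime that remains is covered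
  by \<open>has_ord_mult_if_order_drops\<close>.\<close>

lemma (in group_hom) prime_divisors_of_kernel_if_no_ord:
  assumes fin: "finite (carrier G)" "finite (carrier H)" and surj: "h ` carrier G = carrier H"
    and H: "unit_orders_realized H"
    and pq: "Factorial_Ring.prime (p::nat)" "Factorial_Ring.prime (q::nat)" "p \<noteq> q"
    and u: "has_ord (normalized_units G) (p * q)" and no: "\<not> has_ord G (p * q)"
  shows "p dvd card (kernel G H h) \<and> q dvd card (kernel G H h)"
proof -
  interpret V: group "normalized_units G" by (rule group_normalized_units[OF G.is_group fin(1)])
  interpret W: group "normalized_units H" by (rule group_normalized_units[OF H.is_group fin(2)])
  interpret push: group_hom "normalized_units G" "normalized_units H" "pushforward G h"
    using pushforward_hom[OF fin] V.is_group W.is_group by (simp add: group_hom_def group_hom_axioms_def)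
  obtain u where u: "u \<in> carrier (normalized_units G)" "V.ord u = p * q"
    using u unfolding has_ord_def by blast
  let ?w = "pushforward G h u"
  have w: "?w \<in> carrier (normalized_units H)" using u(1) by simp
  have dvd: "r dvd card (kernel G H h)"
    if rs: "Factorial_Ring.prime r" "s \<noteq> 0" "p * q = r * s" and "W.ord ?w dvd s" for r s
  proof -
    let ?x = "u [^]\<^bsub>normalized_units G\<^esub> s"
    have x: "?x \<in> carrier (normalized_units G)" using u(1) by simp
    have "V.ord ?x = r" using V.ord_pow[OF u(1), of s] u(2) rs by simp
    moreover have "pushforward G h ?x = \<one>\<^bsub>int_group_ring H\<^esub>"
    proof -
      have "?w [^]\<^bsub>normalized_units H\<^esub> s = \<one>\<^bsub>normalized_units H\<^esub>" using W.pow_eq_id[OF w] that(4) by blast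
      then show ?thesis using push.hom_nat_pow[OF u(1), of s] by (simp add: normalized_units_simps)
    qed
    ultimately show ?thesis using prime_ord_unit_in_kernel_dvd[OF fin rs(1) x] by blast
  qed
  have nz: "p \<noteq> 0" "q \<noteq> 0" using pq by auto
  have "?w [^]\<^bsub>normalized_units H\<^esub> (p * q) = \<one>\<^bsub>normalized_units H\<^esub>"
    using push.hom_nat_pow[OF u(1), of "p * q"] V.pow_ord_eq_1[OF u(1)] u(2) by simp
  then have "W.ord ?w dvd p * q" using W.pow_eq_id[OF w] by blast
  moreover have "W.ord ?w \<noteq> p * q"
  proof
    assume "W.ord ?w = p * q"
    then have "has_ord (normalized_units H) (p * q)" using w unfolding has_ord_def by blast
    then have "has_ord H (p * q)" by (rule unit_orders_realizedD(1)[OF H pq])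
    then show False using has_ord_lift[OF fin(1) surj] no by blast
  qed
  ultimately consider "W.ord ?w = 1" | "W.ord ?w = p" | "W.ord ?w = q"
    using dvd_mult_primes_cases[OF pq(1,2)] by blast
  then show ?thesis
  proof cases
    case 1
    then show ?thesis using dvd[OF pq(1) nz(2)] dvd[OF pq(2) nz(1)] by (simp add: mult.commute)
  next
    case 2
    have "q dvd card (kernel G H h)" using dvd[OF pq(2) nz(1)] 2 by (simp add: mult.commute)
    moreover have "p dvd card (kernel G H h)"
    proof (rule ccontr)
      assume "\<not> p dvd card (kernel G H h)"
      then have "has_ord G (q * p)"
        using has_ord_mult_if_order_drops[OF fin pq(2,1) _ u(1) _ 2] pq(3) u(2) by (simp add: mult.commute)
      then show False using no by (simp add: mult.commute)
    qed
    ultimately show ?thesis by blast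
  next
    case 3
    have "p dvd card (kernel G H h)" using dvd[OF pq(1) nz(2)] 3 by simp
    moreover have "q dvd card (kernel G H h)"
      using has_ord_mult_if_order_drops[OF fin pq u 3] no by blast
    ultimately show ?thesis by blast
  qed
qed

text \<open>Were the image of \<open>x\<close> non-trivial, so would be that of \<open>y\<close>, as
  \<open>k\<close> is not 1 modulo \<open>p\<close>; the arc would survive in the quotient and lift
  to \<open>G\<close>. So \<open>x\<close> becomes trivial and \<open>p\<close> divides the order of
  the kernel. If \<open>q\<close> does not, the kernel contains no non-trivial power of an element
  \<open>g\<close> of order \<open>q\<close> in \<open>G\<close>, and the Frattini argument for
  \<open>g\<close> gives an arc of \<open>G\<close>.\<close>

lemma (in group_hom) prime_divisors_of_kernel_if_no_arc:
  assumes fin: "finite (carrier G)" "finite (carrier H)" and surj: "h ` carrier G = carrier H"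
    and H: "unit_orders_realized H"
    and pq: "Factorial_Ring.prime (p::nat)" "Factorial_Ring.prime (q::nat)" "p \<noteq> q"
    and arc: "has_arc (normalized_units G) q p" and no: "\<not> has_arc G q p"
    and no_ord: "\<not> has_ord (normalized_units G) (p * q)"
  shows "p dvd card (kernel G H h) \<and> q dvd card (kernel G H h)"
proof -
  interpret V: group "normalized_units G" by (rule group_normalized_units[OF G.is_group fin(1)])
  interpret W: group "normalized_units H" by (rule group_normalized_units[OF H.is_group fin(2)])
  interpret push: group_hom "normalized_units G" "normalized_units H" "pushforward G h"
    using pushforward_hom[OF fin] V.is_group W.is_group by (simp add: group_hom_def group_hom_axioms_def)
  obtain x y k where xy: "x \<in> carrier (normalized_units G)" "y \<in> carrier (normalized_units G)"
    "V.ord x = p" "V.ord y = q"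
    "y \<otimes>\<^bsub>normalized_units G\<^esub> x \<otimes>\<^bsub>normalized_units G\<^esub> inv\<^bsub>normalized_units G\<^esub> y = x [^]\<^bsub>normalized_units G\<^esub> (k::nat)"
    using arc unfolding has_arc_def by (elim bexE conjE exE) (rule that)
  have nc: "y \<otimes>\<^bsub>normalized_units G\<^esub> x \<noteq> x \<otimes>\<^bsub>normalized_units G\<^esub> y"
    using V.has_ord_mult_if_commute[OF pq xy(1,3,2,4)] no_ord by auto
  note qp = V.prime_dvd_if_conj_power[OF pq(1,2) xy(1,3,2,4,5) nc]
  let ?x = "pushforward G h x" and ?y = "pushforward G h y"
  have xyc: "?x \<in> carrier (normalized_units H)" "?y \<in> carrier (normalized_units H)" using xy by auto
  have x1: "?x = \<one>\<^bsub>normalized_units H\<^esub>"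
  proof (rule ccontr)
    assume nx: "?x \<noteq> \<one>\<^bsub>normalized_units H\<^esub>"
    have "?x [^]\<^bsub>normalized_units H\<^esub> p = \<one>\<^bsub>normalized_units H\<^esub>"
      using push.hom_nat_pow[OF xy(1), of p] V.pow_ord_eq_1[OF xy(1)] xy(3) by simp
    then have ox: "W.ord ?x = p" using W.ord_prime_iff[OF xyc(1) pq(1)] nx by blast
    have conj: "?y \<otimes>\<^bsub>normalized_units H\<^esub> ?x \<otimes>\<^bsub>normalized_units H\<^esub> inv\<^bsub>normalized_units H\<^esub> ?y
      = ?x [^]\<^bsub>normalized_units H\<^esub> k"
      using arg_cong[OF xy(5), of "pushforward G h"] xy(1,2) push.hom_nat_pow[OF xy(1), of k] by simp
    have "?y \<noteq> \<one>\<^bsub>normalized_units H\<^esub>"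
    proof
      assume "?y = \<one>\<^bsub>normalized_units H\<^esub>"
      then have "?x [^]\<^bsub>normalized_units H\<^esub> k = ?x [^]\<^bsub>normalized_units H\<^esub> (1::nat)"
        using conj xyc(1) by simp
      then have "[k = 1] (mod p)" using W.nat_pow_eq_imp_cong[OF xyc(1)] ox by simp
      then show False using qp(2) by blast
    qed
    moreover have "?y [^]\<^bsub>normalized_units H\<^esub> q = \<one>\<^bsub>normalized_units H\<^esub>"
      using push.hom_nat_pow[OF xy(2), of q] V.pow_ord_eq_1[OF xy(2)] xy(4) by simp
    ultimately have oy: "W.ord ?y = q" using W.ord_prime_iff[OF xyc(2) pq(2)] by blast
    have "has_arc (normalized_units H) q p" unfolding has_arc_def using xyc ox oy conj by blast
    then have "has_arc H q p" by (rule unit_orders_realizedD(2)[OF H pq])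
    then show False using has_arc_lift[OF fin(1) surj pq qp(1)] no by blast
  qed
  then have pN: "p dvd card (kernel G H h)"
    using prime_ord_unit_in_kernel_dvd[OF fin pq(1) xy(1,3)] by (simp add: normalized_units_simps)
  moreover have "q dvd card (kernel G H h)"
  proof (rule ccontr)
    assume nq: "\<not> q dvd card (kernel G H h)"
    have "has_ord (normalized_units G) q" using xy(2,4) unfolding has_ord_def by blast
    then have "q dvd order G" by (rule G.prime_ord_unit_dvd_order[OF fin(1) pq(2)])
    then obtain g where g: "g \<in> carrier G" "G.ord g = q"
      using G.cauchy[OF fin(1) pq(2)] unfolding has_ord_def by blast
    have "has_arc G q p"
    proof (rule G.has_arc_if_normalizes[OF fin(1) subgroup_kernel pN pq(1,2) qp(1) g(1)])
      show "g \<otimes> l \<otimes> inv g \<in> kernel G H h" if "l \<in> kernel G H h" for l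
        using G.normal_invE(2)[OF normal_kernel g(1) that] .
      show "q dvd m" if m: "g [^] m \<in> kernel G H h" for m :: nat
      proof (rule ccontr)
        assume "\<not> q dvd m"
        then have "g [^] m \<noteq> \<one>" using G.pow_eq_id[OF g(1)] g(2) by blast
        moreover have "(g [^] m) [^] q = \<one>"
          using g G.pow_eq_id[OF g(1), of "m * q"] by (simp add: G.nat_pow_pow)
        ultimately have "G.ord (g [^] m) = q"
          using G.ord_prime_iff[OF _ pq(2), of "g [^] m"] g(1) by blast
        then show False using G.ord_dvd_card_subgroup[OF subgroup_kernel m] nq by simp
      qed
    qed
    then show False using no by blast
  qed
  ultimately show ?thesis by blast
qed

text \<open>Quotients are presented as epimorphisms onto groups over a fixed type \<open>'c\<close>:
  iterating \<open>Mod\<close> would change the type of the elements in every round of the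
  induction.\<close>

lemma unit_orders_realized_step:
  fixes G :: "'a monoid"
  assumes G: "group G" and fin: "finite (carrier G)" and not_as: "\<not> almost_simple G"
    and quot: "\<And>N. N \<lhd> G \<Longrightarrow> N \<noteq> {\<one>\<^bsub>G\<^esub>} \<Longrightarrow>
      \<exists>(K :: 'c monoid) h. group K \<and> h \<in> epi G K \<and> kernel G K h = N \<and> unit_orders_realized K"
  shows "unit_orders_realized G"
proof -
  interpret group G by fact
  interpret V: group "normalized_units G" by (rule group_normalized_units[OF G fin])
  have nontriv: "carrier G \<noteq> {\<one>\<^bsub>G\<^esub>}" if "Factorial_Ring.prime p" "has_ord (normalized_units G) p" for p
  proof
    assume "carrier G = {\<one>\<^bsub>G\<^esub>}"
    then have "order G = 1" by (simp add: Coset.order_def)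
    then show False using prime_ord_unit_dvd_order[OF fin that] that(1) by simp
  qed
  have realized_ord: "has_ord G (p * q)"
    if pq: "Factorial_Ring.prime p" "Factorial_Ring.prime q" "p \<noteq> q"
      and u: "has_ord (normalized_units G) (p * q)" for p q
  proof (rule ccontr)
    assume no: "\<not> has_ord G (p * q)"
    have "p dvd card N \<and> q dvd card N" if N: "N \<lhd> G" "N \<noteq> {\<one>\<^bsub>G\<^esub>}" for N
    proof -
      obtain K :: "'c monoid" and h where K: "group K" "h \<in> epi G K" "kernel G K h = N" "unit_orders_realized K"
        using quot[OF N] by blast
      then have surj: "h ` carrier G = carrier K" and hom: "h \<in> hom G K" by (auto simp: epi_def)
      interpret h: group_hom G K h using G K(1) hom by (simp add: group_hom_def group_hom_axioms_def)
      have "finite (carrier K)" using surj fin by (metis finite_imageI)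
      from h.prime_divisors_of_kernel_if_no_ord[OF fin this surj K(4) pq u no] show ?thesis
        unfolding K(3) .
    qed
    moreover have "has_arc (normalized_units G) q p" by (rule V.has_arc_if_has_ord_mult[OF pq(1,2) u])
    then have "has_ord (normalized_units G) p" unfolding has_arc_def has_ord_def by blast
    ultimately show False
      using almost_simple_if_all_normal_subgroups_dvd[OF G fin nontriv[OF pq(1)] pq no] not_as by blast
  qed
  have realized_arc: "has_arc G q p"
    if pq: "Factorial_Ring.prime p" "Factorial_Ring.prime q" "p \<noteq> q"
      and arc: "has_arc (normalized_units G) q p" for p q
  proof (rule ccontr)
    assume no: "\<not> has_arc G q p"
    then have no_ord: "\<not> has_ord G (p * q)" using has_arc_if_has_ord_mult[OF pq(1,2)] by blast
    \<comment> \<open>The part on orders, already proved for \<open>G\<close>, excludes commuting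
      pairs among the units, so the arc comes from a non-trivial action.\<close>
    then have no_ord': "\<not> has_ord (normalized_units G) (p * q)" using realized_ord[OF pq] by blast
    have "p dvd card N \<and> q dvd card N" if N: "N \<lhd> G" "N \<noteq> {\<one>\<^bsub>G\<^esub>}" for N
    proof -
      obtain K :: "'c monoid" and h where K: "group K" "h \<in> epi G K" "kernel G K h = N" "unit_orders_realized K"
        using quot[OF N] by blast
      then have surj: "h ` carrier G = carrier K" and hom: "h \<in> hom G K" by (auto simp: epi_def)
      interpret h: group_hom G K h using G K(1) hom by (simp add: group_hom_def group_hom_axioms_def)
      have "finite (carrier K)" using surj fin by (metis finite_imageI)
      from h.prime_divisors_of_kernel_if_no_arc[OF fin this surj K(4) pq arc no no_ord'] show ?thesis
        unfolding K(3) .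
    qed
    moreover have "has_ord (normalized_units G) p" using arc unfolding has_arc_def has_ord_def by blast
    ultimately show False
      using almost_simple_if_all_normal_subgroups_dvd[OF G fin nontriv[OF pq(1)] pq no_ord] not_as by blast
  qed
  show ?thesis unfolding unit_orders_realized_def using realized_ord realized_arc by blast
qed

section \<open>Invariance under isomorphism, and induction over quotients\<close>

lemma (in group_hom) inj_on_pushforward:
  assumes "inj_on h (carrier G)"
  shows "inj_on (pushforward G h) (carrier (normalized_units G))"
proof (rule inj_onI)
  fix u v assume u: "u \<in> carrier (normalized_units G)" and v: "v \<in> carrier (normalized_units G)"
    and eq: "pushforward G h u = pushforward G h v"
  have push: "pushforward G h f (h g) = f g" if "g \<in> carrier G" for f g
  proof -
    have "{x \<in> carrier G. h x = h g} = {g}" using assms that by (auto dest: inj_onD)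
    then show ?thesis by (simp add: pushforward_def)
  qed
  show "u = v"
  proof
    fix x
    show "u x = v x"
    proof (cases "x \<in> carrier G")
      case True
      then show ?thesis using push[OF True, of u] push[OF True, of v] eq by simp
    next
      case False
      then show ?thesis
        using normalized_units_carrier(1)[OF u] normalized_units_carrier(1)[OF v]
        by (simp add: G.int_group_ring_simps)
    qed
  qed
qed

lemma unit_orders_realized_iso:
  assumes "group G" "finite (carrier G)" "group H" and h: "h \<in> iso G H" and H: "unit_orders_realized H"
  shows "unit_orders_realized G"
proof -
  have hom: "h \<in> hom G H" and inj: "inj_on h (carrier G)" and surj: "h ` carrier G = carrier H"
    using h by (auto simp: iso_iff)
  interpret group_hom G H h using assms(1,3) hom by (simp add: group_hom_def group_hom_axioms_def)
  have finH: "finite (carrier H)" using surj assms(2) by (metis finite_imageI)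
  interpret V: group "normalized_units G" by (rule group_normalized_units[OF assms(1,2)])
  interpret W: group "normalized_units H" by (rule group_normalized_units[OF assms(3) finH])
  note push = pushforward_hom[OF assms(2) finH] inj_on_pushforward[OF inj]
  have inv: "inv_into (carrier G) h \<in> hom H G" "inj_on (inv_into (carrier G) h) (carrier H)"
    using G.iso_set_sym[OF h] unfolding Group.iso_iff by blast+
  show ?thesis unfolding unit_orders_realized_def
  proof (intro allI impI conjI)
    fix p q :: nat assume pq: "Factorial_Ring.prime p" "Factorial_Ring.prime q" "p \<noteq> q"
    show "has_ord G (p * q)" if "has_ord (normalized_units G) (p * q)"
      by (rule has_ord_inj_hom[OF assms(3,1) inv unit_orders_realizedD(1)[OF H pq
            has_ord_inj_hom[OF V.is_group W.is_group push that]]])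
    show "has_arc G q p" if "has_arc (normalized_units G) q p"
      by (rule has_arc_inj_hom[OF assms(3,1) inv unit_orders_realizedD(2)[OF H pq
            has_arc_inj_hom[OF V.is_group W.is_group push that]]])
  qed
qed

text \<open>Induction from larger to smaller \<open>N\<close>. All quotients are taken of the fixed
  \<open>G\<close>, so their elements have type \<open>'a set\<close>, as in the hypothesis on
  almost simple images; a quotient of \<open>G Mod N\<close> by \<open>S\<close> is replaced by
  \<open>G Mod M\<close> for the full preimage \<open>M\<close> of \<open>S\<close>.\<close>

lemma unit_orders_realized_Mod:
  fixes G :: "('a, 'b) monoid_scheme"
  assumes G: "group G" and fin: "finite (carrier G)"
    and as: "\<And>(H :: 'a set monoid) f. group H \<Longrightarrow> f \<in> epi G H \<Longrightarrow> almost_simple H \<Longrightarrow> NPQ H"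
    and "N \<lhd> G"
  shows "unit_orders_realized (G Mod N)"
  using \<open>N \<lhd> G\<close>
proof (induction "order G - card N" arbitrary: N rule: less_induct)
  case less
  interpret group G by fact
  interpret N: normal N G by (rule less.prems)
  let ?Q = "G Mod N"
  have Q: "group ?Q" by (rule N.factorgroup_is_group)
  have pi: "(\<lambda>a. N #>\<^bsub>G\<^esub> a) \<in> epi G ?Q"
    using N.r_coset_hom_Mod by (simp add: epi_def carrier_FactGroup)
  have finQ: "finite (carrier ?Q)" using fin by (simp add: carrier_FactGroup)
  show ?case
  proof (cases "almost_simple ?Q")
    case True
    then show ?thesis using unit_orders_realized_if_NPQ[OF Q finQ] as[OF Q pi] by blast
  next
    case False
    show ?thesis
    proof (rule unit_orders_realized_step[OF Q finQ False])
      fix S assume S: "S \<lhd> ?Q" "S \<noteq> {\<one>\<^bsub>?Q\<^esub>}"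
      note subS = normal_imp_subgroup[OF S(1)]
      note SI = subgroup.one_closed[OF subS] subgroup.m_closed[OF subS] subgroup.m_inv_closed[OF subS]
      define M where "M = {g \<in> carrier G. N #>\<^bsub>G\<^esub> g \<in> S}"
      interpret \<pi>: group_hom G ?Q "\<lambda>a. N #>\<^bsub>G\<^esub> a"
        using N.r_coset_hom_Mod G Q by (simp add: group_hom_def group_hom_axioms_def)
      have M: "M \<lhd> G"
      proof (rule normal_invI)
        show "subgroup M G"
        proof
          fix a b assume "a \<in> M" "b \<in> M"
          then show "a \<otimes>\<^bsub>G\<^esub> b \<in> M" using \<pi>.hom_mult[of a b] SI(2)[of "N #>\<^bsub>G\<^esub> a" "N #>\<^bsub>G\<^esub> b"] by (simp add: M_def)
        next
          fix a assume "a \<in> M"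
          then show "inv\<^bsub>G\<^esub> a \<in> M" using \<pi>.hom_inv[of a] SI(3)[of "N #>\<^bsub>G\<^esub> a"] by (simp add: M_def)
        next
          show "\<one>\<^bsub>G\<^esub> \<in> M" using \<pi>.hom_one SI(1) by (simp add: M_def)
        qed (auto simp: M_def)
        fix g x assume g: "g \<in> carrier G" and x: "x \<in> M"
        have xc: "x \<in> carrier G" and xS: "N #>\<^bsub>G\<^esub> x \<in> S" using x by (auto simp: M_def)
        have "(N #>\<^bsub>G\<^esub> g) \<otimes>\<^bsub>?Q\<^esub> (N #>\<^bsub>G\<^esub> x) \<otimes>\<^bsub>?Q\<^esub> inv\<^bsub>?Q\<^esub> (N #>\<^bsub>G\<^esub> g) \<in> S"
          by (rule group.normal_invE(2)[OF Q S(1) _ xS]) (use \<pi>.hom_closed[OF g] in simp)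
        moreover have "N #>\<^bsub>G\<^esub> (g \<otimes>\<^bsub>G\<^esub> x \<otimes>\<^bsub>G\<^esub> inv\<^bsub>G\<^esub> g) =
            (N #>\<^bsub>G\<^esub> g) \<otimes>\<^bsub>?Q\<^esub> (N #>\<^bsub>G\<^esub> x) \<otimes>\<^bsub>?Q\<^esub> inv\<^bsub>?Q\<^esub> (N #>\<^bsub>G\<^esub> g)"
          using \<pi>.hom_mult[of "g \<otimes>\<^bsub>G\<^esub> x" "inv\<^bsub>G\<^esub> g"] \<pi>.hom_mult[of g x] \<pi>.hom_inv[OF g] g xc
          by (simp only: m_closed inv_closed)
        ultimately show "g \<otimes>\<^bsub>G\<^esub> x \<otimes>\<^bsub>G\<^esub> inv\<^bsub>G\<^esub> g \<in> M" using g xc by (simp add: M_def)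
      qed
      interpret M: normal M G by (rule M)
      let ?K = "G Mod M"
      have K: "group ?K" by (rule M.factorgroup_is_group)
      interpret \<mu>: group_hom G ?K "\<lambda>a. M #>\<^bsub>G\<^esub> a"
        using M.r_coset_hom_Mod G K by (simp add: group_hom_def group_hom_axioms_def)
      have NM: "N \<subseteq> M"
      proof
        fix x assume x: "x \<in> N"
        then have xc: "x \<in> carrier G" by (rule N.mem_carrier)
        have "N #>\<^bsub>G\<^esub> x = N" by (rule coset_join2[OF xc N.subgroup_axioms x])
        then have "N #>\<^bsub>G\<^esub> x \<in> S" using SI(1) by (simp only: one_FactGroup)
        with xc show "x \<in> M" unfolding M_def by blast
      qed
      have kerM: "M #>\<^bsub>G\<^esub> x = M \<longleftrightarrow> x \<in> M" if "x \<in> carrier G" for x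
        using coset_join1[OF _ that M.subgroup_axioms] coset_join2[OF that M.subgroup_axioms] by (rule iffI)
      have "N \<subseteq> kernel G ?K (\<lambda>a. M #>\<^bsub>G\<^esub> a)"
      proof
        fix x assume x: "x \<in> N"
        then have "M #>\<^bsub>G\<^esub> x = M" using kerM[OF N.mem_carrier[OF x]] NM by blast
        then show "x \<in> kernel G ?K (\<lambda>a. M #>\<^bsub>G\<^esub> a)" using x by (simp add: kernel_def)
      qed
      \<comment> \<open>The map from \<open>G Mod N\<close> to \<open>G Mod M\<close> of the third
        isomorphism theorem; its kernel is \<open>S\<close>.\<close>
      then obtain f where f: "f \<in> hom ?Q ?K" "\<And>x. x \<in> carrier G \<Longrightarrow> f (N #>\<^bsub>G\<^esub> x) = M #>\<^bsub>G\<^esub> x"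
        using \<mu>.FactGroup_universal_kernel[OF less.prems] by blast
      have "f ` carrier ?Q = carrier ?K"
        using f(2) by (simp add: carrier_FactGroup image_image)
      then have epi: "f \<in> epi ?Q ?K" using f(1) by (simp add: epi_def)
      have ker: "kernel ?Q ?K f = S"
      proof (intro equalityI subsetI)
        fix s assume "s \<in> kernel ?Q ?K f"
        then obtain x where x: "x \<in> carrier G" "s = N #>\<^bsub>G\<^esub> x" "f s = M"
          by (auto simp: kernel_def carrier_FactGroup)
        then have "x \<in> M" using f(2)[OF x(1)] kerM[OF x(1)] by simp
        then show "s \<in> S" unfolding x(2) M_def by blast
      next
        fix s assume s: "s \<in> S"
        then obtain x where x: "x \<in> carrier G" "s = N #>\<^bsub>G\<^esub> x"
          using subgroup.subset[OF subS] by (auto simp: carrier_FactGroup)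
        have "x \<in> M" using s x(1) unfolding x(2) M_def by blast
        then have "f s = M" unfolding x(2) f(2)[OF x(1)] kerM[OF x(1)] .
        moreover have "s \<in> carrier ?Q" by (rule subsetD[OF subgroup.subset[OF subS] s])
        ultimately show "s \<in> kernel ?Q ?K f" by (simp add: kernel_def)
      qed
      have finM: "finite M" using M.subset fin finite_subset by blast
      have "M \<noteq> N"
      proof
        assume eq: "M = N"
        have "s = N" if s: "s \<in> S" for s
        proof -
          obtain x where x: "x \<in> carrier G" "s = N #>\<^bsub>G\<^esub> x"
            using subgroup.subset[OF subS] s by (auto simp: carrier_FactGroup)
          have "x \<in> M" using s x(1) unfolding x(2) M_def by blast
          then have "x \<in> N" unfolding eq .
          then have "N #>\<^bsub>G\<^esub> x = N" by (rule coset_join2[OF x(1) N.subgroup_axioms])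
          then show ?thesis unfolding x(2) .
        qed
        moreover have "N \<in> S" using SI(1) by simp
        ultimately have "S = {N}" by blast
        then show False using S(2) by simp
      qed
      then have "card N < card M" using NM finM by (intro psubset_card_mono) auto
      moreover have "card M \<le> order G" unfolding Coset.order_def using M.subset fin by (rule card_mono[rotated])
      ultimately have "unit_orders_realized ?K" by (intro less.hyps M) simp
      then show "\<exists>(K :: 'a set monoid) h. group K \<and> h \<in> epi ?Q K \<and> kernel ?Q K h = S \<and> unit_orders_realized K"
        using K epi ker by blast
    qed
  qed
qed

text \<open>The quotient by the trivial subgroup moves \<open>G\<close> from type \<open>'a\<close>
  to type \<open>'a set\<close>, where the induction takes place; this also covers an almost simple
  \<open>G\<close>.\<close>

lemma (in group) iso_Mod_one: "(\<lambda>a. {\<one>} #> a) \<in> iso G (G Mod {\<one>})"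
proof -
  interpret N: normal "{\<one>}" G by (rule one_is_normal)
  have "inj_on (\<lambda>a. {\<one>} #> a) (carrier G)" by (rule inj_onI) (auto simp: r_coset_def)
  then show ?thesis using N.r_coset_hom_Mod by (simp add: iso_def bij_betw_def carrier_FactGroup)
qed

theorem theorem1:
  fixes G :: "('a, 'b) monoid_scheme"
  assumes "group G" and "finite (carrier G)"
    and "\<And>(H :: 'a set monoid) f. group H \<Longrightarrow> f \<in> epi G H \<Longrightarrow> almost_simple H \<Longrightarrow> NPQ H"
  shows "NPQ G"
proof -
  interpret group G by fact
  interpret V: group "normalized_units G" by (rule group_normalized_units[OF assms(1,2)])
  interpret N: normal "{\<one>\<^bsub>G\<^esub>}" G by (rule one_is_normal)
  have real: "unit_orders_realized G"
  proof (rule unit_orders_realized_iso[OF assms(1,2) N.factorgroup_is_group iso_Mod_one])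
    show "unit_orders_realized (G Mod {\<one>\<^bsub>G\<^esub>})"
      by (rule unit_orders_realized_Mod[OF assms(1,2) _ one_is_normal]) (rule assms(3))
  qed
  note emb = of_elem_hom[OF assms(2)]
  have "prime_set G = prime_set (normalized_units G)"
  proof -
    \<comment> \<open>A unit of prime order \<open>p\<close> forces \<open>p\<close> to divide the
      order of \<open>G\<close>, and Cauchy's theorem returns an element of order \<open>p\<close>;
      the embedding gives the converse.\<close>
    have "has_ord G p \<longleftrightarrow> has_ord (normalized_units G) p" if "Factorial_Ring.prime p" for p
      using has_ord_inj_hom[OF assms(1) V.is_group emb] cauchy[OF assms(2) that]
        prime_ord_unit_dvd_order[OF assms(2) that] by blast
    then show ?thesis by (auto simp: prime_set_def has_ord_def)
  qed
  moreover have "parcs (N_prime_graph G) = parcs (N_prime_graph (normalized_units G))"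
  proof -
    have "has_arc G q p \<longleftrightarrow> has_arc (normalized_units G) q p"
      if "Factorial_Ring.prime p" "Factorial_Ring.prime q" "p \<noteq> q" for p q
      using has_arc_inj_hom[OF assms(1) V.is_group emb] unit_orders_realizedD(2)[OF real that] by blast
    then show ?thesis
      unfolding N_prime_graph_arcs[OF assms(1)] N_prime_graph_arcs[OF V.is_group] by blast
  qed
  ultimately show ?thesis
    unfolding NPQ_def by (intro pair_pre_digraph.equality) (simp_all add: N_prime_graph_def)
qed

end
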